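(* Let $\Omega\subset\mathbb{R}^n$, $n\in\{2,3\}$, be a bounded radial domain (a ball or an annulus centered at the origin) and let $\beta\leq-1$. Let $(u_1,\dots,u_N)$ be a non-trivial radial solution of $$ \left\{ \begin{array}{l} -\Delta u_{j}+ u_{j}= u^{3}_{j}+\beta\sum_{i=1, i\neq j}^N u_{j}u_{i}^{2} \quad \text{in } \Omega,\\ u_{j}\in H_{0}^{1}(\Omega), \qquad j=1,\dots,N. \end{array} \right. $$ Then for any $i_1,i_2\in\{1,\dots,N\}$ with $i_1\neq i_2$: (1) $n(u_{i_1} - u_{i_2})\geq 1$ when $n(u_{i_1})=n(u_{i_2})=0$; (2) $n(u_{i_1} - u_{i_2})\geq\Big[\frac{\min\{n(u_{i_1}),n(u_{i_2})\}-1}{2}\Big]$ when one of $n(u_{i_1})$ and $n(u_{i_2})$ is non-zero, where $[a]$ denotes the integer part of $a$.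
   Context: A solution $(u_1,\dots,u_N)$ is called non-trivial if none of its components is identically zero. For a continuous radial function $u$, the nodal number $n(u)$ is the largest integer $k$ such that there exist radii $0<x_0<x_1<\dots<x_k$ with $u|_{|x|=x_j}\cdot u|_{|x|=x_{j+1}}<0$ for $j=0,\dots,k-1$ (i.e. the number of sign changes in the radial variable).
   Formalization: In (1) it is additionally assumed that u_{i_1} and u_{i_2} have the same (weak) sign, i.e. u_{i_1}u_{i_2} ≥ 0 in Ω away from the origin; for opposite signs (1) is false, since from a positive solution (u_1,u_2) one gets the solution (u_1,-u_2). *)

theory Defs
  imports "HOL-Analysis.Analysis"
begin

definition radial_domain :: "'a::euclidean_space set \<Rightarrow> bool" where
  "radial_domain \<Omega> \<longleftrightarrow>
     (\<exists>R>0. \<Omega> = ball 0 R) \<or>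
     (\<exists>a b. 0 < a \<and> a < b \<and> \<Omega> = {x. a < norm x \<and> norm x < b})"

definition radial_on :: "'a::euclidean_space set \<Rightarrow> ('a \<Rightarrow> real) \<Rightarrow> bool" where
  "radial_on \<Omega> u \<longleftrightarrow> (\<forall>x\<in>\<Omega>. \<forall>y\<in>\<Omega>. norm x = norm y \<longrightarrow> u x = u y)"

definition grad :: "('a::euclidean_space \<Rightarrow> real) \<Rightarrow> 'a \<Rightarrow> 'a" where
  "grad f x = (THE D. GDERIV f x :> D)"

primrec times_cont_diff :: "nat \<Rightarrow> ('a::euclidean_space \<Rightarrow> real) \<Rightarrow> bool" where
  "times_cont_diff 0 f \<longleftrightarrow> continuous_on UNIV f"
| "times_cont_diff (Suc k) f \<longleftrightarrow>
     (\<exists>g. (\<forall>x. GDERIV f x :> g x) \<and> (\<forall>b\<in>Basis. times_cont_diff k (\<lambda>x. g x \<bullet> b)))"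

text \<open>The space of smooth functions with compact support in \<open>\<Omega>\<close> (extended by zero).\<close>

definition test_functions :: "'a::euclidean_space set \<Rightarrow> ('a \<Rightarrow> real) set" where
  "test_functions \<Omega> =
     {\<phi>. (\<forall>k. times_cont_diff k \<phi>) \<and>
          compact (closure {x. \<phi> x \<noteq> 0}) \<and> closure {x. \<phi> x \<noteq> 0} \<subseteq> \<Omega>}"

definition square_integrable_on ::
  "'a::euclidean_space set \<Rightarrow> ('a \<Rightarrow> 'b::euclidean_space) \<Rightarrow> bool" where
  "square_integrable_on \<Omega> f \<longleftrightarrow>
     f \<in> borel_measurable (lebesgue_on \<Omega>) \<and>
     integrable (lebesgue_on \<Omega>) (\<lambda>x. (norm (f x))\<^sup>2)"

text \<open>\<open>H1_gradient \<Omega> u G\<close>: the function \<open>u\<close> belongs to \<open>H\<^sup>1(\<Omega>)\<close> and \<open>G\<close> is its weak gradient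
  (unique up to null sets).\<close>

definition H1_gradient ::
  "'a::euclidean_space set \<Rightarrow> ('a \<Rightarrow> real) \<Rightarrow> ('a \<Rightarrow> 'a) \<Rightarrow> bool" where
  "H1_gradient \<Omega> u G \<longleftrightarrow>
     square_integrable_on \<Omega> u \<and> square_integrable_on \<Omega> G \<and>
     (\<forall>\<phi>\<in>test_functions \<Omega>.
        (LINT x|lebesgue_on \<Omega>. u x *\<^sub>R grad \<phi> x) = - (LINT x|lebesgue_on \<Omega>. \<phi> x *\<^sub>R G x))"

text \<open>\<open>H\<^sub>0\<^sup>1(\<Omega>)\<close> is the closure of the test functions in the norm of \<open>H\<^sup>1(\<Omega>)\<close>;
  \<open>H10_gradient \<Omega> u G\<close> says that \<open>u\<close> belongs to it and has weak gradient \<open>G\<close>.\<close>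

definition H10_gradient ::
  "'a::euclidean_space set \<Rightarrow> ('a \<Rightarrow> real) \<Rightarrow> ('a \<Rightarrow> 'a) \<Rightarrow> bool" where
  "H10_gradient \<Omega> u G \<longleftrightarrow>
     H1_gradient \<Omega> u G \<and>
     (\<exists>\<phi>. (\<forall>k::nat. \<phi> k \<in> test_functions \<Omega>) \<and>
        (\<lambda>k. LINT x|lebesgue_on \<Omega>. (u x - \<phi> k x)\<^sup>2 + (norm (G x - grad (\<phi> k) x))\<^sup>2)
          \<longlonglongrightarrow> 0)"

text \<open>Weak solutions in \<open>H\<^sub>0\<^sup>1(\<Omega>)\<close> of
  \<open>- \<Delta> u\<^sub>j + u\<^sub>j = u\<^sub>j\<^sup>3 + \<beta> \<Sum>\<^sub>i\<^sub>\<noteq>\<^sub>j u\<^sub>j u\<^sub>i\<^sup>2\<close>.  In dimensions 2 and 3 the cubic terms are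
  integrable on \<open>\<Omega>\<close> by the Sobolev embedding into \<open>L\<^sup>6\<close>.\<close>

definition weak_solution ::
  "'a::euclidean_space set \<Rightarrow> real \<Rightarrow> nat \<Rightarrow> (nat \<Rightarrow> 'a \<Rightarrow> real) \<Rightarrow> bool" where
  "weak_solution \<Omega> \<beta> N u \<longleftrightarrow>
     (\<forall>j\<in>{1..N}. \<exists>G. H10_gradient \<Omega> (u j) G \<and>
        (\<forall>\<phi>\<in>test_functions \<Omega>.
           (LINT x|lebesgue_on \<Omega>. G x \<bullet> grad \<phi> x + u j x * \<phi> x) =
           (LINT x|lebesgue_on \<Omega>.
              (u j x ^ 3 + \<beta> * (\<Sum>i\<in>{1..N} - {j}. u j x * (u i x)\<^sup>2)) * \<phi> x)))"

text \<open>A radial element of \<open>H\<^sup>1(\<Omega>)\<close> has a unique representative that is continuous on \<open>\<Omega> - {0}\<close>;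
  continuity at the origin (for a ball) is not required of this representative, since its nodal
  number depends only on its values at positive radii.\<close>

definition radial_solution ::
  "'a::euclidean_space set \<Rightarrow> real \<Rightarrow> nat \<Rightarrow> (nat \<Rightarrow> 'a \<Rightarrow> real) \<Rightarrow> bool" where
  "radial_solution \<Omega> \<beta> N u \<longleftrightarrow>
     weak_solution \<Omega> \<beta> N u \<and>
     (\<forall>j\<in>{1..N}. radial_on \<Omega> (u j) \<and> continuous_on (\<Omega> - {0}) (u j))"

definition nontrivial ::
  "'a::euclidean_space set \<Rightarrow> nat \<Rightarrow> (nat \<Rightarrow> 'a \<Rightarrow> real) \<Rightarrow> bool" where
  "nontrivial \<Omega> N u \<longleftrightarrow> (\<forall>j\<in>{1..N}. \<not> (AE x in lebesgue_on \<Omega>. u j x = 0))"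

text \<open>The largest \<open>k\<close> for which there are radii \<open>0 < r 0 < \<dots> < r k\<close>, of spheres contained
  in \<open>\<Omega>\<close>, with opposite strict signs of \<open>u\<close> on consecutive spheres.  The value is unspecified
  if \<open>u\<close> changes sign infinitely often.\<close>

definition nodal_number :: "'a::euclidean_space set \<Rightarrow> ('a \<Rightarrow> real) \<Rightarrow> nat" where
  "nodal_number \<Omega> u =
     (GREATEST k. \<exists>r::nat \<Rightarrow> real.
        0 < r 0 \<and> (\<forall>j<k. r j < r (Suc j)) \<and> (\<forall>j\<le>k. sphere 0 (r j) \<subseteq> \<Omega>) \<and>
        (\<forall>j<k. \<forall>y\<in>sphere 0 (r j). \<forall>z\<in>sphere 0 (r (Suc j)). u y * u z < 0))"

end

theory Submission
  imports Defs
begin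

text \<open>
  The idea is to compare two components \<open>f\<close>, \<open>g\<close> and their difference by Sturm's method. As functions of
  \<open>r = |x|\<close>, all three solve linear equations \<open>(r\<^sup>n\<^sup>-\<^sup>1 z')' = r\<^sup>n\<^sup>-\<^sup>1 V z\<close>, where the potential of
  \<open>g\<close> exceeds the potential of \<open>f - g\<close> by \<open>(1 - \<beta>) f (f + g)\<close>
  (lemmas \<open>competing_pair_diff\<close>, \<open>potential_difference\<close>). Suppose that \<open>g\<close> is positive between
  two of its zeros and \<open>f \<ge> g\<close> there. Then \<open>f - g\<close> is nonnegative although it oscillates faster than
  \<open>g\<close>, so Sturm comparison leaves only \<open>f = g\<close>. But then \<open>\<beta> \<le> -1\<close> makes the potential of \<open>g\<close> at
  least 1, and \<open>g\<close> cannot have two zeros. Hence \<open>f < g\<close> somewhere on each interior positive nodal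
  interval of \<open>g\<close> and, by symmetry, \<open>f > g\<close> somewhere on each negative one
  (\<open>no_domination_on_nodal_interval\<close>). If \<open>g\<close> changes sign \<open>m\<close> times it has \<open>m - 1\<close> interior nodal
  intervals of alternating sign, so \<open>f - g\<close> changes sign at least \<open>m - 2\<close> times
  (\<open>alternates_difference\<close>). This is at least \<open>[(m - 1) / 2]\<close> for \<open>m \<ge> 3\<close>, and for smaller \<open>m\<close> that
  bracket is at most 0.

  If \<open>f\<close> and \<open>g\<close> do not change sign, the same argument is run on the whole domain: if \<open>f - g\<close> had a
  sign, then up to symmetry \<open>f \<ge> g > 0\<close>. Instead of zeros at the ends one uses that \<open>g\<close> is a
  principal solution at both ends, that is, \<open>1 / (r\<^sup>n\<^sup>-\<^sup>1 g\<^sup>2)\<close> is not integrable there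
  (\<open>sturm_principal\<close>, \<open>no_global_domination\<close>).

  Two facts about radial functions \<open>u\<close> in \<open>H\<^sub>0\<^sup>1\<close> connect this with weak solutions. The first is the
  decay \<open>u\<^sup>2 \<le> K q\<close>, where \<open>q(r)\<close> is the integral of \<open>t\<^sup>1\<^sup>-\<^sup>n\<close> between \<open>r\<close> and a boundary radius
  (\<open>radial_H10_small_at_ends\<close>). It gives the principal behaviour at the ends. As \<open>q = O(1 / r)\<close>
  towards the centre, it also bounds the potentials below by \<open>- C / r\<close>. Then nodal intervals have
  length at least \<open>1 / C\<close> (\<open>nodal_interval_length\<close>), sign changes do not accumulate, not even at the
  centre of a ball, and the nodal numbers are genuine maxima. The second fact is that the profile
  satisfies the radial equation in the classical sense (\<open>weak_solution_radial_ode\<close>). Both come from one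
  identity: testing the weak gradient of \<open>u\<close> against a radial vector field \<open>\<theta>(r) / r\<^sup>n x\<close>
  (\<open>radial_divergence\<close>), which for \<open>u \<in> H\<^sub>0\<^sup>1\<close> holds even if \<open>\<theta>\<close> does not vanish on the boundary.
\<close>

section \<open>Radial equations and Sturm comparison\<close>

text \<open>
  The equation \<open>(r\<^sup>k z')' = r\<^sup>k V z\<close> for \<open>k = n - 1\<close>, as a first-order system with the flux
  \<open>p = r\<^sup>k z'\<close>. It is required at the points of \<open>I\<close> with two-sided derivatives, so on a
  closed interval it includes the equation at the end points.
\<close>

definition radial_ode ::
  "nat \<Rightarrow> real set \<Rightarrow> (real \<Rightarrow> real) \<Rightarrow> (real \<Rightarrow> real) \<Rightarrow> (real \<Rightarrow> real) \<Rightarrow> bool" where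
  "radial_ode k I V z p \<longleftrightarrow>
     (\<forall>r\<in>I. (z has_real_derivative p r / r ^ k) (at r) \<and>
            (p has_real_derivative r ^ k * V r * z r) (at r))"

lemma radial_ode_subset: "radial_ode k I V z p \<Longrightarrow> J \<subseteq> I \<Longrightarrow> radial_ode k J V z p"
  unfolding radial_ode_def by blast

lemma radial_ode_uminus:
  "radial_ode k I V z p \<Longrightarrow> radial_ode k I V (\<lambda>r. - z r) (\<lambda>r. - p r)"
  unfolding radial_ode_def by (auto intro!: derivative_eq_intros)

lemma radial_ode_const: "radial_ode k I (\<lambda>_. 0) (\<lambda>_. 1) (\<lambda>_. 0)"
  unfolding radial_ode_def by auto

lemma radial_ode_continuous: "radial_ode k I V z p \<Longrightarrow> continuous_on I z"
  unfolding radial_ode_def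
  by (intro continuous_at_imp_continuous_on) (auto intro: DERIV_isCont)

text \<open>
  \<open>p \<phi> - z q = r\<^sup>k (z' \<phi> - z \<phi>')\<close> is the Wronskian in flux form; only the difference of the
  two potentials survives in its derivative. All comparison arguments below are statements about
  the monotonicity of this function.
\<close>

lemma wronskian_derivative:
  assumes "radial_ode k I V z p" "radial_ode k I V' \<phi> q" "r \<in> I"
  shows "((\<lambda>r. p r * \<phi> r - z r * q r) has_real_derivative
          r ^ k * (V r - V' r) * z r * \<phi> r) (at r)"
proof -
  have "(z has_real_derivative p r / r ^ k) (at r)" "(p has_real_derivative r ^ k * V r * z r) (at r)"
    "(\<phi> has_real_derivative q r / r ^ k) (at r)" "(q has_real_derivative r ^ k * V' r * \<phi> r) (at r)"
    using assms unfolding radial_ode_def by auto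
  from this(1,2) this(3,4) show ?thesis
    by (auto intro!: derivative_eq_intros simp: algebra_simps)
qed

lemma quotient_derivative:
  assumes "radial_ode k I V z p" "radial_ode k I V' \<phi> q" "r \<in> I" "r \<noteq> 0" "z r \<noteq> 0"
  shows "((\<lambda>r. \<phi> r / z r) has_real_derivative
          - (p r * \<phi> r - z r * q r) / (r ^ k * (z r)\<^sup>2)) (at r)"
proof -
  have "(z has_real_derivative p r / r ^ k) (at r)" "(\<phi> has_real_derivative q r / r ^ k) (at r)"
    using assms unfolding radial_ode_def by auto
  then show ?thesis using assms(4,5)
    by (auto intro!: derivative_eq_intros simp: field_simps power2_eq_square)
qed

text \<open>
  Sturm comparison on a nodal interval of \<open>z\<close>. The Wronskian is nondecreasing because
  \<open>V' \<le> V\<close>, but it is nonnegative at the left end, where \<open>z\<close> leaves zero upwards, and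
  nonpositive at the right end. So it vanishes identically, and with it its derivative. The usual
  conclusion that \<open>\<phi>\<close> has a zero follows whenever the two potentials differ.
\<close>

lemma sturm:
  assumes z: "radial_ode k {c..d} V z p" and \<phi>: "radial_ode k {c..d} V' \<phi> q"
    and c: "0 < c" "c < d" and ends: "z c = 0" "z d = 0"
    and pos: "\<And>r. c < r \<Longrightarrow> r < d \<Longrightarrow> 0 < z r"
    and \<phi>0: "\<And>r. c \<le> r \<Longrightarrow> r \<le> d \<Longrightarrow> 0 \<le> \<phi> r"
    and V: "\<And>r. c < r \<Longrightarrow> r < d \<Longrightarrow> V' r \<le> V r"
    and r: "c < r" "r < d"
  shows "(V r - V' r) * \<phi> r = 0"
proof -
  define W where "W = (\<lambda>r. p r * \<phi> r - z r * q r)"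
  have dW: "(W has_real_derivative r ^ k * (V r - V' r) * z r * \<phi> r) (at r)" if "c \<le> r" "r \<le> d" for r
    unfolding W_def using wronskian_derivative[OF z \<phi>] that by auto
  have mono: "W x \<le> W y" if "c \<le> x" "x \<le> y" "y \<le> d" for x y
  proof (rule DERIV_nonneg_imp_nondecreasing[OF \<open>x \<le> y\<close>])
    fix t assume t: "x \<le> t" "t \<le> y"
    have "0 \<le> t ^ k * (V t - V' t) * z t * \<phi> t"
    proof (cases "t = c \<or> t = d")
      case True then show ?thesis using ends by auto
    next
      case False
      then have "c < t" "t < d" using t that by auto
      then show ?thesis using pos[of t] \<phi>0[of t] V[of t] c by simp
    qed
    then show "\<exists>y. (W has_real_derivative y) (at t) \<and> 0 \<le> y" using dW[of t] t that by auto
  qed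
  have zc: "(z has_real_derivative p c / c ^ k) (at c)" and zd: "(z has_real_derivative p d / d ^ k) (at d)"
    using z c unfolding radial_ode_def by auto
  have "0 \<le> p c"
  proof (rule ccontr)
    assume "\<not> 0 \<le> p c"
    then have "p c / c ^ k < 0" using c by (simp add: divide_neg_pos)
    from DERIV_neg_dec_right[OF zc this] obtain e where e: "e > 0" "\<And>h. 0 < h \<Longrightarrow> h < e \<Longrightarrow> z (c + h) < z c"
      by blast
    define h where "h = min (e/2) ((d - c)/2)"
    have "0 < h" "h < e" "c + h < d" using e(1) c by (auto simp: h_def min_def field_simps)
    then show False using e(2)[of h] pos[of "c+h"] ends by auto
  qed
  moreover have "p d \<le> 0"
  proof (rule ccontr)
    assume "\<not> p d \<le> 0"
    then have "0 < p d / d ^ k" using c by simp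
    from DERIV_pos_inc_left[OF zd this] obtain e where e: "e > 0" "\<And>h. 0 < h \<Longrightarrow> h < e \<Longrightarrow> z (d - h) < z d"
      by blast
    define h where "h = min (e/2) ((d - c)/2)"
    have "0 < h" "h < e" "c < d - h" using e(1) c by (auto simp: h_def min_def field_simps)
    then show False using e(2)[of h] pos[of "d-h"] ends by auto
  qed
  ultimately have "0 \<le> W c" "W d \<le> 0"
    using \<phi>0[of c] \<phi>0[of d] c ends by (auto simp: W_def mult_nonpos_nonneg)
  then have W0: "W x = 0" if "c \<le> x" "x \<le> d" for x
    using mono[of c x] mono[of x d] that by auto
  have "r ^ k * (V r - V' r) * z r * \<phi> r = 0"
  proof (rule DERIV_local_const[OF dW])
    show "\<forall>y. \<bar>r - y\<bar> < min (r-c) (d-r) \<longrightarrow> W r = W y" using r W0 by auto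
  qed (use r in auto)
  then show ?thesis using pos[OF r] c r by auto
qed

text \<open>
  Nodal intervals cannot be short. The comparison function \<open>1 - C (r - c)\<close> is positive on
  intervals of length below \<open>1 / C\<close>, and it is a strict supersolution for every potential
  \<open>V \<ge> - C / r\<close>. The singular bound \<open>C / r\<close> is exactly what radial Sobolev functions provide, so
  one argument excludes the accumulation of zeros in the interior, at the boundary and at the
  centre of a ball.
\<close>

lemma nodal_interval_length:
  assumes z: "radial_ode k {c..d} V z p" and k: "1 \<le> k"
    and c: "0 < c" "c < d" and ends: "z c = 0" "z d = 0"
    and pos: "\<And>r. c < r \<Longrightarrow> r < d \<Longrightarrow> 0 < z r"
    and C: "0 < C" and V: "\<And>r. c < r \<Longrightarrow> r < d \<Longrightarrow> - C / r \<le> V r"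
  shows "1 / C \<le> d - c"
proof (rule ccontr)
  assume "\<not> 1 / C \<le> d - c"
  then have short: "C * (d - c) < 1" using C by (simp add: field_simps)
  \<comment> \<open>The potential \<open>V'\<close> below is read off from \<open>\<phi>\<close>, whose flux is \<open>- C r\<^sup>k\<close>.\<close>
  define \<phi> where "\<phi> = (\<lambda>r. 1 - C * (r - c))"
  have \<phi>pos: "0 < \<phi> r" if "r \<le> d" for r
  proof -
    have "C * (r - c) \<le> C * (d - c)" using C that by simp
    then show ?thesis using short by (simp add: \<phi>_def)
  qed
  define V' where "V' = (\<lambda>r. - C * real k / r / \<phi> r)"
  have \<phi>ode: "radial_ode k {c..d} V' \<phi> (\<lambda>r. - C * r ^ k)"
    unfolding radial_ode_def
  proof (intro ballI conjI)
    fix r assume r: "r \<in> {c..d}"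
    then have r0: "r > 0" using c by auto
    show "(\<phi> has_real_derivative - C * r ^ k / r ^ k) (at r)"
      unfolding \<phi>_def using r0 by (auto intro!: derivative_eq_intros)
    have "((\<lambda>r. - C * r ^ k) has_real_derivative - C * (real k * r ^ (k - 1))) (at r)"
      by (auto intro!: derivative_eq_intros)
    moreover have "r ^ k = r * r ^ (k - 1)" using k by (metis Suc_diff_1 power_Suc zero_less_one order_less_le_trans)
    ultimately show "((\<lambda>r. - C * r ^ k) has_real_derivative r ^ k * V' r * \<phi> r) (at r)"
      using r0 \<phi>pos[of r] r by (simp add: V'_def field_simps)
  qed
  have less: "V' r < V r" if r: "c < r" "r < d" for r
  proof -
    have r0: "r > 0" using r c by auto
    have "\<phi> r < 1" using r C by (simp add: \<phi>_def)
    then have "\<phi> r < real k" using k by linarith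
    then have "1 < real k / \<phi> r" using \<phi>pos[of r] r by (simp add: field_simps)
    then have "(C / r) * 1 < (C / r) * (real k / \<phi> r)" using C r0 by (intro mult_strict_left_mono) auto
    then have "V' r < - C / r" by (simp add: V'_def)
    then show ?thesis using V[OF r] by linarith
  qed
  define r where "r = (c + d) / 2"
  have r: "c < r" "r < d" using c by (auto simp: r_def)
  have "(V r - V' r) * \<phi> r = 0"
    by (rule sturm[OF z \<phi>ode c ends pos]) (use less \<phi>pos r in \<open>auto intro: less_imp_le\<close>)
  then show False using less[OF r] \<phi>pos[of r] r by auto
qed

text \<open>
  The same comparison on an open interval without any boundary values. The functions \<open>l\<close> and
  \<open>m\<close> witness that \<open>1 / (r\<^sup>k z\<^sup>2)\<close> is not integrable at either end, that is, \<open>z\<close> is a principal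
  solution at both ends. Since \<open>(\<phi> / z)' = - W / (r\<^sup>k z\<^sup>2)\<close>, a Wronskian \<open>W\<close> bounded away from
  zero near one end would drive the nonnegative quotient \<open>\<phi> / z\<close> to minus infinity there. As
  \<open>W\<close> is monotone, this forces \<open>W = 0\<close>.
\<close>

lemma sturm_principal:
  assumes z: "radial_ode k {A<..<B} V z p" and \<phi>: "radial_ode k {A<..<B} V' \<phi> q"
    and A: "0 \<le> A" and pos: "\<And>r. A < r \<Longrightarrow> r < B \<Longrightarrow> 0 < z r"
    and \<phi>0: "\<And>r. A < r \<Longrightarrow> r < B \<Longrightarrow> 0 \<le> \<phi> r"
    and V: "\<And>r. A < r \<Longrightarrow> r < B \<Longrightarrow> V' r \<le> V r"
    and l: "\<And>r. A < r \<Longrightarrow> r < B \<Longrightarrow> (l has_real_derivative l' r) (at r)"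
    and l': "\<And>r. A < r \<Longrightarrow> r < B \<Longrightarrow> l' r \<le> 1 / (r ^ k * (z r)\<^sup>2)"
    and l_top: "filterlim l at_top (at_left B)"
    and m: "\<And>r. A < r \<Longrightarrow> r < B \<Longrightarrow> (m has_real_derivative m' r) (at r)"
    and m': "\<And>r. A < r \<Longrightarrow> r < B \<Longrightarrow> m' r \<le> 1 / (r ^ k * (z r)\<^sup>2)"
    and m_bot: "filterlim m at_bot (at_right A)"
    and r: "A < r" "r < B"
  shows "(V r - V' r) * \<phi> r = 0"
proof -
  define W where "W = (\<lambda>r. p r * \<phi> r - z r * q r)"
  have dW: "(W has_real_derivative r ^ k * (V r - V' r) * z r * \<phi> r) (at r)" if "A < r" "r < B" for r
    unfolding W_def using wronskian_derivative[OF z \<phi>] that by auto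
  have dQ: "((\<lambda>r. \<phi> r / z r) has_real_derivative - W r / (r ^ k * (z r)\<^sup>2)) (at r)" if "A < r" "r < B" for r
    unfolding W_def using quotient_derivative[OF z \<phi>] that pos[of r] A by auto
  have mono: "W x \<le> W y" if xy: "A < x" "x \<le> y" "y < B" for x y
  proof (rule DERIV_nonneg_imp_nondecreasing[OF \<open>x \<le> y\<close>])
    fix t assume t: "x \<le> t" "t \<le> y"
    have "0 \<le> t ^ k * (V t - V' t) * z t * \<phi> t"
      using pos[of t] \<phi>0[of t] V[of t] A t xy by simp
    then show "\<exists>y. (W has_real_derivative y) (at t) \<and> 0 \<le> y" using dW[of t] t that by auto
  qed
  have W0: "W s = 0" if s: "A < s" "s < B" for s
  proof (rule ccontr)
    assume ne: "W s \<noteq> 0"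
    show False
    proof (cases "W s > 0")
      case True
      \<comment> \<open>\<open>W \<ge> \<delta>\<close> to the right of \<open>s\<close>: the quotient plus \<open>\<delta> l\<close> decreases while \<open>l\<close> tends to infinity.\<close>
      define \<delta> where "\<delta> = W s"
      have \<delta>: "\<delta> > 0" using True by (simp add: \<delta>_def)
      have "eventually (\<lambda>r. l r > (\<phi> s / z s + \<delta> * l s) / \<delta>) (at_left B)"
        using l_top by (simp add: filterlim_at_top_dense)
      moreover have "eventually (\<lambda>r. s < r \<and> r < B) (at_left B)"
        using s(2) eventually_at_left by blast
      ultimately have "eventually (\<lambda>r. False) (at_left B)"
      proof eventually_elim
        case (elim r)
        have "\<phi> r / z r + \<delta> * l r \<le> \<phi> s / z s + \<delta> * l s"
        proof (rule DERIV_nonpos_imp_nonincreasing[of s r "\<lambda>r. \<phi> r / z r + \<delta> * l r"])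
          fix t assume t: "s \<le> t" "t \<le> r"
          have tI: "A < t" "t < B" using t s elim by auto
          have P: "0 < t ^ k * (z t)\<^sup>2" using tI A pos[of t] by auto
          have "- W t / (t ^ k * (z t)\<^sup>2) \<le> - \<delta> / (t ^ k * (z t)\<^sup>2)"
            using mono[of s t] P t s tI by (intro divide_right_mono) (auto simp: \<delta>_def)
          moreover have "\<delta> * l' t \<le> \<delta> / (t ^ k * (z t)\<^sup>2)"
            using mult_left_mono[OF l'[OF tI], of \<delta>] \<delta> by simp
          ultimately have "- W t / (t ^ k * (z t)\<^sup>2) + \<delta> * l' t \<le> 0" by simp
          then show "\<exists>y. ((\<lambda>r. \<phi> r / z r + \<delta> * l r) has_real_derivative y) (at t) \<and> y \<le> 0"
            using DERIV_add[OF dQ[OF tI] DERIV_cmult[OF l[OF tI], of \<delta>]] by blast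
        qed (use elim in auto)
        moreover have "0 \<le> \<phi> r / z r" using \<phi>0[of r] pos[of r] s elim by simp
        ultimately show False using elim(1) \<delta> by (simp add: field_simps)
      qed
      then show False using s by (simp add: trivial_limit_at_left_real)
    next
      case False
      \<comment> \<open>\<open>W \<le> - \<delta>\<close> to the left of \<open>s\<close>: the mirror image at the left end.\<close>
      define \<delta> where "\<delta> = - W s"
      have \<delta>: "\<delta> > 0" using False ne by (simp add: \<delta>_def)
      have "eventually (\<lambda>r. m r < - (\<phi> s / z s - \<delta> * m s) / \<delta>) (at_right A)"
        using m_bot by (simp add: filterlim_at_bot_dense)
      moreover have "eventually (\<lambda>r. A < r \<and> r < s) (at_right A)"
        using s(1) eventually_at_right by blast
      ultimately have "eventually (\<lambda>r. False) (at_right A)"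
      proof eventually_elim
        case (elim r)
        have "\<phi> r / z r - \<delta> * m r \<le> \<phi> s / z s - \<delta> * m s"
        proof (rule DERIV_nonneg_imp_nondecreasing[of r s "\<lambda>r. \<phi> r / z r - \<delta> * m r"])
          fix t assume t: "r \<le> t" "t \<le> s"
          have tI: "A < t" "t < B" using t s elim by auto
          have P: "0 < t ^ k * (z t)\<^sup>2" using tI A pos[of t] by auto
          have "\<delta> / (t ^ k * (z t)\<^sup>2) \<le> - W t / (t ^ k * (z t)\<^sup>2)"
            using mono[of t s] P t s tI by (intro divide_right_mono) (auto simp: \<delta>_def)
          moreover have "\<delta> * m' t \<le> \<delta> / (t ^ k * (z t)\<^sup>2)"
            using mult_left_mono[OF m'[OF tI], of \<delta>] \<delta> by simp
          ultimately have "0 \<le> - W t / (t ^ k * (z t)\<^sup>2) - \<delta> * m' t" by simp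
          then show "\<exists>y. ((\<lambda>r. \<phi> r / z r - \<delta> * m r) has_real_derivative y) (at t) \<and> 0 \<le> y"
            using DERIV_diff[OF dQ[OF tI] DERIV_cmult[OF m[OF tI], of \<delta>]] by blast
        qed (use elim in auto)
        moreover have "0 \<le> \<phi> r / z r" using \<phi>0[of r] pos[of r] s elim by simp
        ultimately show False using elim(1) \<delta> by (simp add: field_simps)
      qed
      then show False using s by (simp add: trivial_limit_at_right_real)
    qed
  qed
  have "r ^ k * (V r - V' r) * z r * \<phi> r = 0"
  proof (rule DERIV_local_const[OF dW])
    show "\<forall>y. \<bar>r - y\<bar> < min (r-A) (B-r) \<longrightarrow> W r = W y" using r W0 by auto
  qed (use r in auto)
  then show ?thesis using pos[OF r] A r by auto
qed

text \<open>
  Uniqueness for the initial value problem, by Gronwall: the energy \<open>z\<^sup>2 + p\<^sup>2\<close> changes at most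
  at an exponential rate, forwards and backwards.
\<close>

lemma radial_ode_unique:
  assumes ode: "radial_ode k {c..d} V z p" and c: "0 < c"
    and V: "continuous_on {c..d} V" and s: "s \<in> {c..d}" and init: "z s = 0" "p s = 0"
    and t: "t \<in> {c..d}"
  shows "z t = 0"
proof -
  have "continuous_on {c..d} (\<lambda>r. 1 / r ^ k + r ^ k * V r)"
    using c V by (intro continuous_intros) auto
  then have "bounded ((\<lambda>r. 1 / r ^ k + r ^ k * V r) ` {c..d})"
    by (intro compact_imp_bounded compact_continuous_image) auto
  then obtain M where "\<forall>r\<in>{c..d}. \<bar>1 / r ^ k + r ^ k * V r\<bar> \<le> M"
    unfolding bounded_iff by auto
  then have M: "\<bar>1 / r ^ k + r ^ k * V r\<bar> \<le> M" if "r \<in> {c..d}" for r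
    using that by blast
  define E where "E = (\<lambda>r. (z r)\<^sup>2 + (p r)\<^sup>2)"
  define E' where "E' = (\<lambda>r. 2 * (z r * p r) * (1 / r ^ k + r ^ k * V r))"
  have dE: "(E has_real_derivative E' r) (at r)" if "r \<in> {c..d}" for r
  proof -
    have "(z has_real_derivative p r / r ^ k) (at r)" "(p has_real_derivative r ^ k * V r * z r) (at r)"
      using ode that unfolding radial_ode_def by auto
    then show ?thesis unfolding E_def E'_def
      by (auto intro!: derivative_eq_intros simp: algebra_simps)
  qed
  have E': "\<bar>E' r\<bar> \<le> M * E r" if "r \<in> {c..d}" for r
  proof -
    have "0 \<le> (\<bar>z r\<bar> - \<bar>p r\<bar>)\<^sup>2" by simp
    then have "\<bar>2 * (z r * p r)\<bar> \<le> E r"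
      by (simp add: E_def power2_diff abs_mult)
    then have "\<bar>2 * (z r * p r)\<bar> * \<bar>1 / r ^ k + r ^ k * V r\<bar> \<le> E r * M"
      using M[OF that] by (intro mult_mono) (auto simp: E_def)
    then show ?thesis by (simp add: E'_def abs_mult mult.commute)
  qed
  have Es: "E s = 0" using init by (simp add: E_def)
  have "E t \<le> 0"
  proof (cases "s \<le> t")
    case True
    have "exp (- M * t) * E t \<le> exp (- M * s) * E s"
    proof (rule DERIV_nonpos_imp_nonincreasing[OF True])
      fix x assume x: "s \<le> x" "x \<le> t"
      then have xI: "x \<in> {c..d}" using s t by auto
      have "((\<lambda>r. exp (- M * r) * E r) has_real_derivative
              exp (- M * x) * (E' x - M * E x)) (at x)"
        by (auto intro!: derivative_eq_intros dE[OF xI] simp: algebra_simps)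
      moreover have "exp (- M * x) * (E' x - M * E x) \<le> 0"
        using E'[OF xI] by (auto simp: mult_le_0_iff)
      ultimately show "\<exists>y. ((\<lambda>r. exp (- M * r) * E r) has_real_derivative y) (at x) \<and> y \<le> 0"
        by blast
    qed
    then show ?thesis using Es by (simp add: mult_le_0_iff)
  next
    case False
    then have "t \<le> s" by simp
    have "exp (M * t) * E t \<le> exp (M * s) * E s"
    proof (rule DERIV_nonneg_imp_nondecreasing[OF \<open>t \<le> s\<close>])
      fix x assume x: "t \<le> x" "x \<le> s"
      then have xI: "x \<in> {c..d}" using s t by auto
      have "((\<lambda>r. exp (M * r) * E r) has_real_derivative
              exp (M * x) * (E' x + M * E x)) (at x)"
        by (auto intro!: derivative_eq_intros dE[OF xI] simp: algebra_simps)
      moreover have "0 \<le> exp (M * x) * (E' x + M * E x)"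
        using E'[OF xI] by (auto simp: zero_le_mult_iff)
      ultimately show "\<exists>y. ((\<lambda>r. exp (M * r) * E r) has_real_derivative y) (at x) \<and> 0 \<le> y"
        by blast
    qed
    then show ?thesis using Es by (simp add: mult_le_0_iff)
  qed
  then show ?thesis unfolding E_def using sum_power2_le_zero_iff[of "z t" "p t"] by simp
qed

text \<open>
  At an interior zero of a nonnegative solution the derivative vanishes as well, so uniqueness
  makes the solution vanish identically.
\<close>

lemma radial_ode_strict_sign:
  assumes ode: "radial_ode k {A<..<B} V z p" and A: "0 \<le> A"
    and V: "continuous_on {A<..<B} V"
    and nonneg: "\<And>r. A < r \<Longrightarrow> r < B \<Longrightarrow> 0 \<le> z r"
    and ne: "A < r0" "r0 < B" "z r0 \<noteq> 0"
    and s: "A < s" "s < B"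
  shows "0 < z s"
proof (rule ccontr)
  assume "\<not> 0 < z s"
  then have zs: "z s = 0" using nonneg[OF s] by simp
  have d: "(z has_real_derivative p s / s ^ k) (at s)" using ode s unfolding radial_ode_def by auto
  have "p s / s ^ k = 0"
  proof (rule DERIV_local_min[OF d])
    show "\<forall>y. \<bar>s - y\<bar> < min (s - A) (B - s) \<longrightarrow> z s \<le> z y"
      using nonneg zs by auto
  qed (use s in auto)
  then have ps: "p s = 0" using s A by simp
  define c d where "c = min s r0" and "d = max s r0"
  have sub: "{c..d} \<subseteq> {A<..<B}" using s ne by (auto simp: c_def d_def)
  have "z r0 = 0"
    by (rule radial_ode_unique[OF radial_ode_subset[OF ode sub] _ continuous_on_subset[OF V sub] _ zs ps])
       (use s ne A in \<open>auto simp: c_def d_def\<close>)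
  then show False using ne by simp
qed

section \<open>Two competing components and their difference\<close>

text \<open>
  The equations of two components \<open>f\<close> and \<open>g\<close> of the system; \<open>S\<close> is the sum of the squares of
  all remaining components, and \<open>p\<close>, \<open>q\<close> are the fluxes.
\<close>

definition competing_pair ::
  "nat \<Rightarrow> real set \<Rightarrow> real \<Rightarrow> (real \<Rightarrow> real) \<Rightarrow> (real \<Rightarrow> real) \<Rightarrow> (real \<Rightarrow> real) \<Rightarrow>
   (real \<Rightarrow> real) \<Rightarrow> (real \<Rightarrow> real) \<Rightarrow> bool" where
  "competing_pair k I \<beta> S f p g q \<longleftrightarrow>
     radial_ode k I (\<lambda>r. 1 - (f r)\<^sup>2 - \<beta> * (g r)\<^sup>2 - \<beta> * S r) f p \<and>
     radial_ode k I (\<lambda>r. 1 - (g r)\<^sup>2 - \<beta> * (f r)\<^sup>2 - \<beta> * S r) g q"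

lemma competing_pair_sym:
  "competing_pair k I \<beta> S f p g q \<Longrightarrow> competing_pair k I \<beta> S g q f p"
  by (simp add: competing_pair_def)

lemma competing_pair_subset:
  "competing_pair k I \<beta> S f p g q \<Longrightarrow> J \<subseteq> I \<Longrightarrow> competing_pair k J \<beta> S f p g q"
  unfolding competing_pair_def using radial_ode_subset by blast

lemma competing_pair_uminus:
  "competing_pair k I \<beta> S f p g q \<Longrightarrow>
   competing_pair k I \<beta> S (\<lambda>r. - f r) (\<lambda>r. - p r) (\<lambda>r. - g r) (\<lambda>r. - q r)"
  unfolding competing_pair_def by (auto intro: radial_ode_uminus)

text \<open>
  Although the system is nonlinear, the difference of two components solves a linear equation,
  because \<open>f g\<^sup>2 - g f\<^sup>2\<close> and \<open>f\<^sup>3 - g\<^sup>3\<close> are divisible by \<open>f - g\<close>.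
\<close>

lemma competing_pair_diff:
  assumes "competing_pair k I \<beta> S f p g q"
  shows "radial_ode k I (\<lambda>r. 1 - ((f r)\<^sup>2 + (g r)\<^sup>2 + (1 - \<beta>) * (f r * g r) + \<beta> * S r))
           (\<lambda>r. f r - g r) (\<lambda>r. p r - q r)"
  unfolding radial_ode_def
proof (intro ballI conjI)
  fix r assume r: "r \<in> I"
  have D: "(f has_real_derivative p r / r ^ k) (at r)" "(g has_real_derivative q r / r ^ k) (at r)"
    "(p has_real_derivative r ^ k * (1 - (f r)\<^sup>2 - \<beta> * (g r)\<^sup>2 - \<beta> * S r) * f r) (at r)"
    "(q has_real_derivative r ^ k * (1 - (g r)\<^sup>2 - \<beta> * (f r)\<^sup>2 - \<beta> * S r) * g r) (at r)"
    using assms r unfolding competing_pair_def radial_ode_def by auto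
  show "((\<lambda>r. f r - g r) has_real_derivative (p r - q r) / r ^ k) (at r)"
    using DERIV_diff[OF D(1,2)] by (simp add: diff_divide_distrib)
  show "((\<lambda>r. p r - q r) has_real_derivative
     r ^ k * (1 - ((f r)\<^sup>2 + (g r)\<^sup>2 + (1 - \<beta>) * (f r * g r) + \<beta> * S r)) * (f r - g r)) (at r)"
    using DERIV_diff[OF D(3,4)]
    by (rule DERIV_cong) (simp add: algebra_simps power2_eq_square)
qed

text \<open>
  The potential of \<open>g\<close> minus the potential of \<open>f - g\<close>. It is positive where \<open>f\<close> and \<open>g\<close> are
  both positive, which makes \<open>f - g\<close> oscillate faster than \<open>g\<close> there.
\<close>

lemma potential_difference:
  fixes x y \<beta> s :: real
  shows "(1 - y\<^sup>2 - \<beta> * x\<^sup>2 - \<beta> * s) - (1 - (x\<^sup>2 + y\<^sup>2 + (1 - \<beta>) * (x * y) + \<beta> * s)) =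
     (1 - \<beta>) * (x * (x + y))"
  by (simp add: algebra_simps power2_eq_square)

text \<open>
  This is where \<open>\<beta> \<le> -1\<close> enters: two equal components repel each other at least as much as
  they attract themselves, so their common equation has a positive potential and admits no
  oscillation.
\<close>

lemma potential_on_diagonal:
  fixes x \<beta> s :: real
  assumes "\<beta> \<le> - 1" "0 \<le> s"
  shows "1 \<le> 1 - x\<^sup>2 - \<beta> * x\<^sup>2 - \<beta> * s"
proof -
  have "0 \<le> (- 1 - \<beta>) * x\<^sup>2" using assms by simp
  moreover have "\<beta> * s \<le> 0" using assms by (simp add: mult_nonpos_nonneg)
  ultimately show ?thesis by (simp add: algebra_simps)
qed

text \<open>
  On a positive nodal interval of \<open>g\<close> the other component cannot stay above \<open>g\<close>. Otherwise
  Sturm comparison of \<open>g\<close> with \<open>f - g \<ge> 0\<close> gives \<open>f = g\<close>, and then the potential of \<open>g\<close> is at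
  least 1, which comparison with the constant solution rules out.
\<close>

lemma no_domination_on_nodal_interval:
  assumes pair: "competing_pair k {c..d} \<beta> S f p g q" and \<beta>: "\<beta> \<le> -1"
    and S: "\<And>r. 0 \<le> S r"
    and c: "0 < c" "c < d" and ends: "g c = 0" "g d = 0"
    and pos: "\<And>r. c < r \<Longrightarrow> r < d \<Longrightarrow> 0 < g r"
  obtains t where "c < t" "t < d" "f t < g t"
proof (rule ccontr)
  note witness = that
  assume "\<not> thesis"
  then have dom: "g r \<le> f r" if "c < r" "r < d" for r
    using that witness[of r] by force
  let ?V = "\<lambda>r. 1 - (g r)\<^sup>2 - \<beta> * (f r)\<^sup>2 - \<beta> * S r"
  have odes: "radial_ode k {c..d} ?V g q"
    and contf: "continuous_on {c..d} f" and contg: "continuous_on {c..d} g"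
    using pair radial_ode_continuous unfolding competing_pair_def by blast+
  have dom': "0 \<le> f r - g r" if "c \<le> r" "r \<le> d" for r
  proof (rule continuous_ge_on_closure[of "{c<..<d}" "\<lambda>r. f r - g r" r 0])
    show "continuous_on (closure {c<..<d}) (\<lambda>r. f r - g r)"
      using contf contg c by (simp add: continuous_on_diff)
  qed (use that c dom in auto)
  have eq: "f r = g r" if r: "c < r" "r < d" for r
  proof -
    have "(?V r - (1 - ((f r)\<^sup>2 + (g r)\<^sup>2 + (1 - \<beta>) * (f r * g r) + \<beta> * S r))) * (f r - g r) = 0"
    proof (rule sturm[OF odes competing_pair_diff[OF pair] c ends pos dom' _ r])
      fix t assume "c < t" "t < d"
      then have "0 \<le> (1 - \<beta>) * (f t * (f t + g t))" using pos[of t] dom[of t] \<beta> by simp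
      then show "1 - ((f t)\<^sup>2 + (g t)\<^sup>2 + (1 - \<beta>) * (f t * g t) + \<beta> * S t) \<le> ?V t"
        using potential_difference[of "g t" \<beta> "f t" "S t"] by linarith
    qed
    then have "(1 - \<beta>) * (f r * (f r + g r)) * (f r - g r) = 0"
      unfolding potential_difference .
    then show ?thesis using pos[OF r] dom[OF r] \<beta> by auto
  qed
  have V1: "1 \<le> ?V r" if "c < r" "r < d" for r
    using potential_on_diagonal[OF \<beta> S[of r], of "g r"] eq[OF that] by simp
  define r where "r = (c + d) / 2"
  have r: "c < r" "r < d" using c by (auto simp: r_def)
  have "(?V r - 0) * 1 = 0"
  proof (rule sturm[OF odes radial_ode_const c ends pos _ _ r])
    fix t assume "c < t" "t < d" then show "0 \<le> ?V t" using V1[of t] by linarith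
  qed auto
  then show False using V1[OF r] by simp
qed

text \<open>
  The maximal interval of positivity around \<open>r\<close>: its ends are the last zero before and the
  first zero after \<open>r\<close>.
\<close>

lemma nodal_interval:
  fixes g :: "real \<Rightarrow> real"
  assumes cont: "continuous_on {a..b} g" and r: "a < r" "r < b"
    and sgn: "g a < 0" "0 < g r" "g b < 0"
  obtains c d where "a < c" "c < r" "r < d" "d < b" "g c = 0" "g d = 0"
    "\<And>s. c < s \<Longrightarrow> s < d \<Longrightarrow> 0 < g s"
proof -
  have contl: "continuous_on {a..r} g" and contr: "continuous_on {r..b} g"
    using r by (auto intro: continuous_on_subset[OF cont])
  define Z where "Z = {a..r} \<inter> g -` {0}"
  define Z' where "Z' = {r..b} \<inter> g -` {0}"
  have "compact Z" unfolding Z_def compact_eq_bounded_closed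
    by (auto intro: continuous_closed_preimage[OF contl] bounded_subset[of "{a..r}"])
  moreover have "Z \<noteq> {}"
    using IVT'[of g a 0 r] sgn r contl by (force simp: Z_def)
  ultimately obtain c where c: "c \<in> Z" "\<And>s. s \<in> Z \<Longrightarrow> s \<le> c"
    using compact_attains_sup by metis
  have "compact Z'" unfolding Z'_def compact_eq_bounded_closed
    by (auto intro: continuous_closed_preimage[OF contr] bounded_subset[of "{r..b}"])
  moreover have "Z' \<noteq> {}"
    using IVT2'[of g b 0 r] sgn r contr by (force simp: Z'_def)
  ultimately obtain d where d: "d \<in> Z'" "\<And>s. s \<in> Z' \<Longrightarrow> d \<le> s"
    using compact_attains_inf by metis
  have cd: "a \<le> c" "c \<le> r" "g c = 0" "r \<le> d" "d \<le> b" "g d = 0" using c d by (auto simp: Z_def Z'_def)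
  then have cd': "a < c" "c < r" "r < d" "d < b"
    using sgn by (metis less_le order_less_irrefl)+
  have "0 < g s" if s: "c < s" "s < d" for s
  proof (rule ccontr)
    assume "\<not> 0 < g s"
    then have gs: "g s \<le> 0" by simp
    show False
    proof (cases "s \<le> r")
      case True
      have "continuous_on {s..r} g" using s cd by (auto intro: continuous_on_subset[OF contl])
      then obtain x where "s \<le> x" "x \<le> r" "g x = 0"
        using IVT'[of g s 0 r] gs sgn True by auto
      then show False using c(2)[of x] s cd by (auto simp: Z_def)
    next
      case False
      have "continuous_on {r..s} g" using s cd by (auto intro: continuous_on_subset[OF contr])
      then obtain x where "r \<le> x" "x \<le> s" "g x = 0"
        using IVT2'[of g s 0 r] gs sgn False by auto
      then show False using d(2)[of x] s cd by (auto simp: Z'_def)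
    qed
  qed
  then show thesis using that cd cd' by blast
qed

definition alternates :: "real set \<Rightarrow> (real \<Rightarrow> real) \<Rightarrow> nat \<Rightarrow> (nat \<Rightarrow> real) \<Rightarrow> bool" where
  "alternates I z m r \<longleftrightarrow>
     (\<forall>j<m. r j < r (Suc j)) \<and> (\<forall>j\<le>m. r j \<in> I) \<and> (\<forall>j<m. z (r j) * z (r (Suc j)) < 0)"

text \<open>
  Around a sign point \<open>r\<close> of \<open>g\<close> with opposite signs on both sides, the difference takes
  somewhere the sign opposite to \<open>g r\<close>, and this happens within the nodal interval of \<open>r\<close>. The
  segment condition records the latter in a form from which the order of such points for
  consecutive nodal intervals can be read off.
\<close>

lemma difference_opposes_nodal_interval:
  assumes pair: "competing_pair k {A<..<B} \<beta> S f p g q" and \<beta>: "\<beta> \<le> -1" and A: "0 \<le> A"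
    and S: "\<And>r. 0 \<le> S r"
    and r: "A < a" "a < r" "r < b" "b < B" and sgn: "g a * g r < 0" "g r * g b < 0"
  obtains t where "A < t" "t < B" "(f t - g t) * g r < 0"
    "\<And>s. s \<in> closed_segment t r \<Longrightarrow> 0 < g s * g r"
proof -
  have main: "\<exists>t. A < t \<and> t < B \<and> f t < g t \<and> (\<forall>s\<in>closed_segment t r. 0 < g s)"
    if pair: "competing_pair k {A<..<B} \<beta> S f p g q" and sgn: "g a < 0" "0 < g r" "g b < 0"
    for f p g q
  proof -
    have "continuous_on {A<..<B} g" using pair radial_ode_continuous unfolding competing_pair_def by blast
    then have "continuous_on {a..b} g" using r by (auto intro: continuous_on_subset)
    from nodal_interval[OF this r(2,3) sgn] obtain c d where cd: "a < c" "c < r" "r < d" "d < b"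
      "g c = 0" "g d = 0" "\<And>s. c < s \<Longrightarrow> s < d \<Longrightarrow> 0 < g s" by metis
    have sub: "{c..d} \<subseteq> {A<..<B}" using cd r by auto
    obtain t where t: "c < t" "t < d" "f t < g t"
      using no_domination_on_nodal_interval[OF competing_pair_subset[OF pair sub] \<beta> S _ _ cd(5-7)]
      using cd r A by (metis (no_types, lifting) order.strict_trans order.strict_trans1)
    have "\<forall>s\<in>closed_segment t r. 0 < g s" using t cd by (auto simp: closed_segment_eq_real_ivl)
    then show ?thesis using t cd r by (intro exI[of _ t]) auto
  qed
  show thesis
  proof (cases "0 < g r")
    case True
    then have "g a < 0" "g b < 0" using sgn by (auto simp: mult_less_0_iff)
    from main[OF pair this(1) True this(2)] obtain t where "A < t" "t < B" "f t < g t"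
      "\<forall>s\<in>closed_segment t r. 0 < g s" by blast
    then show thesis using True by (intro that[of t]) (auto simp: mult_less_0_iff)
  next
    case False
    then have "g r < 0" "g a > 0" "g b > 0" using sgn by (auto simp: mult_less_0_iff)
    with main[OF competing_pair_uminus[OF pair]] obtain t where "A < t" "t < B" "- f t < - g t"
      "\<forall>s\<in>closed_segment t r. 0 < - g s" by auto
    then show thesis using \<open>g r < 0\<close> by (intro that[of t]) (auto simp: mult_less_0_iff zero_less_mult_iff)
  qed
qed

text \<open>
  One point per interior nodal interval of \<open>g\<close>, with signs of \<open>f - g\<close> opposite to those of
  \<open>g\<close>: of the \<open>m + 1\<close> nodal intervals only the first and the last are lost, as they need not
  have a zero of \<open>g\<close> at both ends.
\<close>

lemma alternates_difference:
  assumes pair: "competing_pair k {A<..<B} \<beta> S f p g q" and \<beta>: "\<beta> \<le> -1" and A: "0 \<le> A"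
    and S: "\<And>r. 0 \<le> S r"
    and alt: "alternates {A<..<B} g m r" and m: "2 \<le> m"
  obtains t where "alternates {A<..<B} (\<lambda>r. f r - g r) (m - 2) t"
proof -
  have "\<forall>i. \<exists>t. Suc i < m \<longrightarrow> A < t \<and> t < B \<and> (f t - g t) * g (r (Suc i)) < 0 \<and>
          (\<forall>s\<in>closed_segment t (r (Suc i)). 0 < g s * g (r (Suc i)))"
  proof
    fix i
    show "\<exists>t. Suc i < m \<longrightarrow> A < t \<and> t < B \<and> (f t - g t) * g (r (Suc i)) < 0 \<and>
          (\<forall>s\<in>closed_segment t (r (Suc i)). 0 < g s * g (r (Suc i)))"
    proof (cases "Suc i < m")
      case True
      then have *: "A < r i" "r i < r (Suc i)" "r (Suc i) < r (Suc (Suc i))" "r (Suc (Suc i)) < B"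
        "g (r i) * g (r (Suc i)) < 0" "g (r (Suc i)) * g (r (Suc (Suc i))) < 0"
        using alt unfolding alternates_def by auto
      show ?thesis
        using difference_opposes_nodal_interval[OF pair \<beta> A S *] by metis
    qed simp
  qed
  then obtain t where t: "\<And>i. Suc i < m \<Longrightarrow> A < t i \<and> t i < B \<and> (f (t i) - g (t i)) * g (r (Suc i)) < 0 \<and>
          (\<forall>s\<in>closed_segment (t i) (r (Suc i)). 0 < g s * g (r (Suc i)))" by metis
  have "alternates {A<..<B} (\<lambda>r. f r - g r) (m - 2) t"
    unfolding alternates_def
  proof (intro conjI allI impI)
    fix j assume j: "j < m - 2"
    then have j': "Suc j < m" "Suc (Suc j) < m" by auto
    have rr: "r (Suc j) < r (Suc (Suc j))" "g (r (Suc j)) * g (r (Suc (Suc j))) < 0"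
      using alt j' unfolding alternates_def by auto
    note T = t[OF j'(1)] t[OF j'(2)]
    show "t j < t (Suc j)"
    proof (rule ccontr)
      assume "\<not> t j < t (Suc j)"
      \<comment> \<open>If the order failed, the two segments would meet, but \<open>g\<close> has opposite signs on them.\<close>
      then have "\<exists>s. s \<in> closed_segment (t j) (r (Suc j)) \<and> s \<in> closed_segment (t (Suc j)) (r (Suc (Suc j)))"
        using rr(1) unfolding closed_segment_eq_real_ivl
        by (intro exI[of _ "if t j \<le> r (Suc (Suc j)) then max (t j) (t (Suc j)) else r (Suc (Suc j))"]) auto
      then obtain s where "0 < g s * g (r (Suc j))" "0 < g s * g (r (Suc (Suc j)))" using T by blast
      then show False using rr(2) by (auto simp: zero_less_mult_iff mult_less_0_iff)
    qed
    show "(f (t j) - g (t j)) * (f (t (Suc j)) - g (t (Suc j))) < 0"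
      using T rr(2) by (smt (verit, best) mult_less_0_iff)
  next
    fix j assume "j \<le> m - 2"
    then have "Suc j < m" using m by simp
    then show "t j \<in> {A<..<B}" using t[of j] by auto
  qed
  then show thesis by (rule that)
qed

lemma alternates_gap:
  assumes ode: "radial_ode k {A<..<B} V z p" and k: "1 \<le> k" and A: "0 \<le> A" and C: "0 < C"
    and V: "\<And>r. A < r \<Longrightarrow> r < B \<Longrightarrow> - C / r \<le> V r"
    and r: "A < a" "a < r" "r < b" "b < B" and sgn: "z a * z r < 0" "z r * z b < 0"
  shows "1 / C \<le> b - a"
proof -
  have main: "1 / C \<le> b - a" if ode: "radial_ode k {A<..<B} V z p" and sgn: "z a < 0" "0 < z r" "z b < 0"
    for z p
  proof -
    have "continuous_on {a..b} z"
      using r by (auto intro: continuous_on_subset[OF radial_ode_continuous[OF ode]])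
    from nodal_interval[OF this r(2,3) sgn] obtain c d where cd: "a < c" "c < r" "r < d" "d < b"
      "z c = 0" "z d = 0" "\<And>s. c < s \<Longrightarrow> s < d \<Longrightarrow> 0 < z s" by metis
    have sub: "{c..d} \<subseteq> {A<..<B}" using cd r by auto
    have "1 / C \<le> d - c"
      by (rule nodal_interval_length[OF radial_ode_subset[OF ode sub] k _ _ cd(5-7) C])
         (use cd r A V in auto)
    then show ?thesis using cd by linarith
  qed
  show ?thesis
  proof (cases "0 < z r")
    case True
    then show ?thesis using main[OF ode] sgn by (auto simp: mult_less_0_iff)
  next
    case False
    then show ?thesis using main[OF radial_ode_uminus[OF ode]] sgn by (auto simp: mult_less_0_iff)
  qed
qed

text \<open>
  Every second sign point advances by at least \<open>1 / C\<close>, so the length of the interval bounds the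
  number of sign changes.
\<close>

lemma alternates_bounded:
  assumes ode: "radial_ode k {A<..<B} V z p" and k: "1 \<le> k" and A: "0 \<le> A" and C: "0 < C"
    and V: "\<And>r. A < r \<Longrightarrow> r < B \<Longrightarrow> - C / r \<le> V r"
  obtains M where "\<And>m r. alternates {A<..<B} z m r \<Longrightarrow> m \<le> M"
proof
  fix m r assume alt: "alternates {A<..<B} z m r"
  have "r 0 + real i / C \<le> r (2 * i)" if "2 * i \<le> m" for i
    using that
  proof (induction i)
    case (Suc i)
    have "1 / C \<le> r (Suc (Suc (2 * i))) - r (2 * i)"
      by (rule alternates_gap[OF ode k A C V, of _ "r (Suc (2 * i))"])
         (use alt Suc.prems in \<open>auto simp: alternates_def\<close>)
    moreover have "real (Suc i) / C = real i / C + 1 / C" by (simp add: add_divide_distrib)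
    ultimately show ?case using Suc by simp
  qed simp
  from this[of "m div 2"] have "r 0 + real (m div 2) / C \<le> r (2 * (m div 2))" by simp
  moreover have "A < r 0" "r (2 * (m div 2)) < B" using alt by (auto simp: alternates_def)
  ultimately have "real (m div 2) / C < B - A" by linarith
  then have "real (m div 2) < C * (B - A)" using C by (simp add: field_simps)
  then have "m div 2 \<le> nat \<lceil>C * (B - A)\<rceil>" by linarith
  then show "m \<le> 2 * nat \<lceil>C * (B - A)\<rceil> + 1" by linarith
qed

section \<open>Solutions that are small at both ends of the interval\<close>

text \<open>
  An antiderivative of \<open>1 / r\<^sup>k\<close> for \<open>k \<in> {1, 2}\<close>: the radial harmonic function of dimension
  2 and 3, increasing and unbounded below at 0.
\<close>

definition radial_harmonic :: "nat \<Rightarrow> real \<Rightarrow> real" where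
  "radial_harmonic k t = (if k = 1 then ln t else - 1 / t)"

lemma radial_harmonic_derivative:
  assumes "k \<in> {1, 2}" "0 < t"
  shows "(radial_harmonic k has_real_derivative 1 / t ^ k) (at t)"
proof (cases "k = 1")
  case True
  then have "radial_harmonic k = ln" by (auto simp: radial_harmonic_def)
  then show ?thesis using assms True by (auto intro!: derivative_eq_intros)
next
  case False
  then have "radial_harmonic k = (\<lambda>t. - 1 / t)" by (auto simp: radial_harmonic_def)
  then show ?thesis using assms False by (auto intro!: derivative_eq_intros simp: power2_eq_square)
qed

lemma radial_harmonic_strict_mono:
  assumes "k \<in> {1, 2}" "0 < s" "s < t"
  shows "radial_harmonic k s < radial_harmonic k t"
  using assms by (auto simp: radial_harmonic_def field_simps)

lemma radial_harmonic_at_0: "filterlim (radial_harmonic k) at_bot (at_right 0)"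
proof (cases "k = 1")
  case True
  then have "radial_harmonic k = ln" by (auto simp: radial_harmonic_def)
  then show ?thesis using ln_at_0 by simp
next
  case False
  then have "radial_harmonic k = (\<lambda>t. - inverse t)" by (auto simp: radial_harmonic_def field_simps)
  then show ?thesis
    using filterlim_inverse_at_top_right by (simp add: filterlim_uminus_at_top)
qed

text \<open>
  A bound of the same form in both dimensions, so that one comparison function serves for both.
\<close>

lemma radial_harmonic_bound:
  assumes "k \<in> {1, 2}" "0 < s" "s \<le> t"
  shows "radial_harmonic k t - radial_harmonic k s \<le> max 1 t / s"
proof (cases "k = 1")
  case True
  have "ln (t / s) \<le> t / s" using assms ln_le_minus_one[of "t/s"] by auto
  also have "\<dots> \<le> max 1 t / s" using assms by (intro divide_right_mono) auto
  finally show ?thesis using True assms by (simp add: radial_harmonic_def ln_div)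
next
  case False
  have "1 / s \<le> max 1 t / s" using assms by (intro divide_right_mono) auto
  moreover have "0 \<le> 1 / t" using assms by simp
  ultimately have "- (1 / t) - - (1 / s) \<le> max 1 t / s" by linarith
  then show ?thesis using False by (simp add: radial_harmonic_def)
qed

text \<open>
  The decay of radial functions in \<open>H\<^sub>0\<^sup>1\<close>: the square is bounded by a multiple of the radial
  harmonic function that vanishes on the outer sphere and, in the case of an annulus, also of the
  one that vanishes on the inner sphere. At the centre of a ball, \<open>A = 0\<close>, this allows the square
  to blow up, but at most like \<open>1 / r\<close>.
\<close>

definition small_at_ends :: "nat \<Rightarrow> real \<Rightarrow> real \<Rightarrow> (real \<Rightarrow> real) \<Rightarrow> bool" where
  "small_at_ends k A B z \<longleftrightarrow>
     (\<exists>K>0. \<forall>r\<in>{A<..<B}.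
        (z r)\<^sup>2 \<le> K * (radial_harmonic k B - radial_harmonic k r) \<and>
        (0 < A \<longrightarrow> (z r)\<^sup>2 \<le> K * (radial_harmonic k r - radial_harmonic k A)))"

lemma small_at_ends_uminus: "small_at_ends k A B z \<Longrightarrow> small_at_ends k A B (\<lambda>r. - z r)"
  by (simp add: small_at_ends_def)

text \<open>
  Such a function is principal at the outer end: the logarithm of the harmonic function is, up to a
  factor, an antiderivative of a lower bound for \<open>1 / (r\<^sup>k z\<^sup>2)\<close>. In the case of a ball the harmonic
  function tends to infinity at the centre, and the same logarithm serves there.
\<close>

lemma small_at_ends_right:
  assumes small: "small_at_ends k A B z" and k: "k \<in> {1, 2}" and A: "0 \<le> A" "A < B"
    and pos: "\<And>r. A < r \<Longrightarrow> r < B \<Longrightarrow> 0 < z r"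
  obtains l l' where "\<And>r. A < r \<Longrightarrow> r < B \<Longrightarrow> (l has_real_derivative l' r) (at r)"
    "\<And>r. A < r \<Longrightarrow> r < B \<Longrightarrow> l' r \<le> 1 / (r ^ k * (z r)\<^sup>2)"
    "filterlim l at_top (at_left B)" "A = 0 \<Longrightarrow> filterlim l at_bot (at_right A)"
proof -
  let ?L = "radial_harmonic k"
  obtain K where K: "K > 0" "\<And>r. A < r \<Longrightarrow> r < B \<Longrightarrow> (z r)\<^sup>2 \<le> K * (?L B - ?L r)"
    using small unfolding small_at_ends_def by auto
  define l where "l = (\<lambda>r. - (1 / K) * ln (?L B - ?L r))"
  have Lpos: "0 < ?L B - ?L r" if "A < r" "r < B" for r
    using radial_harmonic_strict_mono[OF k, of r B] that A by auto
  have d: "(l has_real_derivative 1 / (r ^ k * (K * (?L B - ?L r)))) (at r)" if "A < r" "r < B" for r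
    unfolding l_def using that A K(1) Lpos[OF that]
    by (auto intro!: derivative_eq_intros radial_harmonic_derivative[OF k] simp: field_simps)
  have le: "1 / (r ^ k * (K * (?L B - ?L r))) \<le> 1 / (r ^ k * (z r)\<^sup>2)" if "A < r" "r < B" for r
    using that A K pos[of r] Lpos[OF that] by (intro divide_left_mono mult_left_mono) auto
  have cont: "(?L \<longlongrightarrow> ?L B) (at_left B)"
    using DERIV_isCont[OF radial_harmonic_derivative[OF k, of B]] A
    by (auto simp: isCont_def intro: tendsto_within_subset)
  have "filterlim (\<lambda>r. ?L B - ?L r) (at_right 0) (at_left B)"
    unfolding filterlim_at
  proof
    show "((\<lambda>r. ?L B - ?L r) \<longlongrightarrow> 0) (at_left B)" using tendsto_diff[OF tendsto_const[of "?L B"] cont] by simp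
    show "\<forall>\<^sub>F r in at_left B. ?L B - ?L r \<in> {0<..} \<and> ?L B - ?L r \<noteq> 0"
      using eventually_at_left_real[OF A(2)] 
    proof eventually_elim
      case (elim r)
      then show ?case using Lpos[of r] by simp
    qed
  qed
  then have "filterlim (\<lambda>r. ln (?L B - ?L r)) at_bot (at_left B)"
    using filterlim_compose[OF ln_at_0] by blast
  then have top: "filterlim l at_top (at_left B)"
    unfolding l_def using K(1)
    by (subst filterlim_tendsto_neg_mult_at_top_iff[OF tendsto_const]) auto
  have bot: "filterlim l at_bot (at_right A)" if "A = 0"
  proof -
    have "filterlim (\<lambda>r. ?L B + - ?L r) at_top (at_right A)"
      using radial_harmonic_at_0[of k] that
      by (intro filterlim_tendsto_add_at_top[OF tendsto_const]) (simp add: filterlim_uminus_at_top)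
    then have "filterlim (\<lambda>r. ln (?L B - ?L r)) at_top (at_right A)"
      using filterlim_compose[OF ln_at_top] by simp
    then show ?thesis unfolding l_def using K(1)
      by (subst filterlim_tendsto_neg_mult_at_bot_iff[OF tendsto_const]) auto
  qed
  show thesis by (rule that[OF d le top bot])
qed

lemma small_at_ends_left:
  assumes small: "small_at_ends k A B z" and k: "k \<in> {1, 2}" and A: "0 \<le> A" "A < B"
    and pos: "\<And>r. A < r \<Longrightarrow> r < B \<Longrightarrow> 0 < z r"
  obtains l l' where "\<And>r. A < r \<Longrightarrow> r < B \<Longrightarrow> (l has_real_derivative l' r) (at r)"
    "\<And>r. A < r \<Longrightarrow> r < B \<Longrightarrow> l' r \<le> 1 / (r ^ k * (z r)\<^sup>2)"
    "filterlim l at_bot (at_right A)"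
proof (cases "A = 0")
  case True
  then show ?thesis using small_at_ends_right[OF small k A pos] that by metis
next
  case False
  let ?L = "radial_harmonic k"
  have A0: "A > 0" using False A by simp
  obtain K where K: "K > 0" "\<And>r. A < r \<Longrightarrow> r < B \<Longrightarrow> (z r)\<^sup>2 \<le> K * (?L r - ?L A)"
    using small A0 unfolding small_at_ends_def by auto
  define l where "l = (\<lambda>r. (1 / K) * ln (?L r - ?L A))"
  have Lpos: "0 < ?L r - ?L A" if "A < r" "r < B" for r
    using radial_harmonic_strict_mono[OF k A0, of r] that A by auto
  have d: "(l has_real_derivative 1 / (r ^ k * (K * (?L r - ?L A)))) (at r)" if "A < r" "r < B" for r
    unfolding l_def using that A K(1) Lpos[OF that]
    by (auto intro!: derivative_eq_intros radial_harmonic_derivative[OF k] simp: field_simps)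
  have le: "1 / (r ^ k * (K * (?L r - ?L A))) \<le> 1 / (r ^ k * (z r)\<^sup>2)" if "A < r" "r < B" for r
    using that A K pos[of r] Lpos[OF that] by (intro divide_left_mono mult_left_mono) auto
  have cont: "(?L \<longlongrightarrow> ?L A) (at_right A)"
    using DERIV_isCont[OF radial_harmonic_derivative[OF k A0]]
    by (auto simp: isCont_def intro: tendsto_within_subset)
  have "filterlim (\<lambda>r. ?L r - ?L A) (at_right 0) (at_right A)"
    unfolding filterlim_at
  proof
    show "((\<lambda>r. ?L r - ?L A) \<longlongrightarrow> 0) (at_right A)" using tendsto_diff[OF cont tendsto_const[of "?L A"]] by simp
    show "\<forall>\<^sub>F r in at_right A. ?L r - ?L A \<in> {0<..} \<and> ?L r - ?L A \<noteq> 0"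
      using eventually_at_right_real[OF A(2)] 
    proof eventually_elim
      case (elim r)
      then show ?case using Lpos[of r] by simp
    qed
  qed
  then have "filterlim (\<lambda>r. ln (?L r - ?L A)) at_bot (at_right A)"
    using filterlim_compose[OF ln_at_0] by blast
  then have bot: "filterlim l at_bot (at_right A)"
    unfolding l_def using K(1)
    by (subst filterlim_tendsto_pos_mult_at_bot_iff[OF tendsto_const]) auto
  show thesis by (rule that[OF d le bot])
qed

text \<open>
  The argument of the nodal interval, now on the whole domain: the decay replaces the zeros at
  the ends.
\<close>

lemma no_global_domination:
  assumes pair: "competing_pair k {A<..<B} \<beta> S f p g q" and \<beta>: "\<beta> \<le> -1"
    and S: "\<And>r. 0 \<le> S r" and k: "k \<in> {1, 2}" and A: "0 \<le> A" "A < B"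
    and pos: "\<And>r. A < r \<Longrightarrow> r < B \<Longrightarrow> 0 < g r" and dom: "\<And>r. A < r \<Longrightarrow> r < B \<Longrightarrow> g r \<le> f r"
    and small: "small_at_ends k A B g"
  shows False
proof -
  let ?V = "\<lambda>r. 1 - (g r)\<^sup>2 - \<beta> * (f r)\<^sup>2 - \<beta> * S r"
  have ode: "radial_ode k {A<..<B} ?V g q" using pair unfolding competing_pair_def by blast
  obtain l l' where l: "\<And>r. A < r \<Longrightarrow> r < B \<Longrightarrow> (l has_real_derivative l' r) (at r)"
    "\<And>r. A < r \<Longrightarrow> r < B \<Longrightarrow> l' r \<le> 1 / (r ^ k * (g r)\<^sup>2)" "filterlim l at_top (at_left B)"
    using small_at_ends_right[OF small k A pos] by metis
  obtain m m' where m: "\<And>r. A < r \<Longrightarrow> r < B \<Longrightarrow> (m has_real_derivative m' r) (at r)"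
    "\<And>r. A < r \<Longrightarrow> r < B \<Longrightarrow> m' r \<le> 1 / (r ^ k * (g r)\<^sup>2)" "filterlim m at_bot (at_right A)"
    using small_at_ends_left[OF small k A pos] by metis
  have principal: "(?V r - V' r) * \<phi> r = 0"
    if "radial_ode k {A<..<B} V' \<phi> q'" "\<And>t. A < t \<Longrightarrow> t < B \<Longrightarrow> 0 \<le> \<phi> t"
      "\<And>t. A < t \<Longrightarrow> t < B \<Longrightarrow> V' t \<le> ?V t" "A < r" "r < B" for V' \<phi> q' r
    by (rule sturm_principal[OF ode that(1) A(1) pos that(2,3) l m that(4,5)])
  have eq: "f r = g r" if r: "A < r" "r < B" for r
  proof -
    have "(?V r - (1 - ((f r)\<^sup>2 + (g r)\<^sup>2 + (1 - \<beta>) * (f r * g r) + \<beta> * S r))) * (f r - g r) = 0"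
    proof (rule principal[OF competing_pair_diff[OF pair] _ _ r])
      fix t assume t: "A < t" "t < B"
      then have "0 \<le> (1 - \<beta>) * (f t * (f t + g t))" using pos[of t] dom[of t] \<beta> by simp
      then show "1 - ((f t)\<^sup>2 + (g t)\<^sup>2 + (1 - \<beta>) * (f t * g t) + \<beta> * S t) \<le> ?V t"
        using potential_difference[of "g t" \<beta> "f t" "S t"] by linarith
    qed (use dom in simp)
    then have "(1 - \<beta>) * (f r * (f r + g r)) * (f r - g r) = 0"
      unfolding potential_difference .
    then show ?thesis using pos[OF r] dom[OF r] \<beta> by auto
  qed
  have V1: "1 \<le> ?V r" if "A < r" "r < B" for r
    using potential_on_diagonal[OF \<beta> S[of r], of "g r"] eq[OF that] by simp
  define r where "r = (A + B) / 2"
  have r: "A < r" "r < B" using A by (auto simp: r_def)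
  have "(?V r - 0) * 1 = 0"
  proof (rule principal[OF radial_ode_const _ _ r])
    fix t assume "A < t" "t < B" then show "0 \<le> ?V t" using V1[of t] by linarith
  qed auto
  then show False using V1[OF r] by simp
qed

lemma no_sign_change_cases:
  fixes z :: "real \<Rightarrow> real"
  assumes "\<forall>x\<in>I. \<forall>y\<in>I. 0 \<le> z x * z y"
  shows "(\<forall>x\<in>I. 0 \<le> z x) \<or> (\<forall>x\<in>I. z x \<le> 0)"
proof (rule ccontr)
  assume "\<not> ?thesis"
  then obtain x y where "x \<in> I" "z x < 0" "y \<in> I" "0 < z y" by (auto simp: not_le)
  then show False using assms mult_neg_pos[of "z x" "z y"] by force
qed

text \<open>
  If \<open>f - g\<close> did not change sign, one of \<open>f\<close>, \<open>g\<close> would dominate the other. Components without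
  sign changes are strictly signed by unique continuation, so \<open>f g \<ge> 0\<close> gives them the same
  sign, and after changing signs and names the previous lemma applies.
\<close>

lemma difference_changes_sign:
  assumes pair: "competing_pair k {A<..<B} \<beta> S f p g q" and \<beta>: "\<beta> \<le> -1"
    and S: "\<And>r. 0 \<le> S r" "continuous_on {A<..<B} S"
    and k: "k \<in> {1, 2}" and A: "0 \<le> A" "A < B"
    and small: "small_at_ends k A B f" "small_at_ends k A B g"
    and f0: "\<exists>r\<in>{A<..<B}. f r \<noteq> 0" and g0: "\<exists>r\<in>{A<..<B}. g r \<noteq> 0"
    and fsgn: "\<forall>x\<in>{A<..<B}. \<forall>y\<in>{A<..<B}. 0 \<le> f x * f y"
    and gsgn: "\<forall>x\<in>{A<..<B}. \<forall>y\<in>{A<..<B}. 0 \<le> g x * g y"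
    and fg: "\<And>x. x \<in> {A<..<B} \<Longrightarrow> 0 \<le> f x * g x"
  shows "\<exists>x\<in>{A<..<B}. \<exists>y\<in>{A<..<B}. (f x - g x) * (f y - g y) < 0"
proof (rule ccontr)
  assume "\<not> ?thesis"
  then have "\<forall>x\<in>{A<..<B}. \<forall>y\<in>{A<..<B}. 0 \<le> (f x - g x) * (f y - g y)"
    using not_less by blast
  then have wsgn: "(\<forall>x\<in>{A<..<B}. 0 \<le> f x - g x) \<or> (\<forall>x\<in>{A<..<B}. f x - g x \<le> 0)"
    by (rule no_sign_change_cases)
  have strict: "0 < u r" if "competing_pair k {A<..<B} \<beta> S u u' v v'" "\<exists>r\<in>{A<..<B}. u r \<noteq> 0"
    "\<forall>r\<in>{A<..<B}. 0 \<le> u r" "r \<in> {A<..<B}" for u u' v v' r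
  proof -
    have odes: "radial_ode k {A<..<B} (\<lambda>r. 1 - (u r)\<^sup>2 - \<beta> * (v r)\<^sup>2 - \<beta> * S r) u u'"
      and "continuous_on {A<..<B} u" "continuous_on {A<..<B} v"
      using that(1) radial_ode_continuous unfolding competing_pair_def by blast+
    then have "continuous_on {A<..<B} (\<lambda>r. 1 - (u r)\<^sup>2 - \<beta> * (v r)\<^sup>2 - \<beta> * S r)"
      using S by (intro continuous_intros)
    moreover from that(2) obtain r0 where "A < r0" "r0 < B" "u r0 \<noteq> 0" by auto
    ultimately show ?thesis
      using radial_ode_strict_sign[OF odes A(1)] that(3,4) by simp
  qed
  have main: False if "competing_pair k {A<..<B} \<beta> S u u' v v'" "\<forall>r\<in>{A<..<B}. 0 \<le> v r"
      "\<exists>r\<in>{A<..<B}. v r \<noteq> 0" "\<forall>r\<in>{A<..<B}. v r \<le> u r" "small_at_ends k A B v" for u u' v v'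
    by (rule no_global_domination[OF that(1) \<beta> S(1) k A _ _ that(5)])
       (use strict[OF competing_pair_sym[OF that(1)] that(3,2)] that(4) in auto)
  note sym = competing_pair_sym
  have same: False if "competing_pair k {A<..<B} \<beta> S u u' v v'" "\<forall>r\<in>{A<..<B}. 0 \<le> u r" "\<forall>r\<in>{A<..<B}. 0 \<le> v r"
      "\<exists>r\<in>{A<..<B}. u r \<noteq> 0" "\<exists>r\<in>{A<..<B}. v r \<noteq> 0"
      "(\<forall>x\<in>{A<..<B}. 0 \<le> u x - v x) \<or> (\<forall>x\<in>{A<..<B}. u x - v x \<le> 0)"
      "small_at_ends k A B u" "small_at_ends k A B v" for u u' v v'
    using main[OF that(1,3,5)] main[OF sym[OF that(1)] that(2,4)] that(6-8) by auto
  have opposite: False if "\<forall>r\<in>{A<..<B}. 0 \<le> u r" "\<forall>r\<in>{A<..<B}. v r \<le> 0"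
      "competing_pair k {A<..<B} \<beta> S u u' x x'" "competing_pair k {A<..<B} \<beta> S (\<lambda>r. - v r) v' y y'"
      "\<exists>r\<in>{A<..<B}. u r \<noteq> 0" "\<exists>r\<in>{A<..<B}. v r \<noteq> 0"
      "\<And>r. r \<in> {A<..<B} \<Longrightarrow> 0 \<le> u r * v r" for u u' v v' x x' y y'
  proof -
    define r where "r = (A + B) / 2"
    have r: "r \<in> {A<..<B}" using A by (auto simp: r_def)
    have "0 < u r" using strict[OF that(3,5,1) r] .
    moreover have "0 < - v r" using strict[OF that(4) _ _ r] that(2,6) by auto
    ultimately show False using that(7)[OF r] by (auto simp: zero_le_mult_iff)
  qed
  note neg = competing_pair_uminus[OF pair]
  show False
    using no_sign_change_cases[OF fsgn] no_sign_change_cases[OF gsgn]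
  proof (elim disjE)
    assume "\<forall>x\<in>{A<..<B}. 0 \<le> f x" "\<forall>x\<in>{A<..<B}. 0 \<le> g x"
    then show False using same[OF pair] f0 g0 wsgn small by blast
  next
    assume *: "\<forall>x\<in>{A<..<B}. 0 \<le> f x" "\<forall>x\<in>{A<..<B}. g x \<le> 0"
    show False by (rule opposite[OF * pair sym[OF neg] f0 g0 fg])
  next
    assume *: "\<forall>x\<in>{A<..<B}. f x \<le> 0" "\<forall>x\<in>{A<..<B}. 0 \<le> g x"
    show False by (rule opposite[OF *(2,1) sym[OF pair] neg g0 f0]) (use fg in \<open>auto simp: mult.commute\<close>)
  next
    assume "\<forall>x\<in>{A<..<B}. f x \<le> 0" "\<forall>x\<in>{A<..<B}. g x \<le> 0"
    then show False using f0 g0 wsgn small by (intro same[OF neg]) (auto simp: small_at_ends_uminus)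
  qed
qed

section \<open>Smooth functions and compactly supported tests\<close>

definition smooth :: "('a::euclidean_space \<Rightarrow> real) \<Rightarrow> bool" where
  "smooth f \<longleftrightarrow> (\<forall>k. times_cont_diff k f)"

lemma GDERIV_unique: "GDERIV f x :> d \<Longrightarrow> GDERIV f x :> e \<Longrightarrow> d = e"
  unfolding gderiv_def using has_derivative_unique[of f "\<lambda>h. h \<bullet> d" x "\<lambda>h. h \<bullet> e"]
  by (metis inner_commute vector_eq_rdot)

lemma grad_eq: "GDERIV f x :> d \<Longrightarrow> grad f x = d"
  unfolding grad_def using GDERIV_unique by blast

lemma times_cont_diff_0_if_GDERIV:
  assumes "\<forall>x. GDERIV f x :> g x" shows "times_cont_diff 0 f"
  using assms unfolding gderiv_def times_cont_diff.simps
  by (meson continuous_at_imp_continuous_on has_derivative_continuous)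

lemma times_cont_diff_Suc_D: "times_cont_diff (Suc k) f \<Longrightarrow> times_cont_diff k f"
proof (induction k arbitrary: f)
  case 0
  then show ?case using times_cont_diff_0_if_GDERIV by (metis times_cont_diff.simps(2))
next
  case (Suc k)
  then show ?case by (subst times_cont_diff.simps(2), subst (asm) times_cont_diff.simps(2)) blast
qed

lemma times_cont_diff_const: "times_cont_diff k (\<lambda>_. c)"
  by (induction k arbitrary: c) (auto intro!: exI[of _ "\<lambda>_. 0"] GDERIV_const)

lemma times_cont_diff_add:
  "times_cont_diff k f \<Longrightarrow> times_cont_diff k g \<Longrightarrow> times_cont_diff k (\<lambda>x. f x + g x)"
proof (induction k arbitrary: f g)
  case 0
  then show ?case by (simp add: continuous_on_add)
next
  case (Suc k)
  obtain f' where f': "\<And>x. GDERIV f x :> f' x" "\<And>b. b \<in> Basis \<Longrightarrow> times_cont_diff k (\<lambda>x. f' x \<bullet> b)"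
    using Suc.prems(1) by auto
  obtain g' where g': "\<And>x. GDERIV g x :> g' x" "\<And>b. b \<in> Basis \<Longrightarrow> times_cont_diff k (\<lambda>x. g' x \<bullet> b)"
    using Suc.prems(2) by auto
  show ?case unfolding times_cont_diff.simps
    using f' g' Suc.IH by (intro exI[of _ "\<lambda>x. f' x + g' x"]) (auto simp: inner_add_left GDERIV_add)
qed

lemma times_cont_diff_mult:
  "times_cont_diff k f \<Longrightarrow> times_cont_diff k g \<Longrightarrow> times_cont_diff k (\<lambda>x. f x * g x)"
proof (induction k arbitrary: f g)
  case 0
  then show ?case by (simp add: continuous_on_mult)
next
  case (Suc k)
  obtain f' where f': "\<And>x. GDERIV f x :> f' x" "\<And>b. b \<in> Basis \<Longrightarrow> times_cont_diff k (\<lambda>x. f' x \<bullet> b)"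
    using Suc.prems(1) by auto
  obtain g' where g': "\<And>x. GDERIV g x :> g' x" "\<And>b. b \<in> Basis \<Longrightarrow> times_cont_diff k (\<lambda>x. g' x \<bullet> b)"
    using Suc.prems(2) by auto
  have fg: "times_cont_diff k f" "times_cont_diff k g" using Suc.prems times_cont_diff_Suc_D by blast+
  show ?case unfolding times_cont_diff.simps
    using f' g' Suc.IH fg
    by (intro exI[of _ "\<lambda>x. f x *\<^sub>R g' x + g x *\<^sub>R f' x"])
       (auto simp: inner_add_left intro!: GDERIV_mult times_cont_diff_add)
qed

lemma times_cont_diff_inner: "times_cont_diff k (\<lambda>x. x \<bullet> b)"
proof (cases k)
  case 0
  then show ?thesis by (simp add: continuous_intros)
next
  case (Suc m)
  have "GDERIV (\<lambda>x. x \<bullet> b) x :> b" for x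
    unfolding gderiv_def by (auto intro!: derivative_eq_intros)
  then show ?thesis using Suc times_cont_diff_const by (auto intro!: exI[of _ "\<lambda>_. b"])
qed

lemma times_cont_diff_Suc_real:
  "times_cont_diff (Suc k) (f::real \<Rightarrow> real) \<longleftrightarrow>
     (\<exists>f'. (\<forall>x. (f has_real_derivative f' x) (at x)) \<and> times_cont_diff k f')"
  by simp

lemma times_cont_diff_affine:
  fixes f :: "real \<Rightarrow> real"
  shows "times_cont_diff k f \<Longrightarrow> times_cont_diff k (\<lambda>t. f (s * t + c))"
proof (induction k arbitrary: f)
  case 0
  then show ?case
    by (auto intro!: continuous_on_compose2[of UNIV f] continuous_intros)
next
  case (Suc k)
  obtain f' where f': "\<And>x. (f has_real_derivative f' x) (at x)" "times_cont_diff k f'"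
    using Suc.prems unfolding times_cont_diff_Suc_real by auto
  have "((\<lambda>t. f (s * t + c)) has_real_derivative s * f' (s * x + c)) (at x)" for x
    by (rule DERIV_cong[OF DERIV_chain2[OF f'(1)]]) (auto intro!: derivative_eq_intros)
  moreover have "times_cont_diff k (\<lambda>x. s * f' (s * x + c))"
    using Suc.IH[OF f'(2)] times_cont_diff_const by (intro times_cont_diff_mult)
  ultimately show ?case unfolding times_cont_diff_Suc_real
    by (intro exI[of _ "\<lambda>x. s * f' (s * x + c)"] conjI allI)
qed

text \<open>
  The functions \<open>exp (- 1 / t) / t\<^sup>m\<close>, continued by zero. They are closed under differentiation
  up to linear combinations, which is why all \<open>m\<close> are treated at once.
\<close>

definition flat_exp :: "nat \<Rightarrow> real \<Rightarrow> real" where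
  "flat_exp m t = (if 0 < t then exp (- inverse t) * inverse t ^ m else 0)"

lemma flat_exp_derivative:
  "(flat_exp m has_real_derivative flat_exp (m + 2) t - real m * flat_exp (m + 1) t) (at t)"
proof (cases t "0::real" rule: linorder_cases)
  case less
  have "((\<lambda>_. 0) has_real_derivative 0) (at t)" by simp
  then have "(flat_exp m has_real_derivative 0) (at t)"
    by (rule has_field_derivative_transform_within_open[of _ _ _ "{..<0}"])
       (use less in \<open>auto simp: flat_exp_def\<close>)
  then show ?thesis using less by (simp add: flat_exp_def)
next
  case greater
  have "((\<lambda>t. exp (- inverse t) * inverse t ^ m) has_real_derivative
     exp (- inverse t) * inverse t ^ (m + 2) - real m * (exp (- inverse t) * inverse t ^ (m + 1))) (at t)"
  proof (rule DERIV_cong)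
    show "((\<lambda>t. exp (- inverse t) * inverse t ^ m) has_real_derivative
       exp (- inverse t) * (inverse t)\<^sup>2 * inverse t ^ m +
       real m * inverse t ^ (m - 1) * (- (inverse t)\<^sup>2) * exp (- inverse t)) (at t)"
      using greater by (auto intro!: derivative_eq_intros simp: power2_eq_square)
  qed (cases m, auto simp: algebra_simps power2_eq_square)
  then have "(flat_exp m has_real_derivative
     exp (- inverse t) * inverse t ^ (m + 2) - real m * (exp (- inverse t) * inverse t ^ (m + 1))) (at t)"
    by (rule has_field_derivative_transform_within_open[of _ _ _ "{0<..}"])
       (use greater in \<open>auto simp: flat_exp_def\<close>)
  then show ?thesis using greater by (simp add: flat_exp_def)
next
  case equal
  have lim: "((\<lambda>x::real. x ^ (m + 1) / exp x) \<longlongrightarrow> 0) at_top" for m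
    by (rule tendsto_power_div_exp_0)
  have "((\<lambda>h. inverse h ^ (m + 1) / exp (inverse h)) \<longlongrightarrow> 0) (at_right (0::real))"
    by (rule filterlim_compose[OF lim filterlim_inverse_at_top_right])
  then have "((\<lambda>h. (flat_exp m (0 + h) - flat_exp m 0) / h) \<longlongrightarrow> 0) (at_right 0)"
    by (rule Lim_transform_eventually)
       (auto simp: eventually_at_filter flat_exp_def exp_minus field_simps)
  moreover have "((\<lambda>h. (flat_exp m (0 + h) - flat_exp m 0) / h) \<longlongrightarrow> 0) (at_left 0)"
    by (rule Lim_transform_eventually[OF tendsto_const])
       (auto simp: eventually_at_filter flat_exp_def)
  ultimately have "(flat_exp m has_real_derivative 0) (at 0)"
    unfolding DERIV_def by (intro filterlim_split_at)
  then show ?thesis using equal by (simp add: flat_exp_def)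
qed

lemma times_cont_diff_flat_exp: "times_cont_diff k (flat_exp m)"
proof (induction k arbitrary: m)
  case 0
  have "\<forall>t. GDERIV (flat_exp m) t :> flat_exp (m + 2) t - real m * flat_exp (m + 1) t"
    using flat_exp_derivative by (simp del: add_2_eq_Suc' add_Suc_right)
  then show ?case by (rule times_cont_diff_0_if_GDERIV)
next
  case (Suc k)
  have "times_cont_diff k (\<lambda>t. flat_exp (m + 2) t + (- real m) * flat_exp (m + 1) t)"
    by (intro times_cont_diff_add times_cont_diff_mult times_cont_diff_const Suc)
  then show ?case unfolding times_cont_diff_Suc_real using flat_exp_derivative[of m]
    by (intro exI[of _ "\<lambda>t. flat_exp (m + 2) t - real m * flat_exp (m + 1) t"] conjI allI) auto
qed

text \<open>
  The test functions on the open interval from \<open>a\<close> to \<open>b\<close>. For \<open>0 \<le> a\<close> they vanish near 0, so that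
  they may be divided by the radius and composed with the norm without losing smoothness.
\<close>

definition compact_test :: "real \<Rightarrow> real \<Rightarrow> (real \<Rightarrow> real) \<Rightarrow> bool" where
  "compact_test a b \<psi> \<longleftrightarrow>
     smooth \<psi> \<and> (\<exists>c d. a < c \<and> c < d \<and> d < b \<and> (\<forall>t. \<psi> t \<noteq> 0 \<longrightarrow> c < t \<and> t < d))"

lemma compact_testE:
  assumes "compact_test a b \<psi>"
  obtains c d where "a < c" "c < d" "d < b" "\<And>t. t \<le> c \<Longrightarrow> \<psi> t = 0" "\<And>t. d \<le> t \<Longrightarrow> \<psi> t = 0"
  using assms unfolding compact_test_def by (metis not_less)

lemma compact_testI:
  assumes "smooth \<psi>" "a < c" "c < d" "d < b" "\<And>t. t \<le> c \<Longrightarrow> \<psi> t = 0" "\<And>t. d \<le> t \<Longrightarrow> \<psi> t = 0"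
  shows "compact_test a b \<psi>"
  using assms unfolding compact_test_def by (metis not_less)

lemma compact_test_mono: "compact_test a b \<psi> \<Longrightarrow> a' \<le> a \<Longrightarrow> b \<le> b' \<Longrightarrow> compact_test a' b' \<psi>"
  unfolding compact_test_def by (meson le_less_trans less_le_trans)

lemma compact_test_outside: "compact_test a b \<psi> \<Longrightarrow> t \<notin> {a<..<b} \<Longrightarrow> \<psi> t = 0"
  unfolding compact_test_def by fastforce

lemma compact_test_continuous: "compact_test a b \<psi> \<Longrightarrow> continuous_on S \<psi>"
  unfolding compact_test_def smooth_def
  by (metis continuous_on_subset subset_UNIV times_cont_diff.simps(1))

lemma compact_test_lincomb:
  assumes "compact_test a b \<psi>" "compact_test a b \<eta>"
  shows "compact_test a b (\<lambda>t. \<psi> t + s * \<eta> t)"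
proof -
  obtain c d where cd: "a < c" "c < d" "d < b" "\<And>t. t \<le> c \<Longrightarrow> \<psi> t = 0" "\<And>t. d \<le> t \<Longrightarrow> \<psi> t = 0"
    using compact_testE[OF assms(1)] by blast
  obtain c' d' where cd': "a < c'" "c' < d'" "d' < b" "\<And>t. t \<le> c' \<Longrightarrow> \<eta> t = 0" "\<And>t. d' \<le> t \<Longrightarrow> \<eta> t = 0"
    using compact_testE[OF assms(2)] by blast
  show ?thesis
  proof (rule compact_testI)
    show "smooth (\<lambda>t. \<psi> t + s * \<eta> t)" using assms unfolding compact_test_def smooth_def
      by (auto intro!: times_cont_diff_add times_cont_diff_mult times_cont_diff_const)
    show "a < min c c'" "min c c' < max d d'" "max d d' < b" using cd cd' by auto
  qed (use cd cd' in auto)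
qed

lemma smooth_power: "smooth (\<lambda>t::real. t ^ k)"
proof (induction k)
  case 0
  show ?case by (simp add: smooth_def times_cont_diff_const)
next
  case (Suc k)
  have "times_cont_diff j (\<lambda>t::real. t)" for j using times_cont_diff_inner[of j "1::real"] by simp
  then show ?case using Suc by (simp add: smooth_def times_cont_diff_mult)
qed

lemma compact_test_mult:
  assumes "compact_test a b \<psi>" "smooth g"
  shows "compact_test a b (\<lambda>t. g t * \<psi> t)"
  using assms unfolding compact_test_def smooth_def by (auto intro!: times_cont_diff_mult) metis

lemma compact_test_deriv:
  assumes "compact_test a b \<psi>"
  obtains \<psi>' where "compact_test a b \<psi>'" "\<And>t. (\<psi> has_real_derivative \<psi>' t) (at t)"
proof -
  obtain c d where cd: "a < c" "c < d" "d < b" "\<And>t. t \<le> c \<Longrightarrow> \<psi> t = 0" "\<And>t. d \<le> t \<Longrightarrow> \<psi> t = 0"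
    using compact_testE[OF assms(1)] by blast
  have sm: "times_cont_diff k \<psi>" for k using assms by (simp add: compact_test_def smooth_def)
  obtain \<psi>' where d: "\<And>t. (\<psi> has_real_derivative \<psi>' t) (at t)"
    using sm[of "Suc 0"] unfolding times_cont_diff_Suc_real by auto
  have "times_cont_diff k \<psi>'" for k
  proof -
    obtain f where f: "\<And>t. (\<psi> has_real_derivative f t) (at t)" "times_cont_diff k f"
      using sm[of "Suc k"] unfolding times_cont_diff_Suc_real by auto
    then have "f = \<psi>'" using d DERIV_unique by blast
    then show ?thesis using f by simp
  qed
  then have "smooth \<psi>'" by (simp add: smooth_def)
  moreover have "\<psi>' t = 0" if "t < c" for t
    by (rule DERIV_local_const[OF d, of "c - t"]) (use that cd in auto)
  moreover have "\<psi>' t = 0" if "t > d" for t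
    by (rule DERIV_local_const[OF d, of "t - d"]) (use that cd in auto)
  ultimately have "compact_test a b \<psi>'"
    using cd by (intro compact_testI[of _ _ "(a + c) / 2" "(d + b) / 2"]) auto
  then show thesis using d that by blast
qed

text \<open>
  Division by the radius stays smooth for functions that vanish near 0. The derivative of the
  quotient is \<open>\<psi>' / t - \<psi> / t / t\<close>, so the induction has to quantify over \<open>\<psi>\<close>.
\<close>

lemma times_cont_diff_divide:
  assumes "times_cont_diff k \<psi>" "0 < c" "\<And>t. t \<le> c \<Longrightarrow> \<psi> t = 0"
  shows "times_cont_diff k (\<lambda>t. \<psi> t / t :: real)"
  using assms
proof (induction k arbitrary: \<psi> c)
  case 0
  have "continuous_on {0<..} (\<lambda>t. \<psi> t / t)"
    using 0 by (intro continuous_intros) (auto intro: continuous_on_subset)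
  moreover have "continuous_on {..<c} (\<lambda>t. \<psi> t / t)"
    by (subst continuous_on_cong[OF refl, of _ _ "\<lambda>_. 0"]) (use 0 in auto)
  ultimately have "continuous_on ({0<..} \<union> {..<c}) (\<lambda>t. \<psi> t / t)"
    by (intro continuous_on_open_Un) auto
  moreover have "{0<..} \<union> {..<c} = UNIV" using 0 by auto
  ultimately show ?case by simp
next
  case (Suc k)
  obtain \<psi>' where d: "\<And>t. (\<psi> has_real_derivative \<psi>' t) (at t)" and k: "times_cont_diff k \<psi>'"
    using Suc.prems(1) unfolding times_cont_diff_Suc_real by auto
  have z: "\<psi>' t = 0" if "t < c" for t
    by (rule DERIV_local_const[OF d, of "c - t"]) (use that Suc.prems in auto)
  have "((\<lambda>t. \<psi> t / t) has_real_derivative \<psi>' t / t + (- 1) * (\<psi> t / t / t)) (at t)" for t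
  proof (cases "t < c")
    case True
    have "((\<lambda>_. 0) has_real_derivative 0) (at t)" by simp
    then have "((\<lambda>t. \<psi> t / t) has_real_derivative 0) (at t)"
      by (rule has_field_derivative_transform_within_open[of _ _ _ "{..<c}"])
         (use True Suc.prems in auto)
    then show ?thesis using True z Suc.prems by simp
  next
    case False
    then have "t \<noteq> 0" using Suc.prems by auto
    then show ?thesis by (auto intro!: derivative_eq_intros d simp: field_simps)
  qed
  moreover have "times_cont_diff k (\<lambda>t. \<psi>' t / t + (- 1) * (\<psi> t / t / t))"
  proof (intro times_cont_diff_add times_cont_diff_mult times_cont_diff_const)
    show "times_cont_diff k (\<lambda>t. \<psi>' t / t)"
      by (rule Suc.IH[OF k, of "c/2"]) (use z Suc.prems in auto)
    have "times_cont_diff k (\<lambda>t. \<psi> t / t)"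
      by (rule Suc.IH[OF times_cont_diff_Suc_D[OF Suc.prems(1)] Suc.prems(2,3)])
    then show "times_cont_diff k (\<lambda>t. \<psi> t / t / t)"
      by (rule Suc.IH[OF _ Suc.prems(2)]) (use Suc.prems in auto)
  qed
  ultimately show ?case unfolding times_cont_diff_Suc_real
    by (intro exI[of _ "\<lambda>t. \<psi>' t / t + (- 1) * (\<psi> t / t / t)"] conjI allI)
qed

lemma compact_test_divide:
  assumes "compact_test a b \<psi>" "0 \<le> a"
  shows "compact_test a b (\<lambda>t. \<psi> t / t)"
proof -
  obtain c d where cd: "a < c" "c < d" "d < b" "\<And>t. t \<le> c \<Longrightarrow> \<psi> t = 0" "\<And>t. d \<le> t \<Longrightarrow> \<psi> t = 0"
    using compact_testE[OF assms(1)] by blast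
  have "smooth (\<lambda>t. \<psi> t / t)" unfolding smooth_def
    using assms cd by (intro allI times_cont_diff_divide[of _ _ c]) (auto simp: compact_test_def smooth_def)
  then show ?thesis using cd by (intro compact_testI) auto
qed

lemma compact_test_divide_power:
  assumes "compact_test a b \<psi>" "0 \<le> a"
  shows "compact_test a b (\<lambda>t. \<psi> t / t ^ k)"
proof (induction k)
  case (Suc k)
  have "(\<lambda>t. \<psi> t / t ^ Suc k) = (\<lambda>t. \<psi> t / t ^ k / t)" by (simp add: mult.commute)
  then show ?case using compact_test_divide[OF Suc assms(2)] by simp
qed (use assms in simp)

lemma radial_test_GDERIV:
  assumes \<psi>: "compact_test a b \<psi>" "0 \<le> a" and d: "\<And>t. (\<psi> has_real_derivative \<psi>' t) (at t)"
  shows "GDERIV (\<lambda>x::'a::euclidean_space. \<psi> (norm x)) x :> (\<psi>' (norm x) / norm x) *\<^sub>R x"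
proof (cases "x = 0")
  case True
  obtain c e where ce: "a < c" "c < e" "e < b" "\<And>t. t \<le> c \<Longrightarrow> \<psi> t = 0" "\<And>t. e \<le> t \<Longrightarrow> \<psi> t = 0"
    using compact_testE[OF assms(1)] by blast
  have "((\<lambda>_. 0::real) has_derivative (\<lambda>h. 0)) (at x)" by simp
  then have "((\<lambda>x::'a. \<psi> (norm x)) has_derivative (\<lambda>h. 0)) (at x)"
    by (rule has_derivative_transform_within_open[of _ _ _ _ "ball 0 c"])
       (use ce \<psi> True in auto)
  then show ?thesis using True by (simp add: gderiv_def)
next
  case False
  then show ?thesis
    using GDERIV_DERIV_compose[OF GDERIV_norm[OF False] d] by (simp add: sgn_div_norm field_simps)
qed

text \<open>
  A test function of the radius is smooth in space: each derivative brings down a coordinate and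
  replaces the profile \<open>\<psi>\<close> by \<open>\<psi>' / r\<close>, which is again a test function.
\<close>

lemma times_cont_diff_radial:
  assumes "compact_test a b \<psi>" "0 \<le> a"
  shows "times_cont_diff k (\<lambda>x::'a::euclidean_space. \<psi> (norm x))"
  using assms
proof (induction k arbitrary: \<psi>)
  case 0
  then show ?case
    using continuous_on_compose2[OF compact_test_continuous[OF 0(1), of UNIV] continuous_on_norm_id]
    by simp
next
  case (Suc k)
  obtain \<psi>' where \<psi>': "compact_test a b \<psi>'" "\<And>t. (\<psi> has_real_derivative \<psi>' t) (at t)"
    using compact_test_deriv[OF Suc.prems(1)] by blast
  show ?case unfolding times_cont_diff.simps
  proof (intro exI conjI allI ballI)
    show "GDERIV (\<lambda>x::'a. \<psi> (norm x)) x :> (\<psi>' (norm x) / norm x) *\<^sub>R x" for x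
      by (rule radial_test_GDERIV[OF Suc.prems \<psi>'(2)])
    show "times_cont_diff k (\<lambda>x::'a. ((\<psi>' (norm x) / norm x) *\<^sub>R x) \<bullet> b)" for b
      using times_cont_diff_mult[OF Suc.IH[OF compact_test_divide[OF \<psi>'(1) Suc.prems(2)] Suc.prems(2)]
          times_cont_diff_inner[of k b]] by simp
  qed
qed

section \<open>From the weak to the classical equation in one variable\<close>

lemma has_integral_compact_support:
  fixes f :: "real \<Rightarrow> real"
  assumes "continuous_on {c..d} f" "\<And>t. t \<notin> {c..d} \<Longrightarrow> f t = 0"
  shows "(f has_integral integral {c..d} f) UNIV"
  by (rule has_integral_on_superset[OF integrable_integral[OF integrable_continuous_real[OF assms(1)]]])
     (use assms in auto)

lemma integral_lincomb:
  fixes f g :: "real \<Rightarrow> real"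
  assumes "f integrable_on UNIV" "g integrable_on UNIV" "\<And>t. F t = f t + s * g t"
  shows "integral UNIV F = integral UNIV f + s * integral UNIV g"
proof -
  have "((\<lambda>t. f t + s * g t) has_integral integral UNIV f + s * integral UNIV g) UNIV"
    by (intro has_integral_add has_integral_mult_right integrable_integral assms(1,2))
  moreover have "F = (\<lambda>t. f t + s * g t)" using assms(3) by blast
  ultimately show ?thesis by (simp add: integral_unique)
qed

lemma compact_test_integrable:
  assumes \<psi>: "compact_test a b \<psi>" and v: "continuous_on {a<..<b} v"
  shows "(\<lambda>t. v t * \<psi> t) integrable_on UNIV"
proof -
  obtain c d where cd: "a < c" "c < d" "d < b" "\<And>t. t \<le> c \<Longrightarrow> \<psi> t = 0" "\<And>t. d \<le> t \<Longrightarrow> \<psi> t = 0"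
    using compact_testE[OF assms(1)] by blast
  have "continuous_on {c..d} (\<lambda>t. v t * \<psi> t)"
    using cd by (intro continuous_intros compact_test_continuous[OF \<psi>] continuous_on_subset[OF v]) auto
  then have "((\<lambda>t. v t * \<psi> t) has_integral integral {c..d} (\<lambda>t. v t * \<psi> t)) UNIV"
    by (rule has_integral_compact_support) (use cd in auto)
  then show ?thesis by (rule has_integral_integrable)
qed

lemma compact_test_integrable': "compact_test a b \<psi> \<Longrightarrow> \<psi> integrable_on UNIV"
  using compact_test_integrable[of a b \<psi> "\<lambda>_. 1"] by simp

lemma test_integral_by_parts:
  assumes \<psi>: "compact_test a b \<psi>" and d: "\<And>t. (\<psi> has_real_derivative \<psi>' t) (at t)"
    and P: "\<And>t. a < t \<Longrightarrow> t < b \<Longrightarrow> (P has_real_derivative p t) (at t)"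
  shows "((\<lambda>t. P t * \<psi>' t + p t * \<psi> t) has_integral 0) UNIV"
proof -
  obtain c e where ce: "a < c" "c < e" "e < b" "\<And>t. t \<le> c \<Longrightarrow> \<psi> t = 0" "\<And>t. e \<le> t \<Longrightarrow> \<psi> t = 0"
    using compact_testE[OF assms(1)] by blast
  have "((\<lambda>t. P t * \<psi>' t + p t * \<psi> t) has_integral (P e * \<psi> e - P c * \<psi> c)) {c..e}"
  proof (rule fundamental_theorem_of_calculus)
    fix t assume "t \<in> {c..e}"
    then have "((\<lambda>t. P t * \<psi> t) has_real_derivative P t * \<psi>' t + p t * \<psi> t) (at t)"
      using ce by (auto intro!: derivative_eq_intros d P)
    then show "((\<lambda>t. P t * \<psi> t) has_vector_derivative P t * \<psi>' t + p t * \<psi> t) (at t within {c..e})"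
      by (simp add: has_real_derivative_iff_has_vector_derivative has_vector_derivative_at_within)
  qed (use ce in simp)
  then have I: "((\<lambda>t. P t * \<psi>' t + p t * \<psi> t) has_integral 0) {c..e}" using ce by simp
  have "\<psi>' t = 0" if "t < c" for t
    by (rule DERIV_local_const[OF d, of "c - t"]) (use that ce in auto)
  moreover have "\<psi>' t = 0" if "t > e" for t
    by (rule DERIV_local_const[OF d, of "t - e"]) (use that ce in auto)
  ultimately have "P t * \<psi>' t + p t * \<psi> t = 0" if "t \<notin> {c..e}" for t
    using that ce(4)[of t] ce(5)[of t] by (cases "t < c") auto
  from has_integral_on_superset[OF I this subset_UNIV] show ?thesis .
qed

text \<open>
  Vanishing total integral is what makes the antiderivative compactly supported.
\<close>

lemma test_antiderivative:
  assumes h: "compact_test a b h" and zero: "integral UNIV h = 0"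
  obtains \<theta> where "compact_test a b \<theta>" "\<And>t. (\<theta> has_real_derivative h t) (at t)"
    "\<And>t. \<theta> t = integral {a..t} h"
proof -
  obtain c d where cd: "a < c" "c < d" "d < b" "\<And>t. t \<le> c \<Longrightarrow> h t = 0" "\<And>t. d \<le> t \<Longrightarrow> h t = 0"
    using compact_testE[OF h] by blast
  define \<theta> where "\<theta> = (\<lambda>t. integral {a..t} h)"
  have cont: "continuous_on S h" for S using compact_test_continuous[OF h] .
  have left: "\<theta> t = 0" if "t \<le> c" for t
    unfolding \<theta>_def by (rule integral_unique[OF has_integral_is_0]) (use cd that in auto)
  have right: "\<theta> t = 0" if "d \<le> t" for t
  proof -
    have "(h has_integral integral {a..t} h) UNIV"
      using cd that by (intro has_integral_compact_support cont) auto
    then show ?thesis using zero by (simp add: \<theta>_def integral_unique)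
  qed
  have D: "(\<theta> has_real_derivative h t) (at t)" for t
  proof (cases "t < c")
    case True
    have "((\<lambda>_. 0) has_real_derivative 0) (at t)" by simp
    then have "(\<theta> has_real_derivative 0) (at t)"
      by (rule has_field_derivative_transform_within_open[of _ _ _ "{..<c}"])
         (use True left in auto)
    then show ?thesis using True cd by simp
  next
    case False
    then have "a < t" using cd by simp
    then have "(\<theta> has_real_derivative h t) (at t within {a..t+1})"
      unfolding \<theta>_def by (intro integral_has_real_derivative cont) auto
    then have "(\<theta> has_real_derivative h t) (at t within {a<..<t+1})"
      by (rule DERIV_subset) auto
    then show ?thesis using \<open>a < t\<close> at_within_open[of t "{a<..<t+1}"] by simp
  qed
  have "smooth \<theta>"
    unfolding smooth_def
  proof
    fix k
    have "times_cont_diff (Suc k) \<theta>"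
      unfolding times_cont_diff_Suc_real using D h by (auto simp: compact_test_def smooth_def)
    then show "times_cont_diff k \<theta>" by (rule times_cont_diff_Suc_D)
  qed
  then have "compact_test a b \<theta>" using cd left right by (intro compact_testI)
  then show thesis using D that by (auto simp: \<theta>_def)
qed

lemma unit_bump_exists:
  assumes "a < b"
  obtains h where "compact_test a b h" "\<And>t. 0 \<le> h t" "integral UNIV h = 1"
proof -
  define c where "c = a + (b - a) / 3"
  define d where "d = a + 2 * (b - a) / 3"
  have cd: "a < c" "c < d" "d < b" using assms by (auto simp: c_def d_def field_simps)
  \<comment> \<open>Positive exactly between \<open>c\<close> and \<open>d\<close>.\<close>
  define e where "e = (\<lambda>t. flat_exp 0 (1 * t + (- c)) * flat_exp 0 ((-1) * t + d))"
  have e0: "0 \<le> e t" for t by (simp add: e_def flat_exp_def)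
  have "smooth e" unfolding smooth_def e_def
    by (intro allI times_cont_diff_mult times_cont_diff_affine times_cont_diff_flat_exp)
  then have e: "compact_test a b e" using cd by (intro compact_testI[of _ _ c d]) (auto simp: e_def flat_exp_def)
  have "integral {c..d} e \<noteq> 0"
  proof
    assume "integral {c..d} e = 0"
    then have "\<forall>t\<in>{c..d}. e t = 0"
      using cd e0 by (subst (asm) integral_eq_0_iff[OF compact_test_continuous[OF e]]) auto
    then have "e ((c + d) / 2) = 0" using cd by auto
    then show False using cd by (simp add: e_def flat_exp_def)
  qed
  moreover have "0 \<le> integral {c..d} e" using e0 by (simp add: integral_nonneg compact_test_continuous[OF e] integrable_continuous_real)
  moreover have I: "(e has_integral integral {c..d} e) UNIV"
    by (rule has_integral_compact_support[OF compact_test_continuous[OF e]]) (auto simp: e_def flat_exp_def)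
  ultimately have pos: "0 < integral UNIV e" by (simp add: integral_unique)
  define h where "h = (\<lambda>t. inverse (integral UNIV e) * e t)"
  have "smooth (\<lambda>_::real. inverse (integral UNIV e))" by (simp add: smooth_def times_cont_diff_const)
  then have "compact_test a b h" unfolding h_def by (rule compact_test_mult[OF e])
  moreover have "0 \<le> h t" for t using e0 pos by (simp add: h_def)
  moreover have "integral UNIV h = 1" using pos by (simp add: h_def)
  ultimately show thesis using that by blast
qed

lemma unit_bump_average:
  assumes h: "compact_test a b h" "\<And>t. 0 \<le> h t" "integral UNIV h = 1"
    and v: "continuous_on {a<..<b} v" and m: "\<And>t. a < t \<Longrightarrow> t < b \<Longrightarrow> m \<le> v t"
  shows "m \<le> integral UNIV (\<lambda>t. v t * h t)"
proof -
  have "integral UNIV (\<lambda>t. m * h t) \<le> integral UNIV (\<lambda>t. v t * h t)"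
  proof (rule integral_le)
    show "m * h t \<le> v t * h t" for t
      using m[of t] h(2)[of t] compact_test_outside[OF h(1), of t]
      by (cases "t \<in> {a<..<b}") (auto intro: mult_right_mono)
  qed (use compact_test_integrable[OF h(1) v] compact_test_integrable'[OF h(1)] in \<open>auto intro: integrable_on_mult_right\<close>)
  then show ?thesis using h(3) by simp
qed

text \<open>
  The fundamental lemma of the calculus of variations, with bumps around a point where \<open>v\<close> has a
  sign.
\<close>

lemma bump_eq_0:
  assumes v: "continuous_on {a<..<b} v"
    and 0: "\<And>h. compact_test a b h \<Longrightarrow> integral UNIV (\<lambda>t. v t * h t) = 0"
    and t: "a < t" "t < b"
  shows "v t = 0"
proof -
  have le: "w t \<le> 0" if w: "continuous_on {a<..<b} w"
    and 0: "\<And>h. compact_test a b h \<Longrightarrow> integral UNIV (\<lambda>t. w t * h t) = 0" for w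
  proof (rule ccontr)
    assume "\<not> w t \<le> 0"
    then have pos: "0 < w t / 2" "w t / 2 < w t" by auto
    have "isCont w t" using continuous_on_eq_continuous_at[OF open_greaterThanLessThan, of a b w] w t by auto
    then have "\<forall>\<^sub>F x in at t. w t / 2 < w x"
      using pos order_tendstoD(1)[of w "w t" "at t" "w t / 2"] by (simp add: isCont_def)
    then obtain e where e: "e > 0" "\<And>x. x \<noteq> t \<Longrightarrow> dist x t < e \<Longrightarrow> w t / 2 < w x"
      unfolding eventually_at by auto
    define a' b' where "a' = max a (t - e)" and "b' = min b (t + e)"
    have ab: "a' < b'" "a \<le> a'" "b' \<le> b" using t e by (auto simp: a'_def b'_def)
    obtain h where h: "compact_test a' b' h" "\<And>t. 0 \<le> h t" "integral UNIV h = 1"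
      using unit_bump_exists[OF ab(1)] by blast
    have "w t / 2 \<le> integral UNIV (\<lambda>t. w t * h t)"
    proof (rule unit_bump_average[OF h])
      show "continuous_on {a'<..<b'} w" using ab by (intro continuous_on_subset[OF w]) auto
      show "w t / 2 \<le> w x" if "a' < x" "x < b'" for x
        using that e(2)[of x] pos by (cases "x = t") (auto simp: a'_def b'_def dist_real_def abs_less_iff intro: less_imp_le)
    qed
    then show False using 0[OF compact_test_mono[OF h(1) ab(2,3)]] pos by simp
  qed
  have "- v t \<le> 0" by (rule le[where w="\<lambda>t. - v t"]) (use v 0 in \<open>auto intro: continuous_on_minus\<close>)
  moreover have "v t \<le> 0" by (rule le[OF v 0])
  ultimately show ?thesis by simp
qed

lemma antiderivative_open_interval:
  fixes H :: "real \<Rightarrow> real"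
  assumes H: "continuous_on {a<..<b} H"
  obtains Q where "\<And>t. a < t \<Longrightarrow> t < b \<Longrightarrow> (Q has_real_derivative H t) (at t)"
proof -
  define m where "m = (a + b) / 2"
  define Q where "Q = (\<lambda>t. integral {m..t} H - integral {t..m} H)"
  have "(Q has_real_derivative H t) (at t)" if t: "a < t" "t < b" for t
  proof -
    have m: "a < m" "m < b" using t by (auto simp: m_def)
    define c where "c = (a + min t m) / 2"
    define d where "d = (b + max t m) / 2"
    have cd: "a < c" "c < t" "c < m" "t < d" "m < d" "d < b"
      using t m by (auto simp: c_def d_def min_def max_def field_simps)
    have cont: "continuous_on {c..d} H" using cd by (intro continuous_on_subset[OF H]) auto
    have int: "H integrable_on {x..y}" if "c \<le> x" "y \<le> d" for x y
      using that by (intro integrable_continuous_real continuous_on_subset[OF cont]) auto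
    have Q: "Q s = integral {c..s} H - integral {c..m} H" if "c < s" "s < d" for s
    proof (cases "m \<le> s")
      case True
      have "integral {c..m} H + integral {m..s} H = integral {c..s} H"
        by (rule Henstock_Kurzweil_Integration.integral_combine) (use True that cd int in auto)
      moreover have "integral {s..m} H = 0" using True by (cases "s = m") auto
      ultimately show ?thesis by (simp add: Q_def)
    next
      case False
      have "integral {c..s} H + integral {s..m} H = integral {c..m} H"
        by (rule Henstock_Kurzweil_Integration.integral_combine) (use False that cd int in auto)
      moreover have "integral {m..s} H = 0" using False by simp
      ultimately show ?thesis by (simp add: Q_def)
    qed
    have "((\<lambda>s. integral {c..s} H) has_real_derivative H t) (at t within {c..d})"
      using cd by (intro integral_has_real_derivative cont) auto
    then have "((\<lambda>s. integral {c..s} H) has_real_derivative H t) (at t within {c<..<d})"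
      by (rule DERIV_subset) auto
    then have "((\<lambda>s. integral {c..s} H) has_real_derivative H t) (at t)"
      using cd at_within_open[of t "{c<..<d}"] by simp
    then have "((\<lambda>s. integral {c..s} H - integral {c..m} H) has_real_derivative H t) (at t)"
      by (auto intro!: derivative_eq_intros)
    then show ?thesis
      by (rule has_field_derivative_transform_within_open[of _ _ _ "{c<..<d}"]) (use cd Q in auto)
  qed
  then show thesis by (rule that)
qed

lemma DERIV_continuous_on_open_interval:
  "(\<And>t. a < t \<Longrightarrow> t < b \<Longrightarrow> (Q has_real_derivative q t) (at t)) \<Longrightarrow> continuous_on {a<..<b} Q"
  by (intro continuous_at_imp_continuous_on) (meson DERIV_isCont greaterThanLessThan_iff)

text \<open>
  The lemma of du Bois-Reymond. Subtracting an antiderivative of \<open>q\<close> reduces to the case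
  \<open>q = 0\<close>, and a function orthogonal to all tests of integral zero is constant.
\<close>

lemma weak_first_derivative:
  assumes U: "continuous_on {a<..<b} U" and q: "continuous_on {a<..<b} q"
    and weak: "\<And>\<eta> \<eta>'. compact_test a b \<eta> \<Longrightarrow> compact_test a b \<eta>' \<Longrightarrow> (\<And>t. (\<eta> has_real_derivative \<eta>' t) (at t)) \<Longrightarrow>
      integral UNIV (\<lambda>t. U t * \<eta>' t + q t * \<eta> t) = 0"
    and t: "a < t" "t < b"
  shows "(U has_real_derivative q t) (at t)"
proof -
  obtain Q where Q: "\<And>t. a < t \<Longrightarrow> t < b \<Longrightarrow> (Q has_real_derivative q t) (at t)"
    using antiderivative_open_interval[OF q] by blast
  have contQ: "continuous_on {a<..<b} Q" by (rule DERIV_continuous_on_open_interval[OF Q])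
  have contz: "continuous_on {a<..<b} (\<lambda>t. U t - Q t)" by (intro continuous_intros U contQ)
  obtain h0 where h0: "compact_test a b h0" "integral UNIV h0 = 1"
    using unit_bump_exists[OF less_trans[OF t]] by blast
  define K where "K = integral UNIV (\<lambda>t. (U t - Q t) * h0 t)"
  have z0: "integral UNIV (\<lambda>t. (U t - Q t) * \<eta>' t) = 0" if \<eta>': "compact_test a b \<eta>'" "integral UNIV \<eta>' = 0" for \<eta>'
  proof -
    obtain \<eta> where \<eta>: "compact_test a b \<eta>" "\<And>t. (\<eta> has_real_derivative \<eta>' t) (at t)"
      by (rule test_antiderivative[OF \<eta>']) (rule that)
    have "integral UNIV (\<lambda>t. Q t * \<eta>' t + q t * \<eta> t) = 0"
      by (rule integral_unique[OF test_integral_by_parts[OF \<eta> Q]])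
    moreover note weak[OF \<eta>(1) \<eta>'(1) \<eta>(2)]
    ultimately have "integral UNIV (\<lambda>t. (U t * \<eta>' t + q t * \<eta> t) - (Q t * \<eta>' t + q t * \<eta> t)) = 0"
      using compact_test_integrable[OF \<eta>'(1) U] compact_test_integrable[OF \<eta>(1) q]
        compact_test_integrable[OF \<eta>'(1) contQ]
      by (subst integral_diff) (auto intro: integrable_add)
    then show ?thesis by (simp add: algebra_simps)
  qed
  have eq: "U s - Q s - K = 0" if s: "a < s" "s < b" for s
  proof (rule bump_eq_0[OF _ _ s])
    show "continuous_on {a<..<b} (\<lambda>t. U t - Q t - K)" by (intro continuous_intros contz)
    fix h assume h: "compact_test a b h"
    let ?s = "integral UNIV h"
    note int = compact_test_integrable'[OF h] compact_test_integrable'[OF h0(1)]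
    note intz = compact_test_integrable[OF h contz] compact_test_integrable[OF h0(1) contz]
    have "integral UNIV (\<lambda>t. (U t - Q t) * (h t + (- ?s) * h0 t)) = 0"
    proof (rule z0[OF compact_test_lincomb[OF h h0(1)]])
      show "integral UNIV (\<lambda>t. h t + (- ?s) * h0 t) = 0"
        using integral_lincomb[OF int refl, of "- ?s"] h0(2) by simp
    qed
    moreover have "integral UNIV (\<lambda>t. (U t - Q t) * (h t + (- ?s) * h0 t)) =
        integral UNIV (\<lambda>t. (U t - Q t) * h t) + (- ?s) * K"
      unfolding K_def by (rule integral_lincomb[OF intz]) (rule distrib_left[THEN trans], simp only: mult.left_commute)
    moreover have "integral UNIV (\<lambda>t. (U t - Q t - K) * h t) =
        integral UNIV (\<lambda>t. (U t - Q t) * h t) + (- K) * ?s"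
      by (rule integral_lincomb[OF intz(1) int(1)]) (simp add: left_diff_distrib)
    ultimately show "integral UNIV (\<lambda>t. (U t - Q t - K) * h t) = 0" by algebra
  qed
  have "((\<lambda>s. Q s + K) has_real_derivative q t) (at t)"
    using DERIV_add[OF Q[OF t] DERIV_const[of K]] by simp
  then show ?thesis
  proof (rule has_field_derivative_transform_within_open[of _ _ _ "{a<..<b}"])
    show "Q s + K = U s" if "s \<in> {a<..<b}" for s using eq[of s] that by force
  qed (use t in auto)
qed

text \<open>
  A continuous distributional solution of \<open>(r\<^sup>k U')' = H\<close> is a classical one. The fluxes
  \<open>\<eta> = r\<^sup>k \<psi>'\<close> of tests \<open>\<psi>\<close> are exactly the tests with \<open>\<integral> \<eta> / r\<^sup>k = 0\<close>; one further test
  function removes this constraint at the price of a constant \<open>K\<close> of integration, and the lemma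
  of du Bois-Reymond gives \<open>r\<^sup>k U' = Q - K\<close> with \<open>Q' = H\<close>.
\<close>

lemma weak_radial_equation:
  assumes a: "0 \<le> a" "a < b" and U: "continuous_on {a<..<b} U" and H: "continuous_on {a<..<b} H"
    and weak: "\<And>\<psi> \<eta> \<eta>'. compact_test a b \<psi> \<Longrightarrow> compact_test a b \<eta> \<Longrightarrow> compact_test a b \<eta>' \<Longrightarrow>
      (\<And>t. (\<psi> has_real_derivative \<eta> t / t ^ k) (at t)) \<Longrightarrow> (\<And>t. (\<eta> has_real_derivative \<eta>' t) (at t)) \<Longrightarrow>
      integral UNIV (\<lambda>t. U t * \<eta>' t - H t * \<psi> t) = 0"
  obtains p where "\<And>t. a < t \<Longrightarrow> t < b \<Longrightarrow> (U has_real_derivative p t / t ^ k) (at t)"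
    "\<And>t. a < t \<Longrightarrow> t < b \<Longrightarrow> (p has_real_derivative H t) (at t)"
proof -
  obtain Q where Q: "\<And>t. a < t \<Longrightarrow> t < b \<Longrightarrow> (Q has_real_derivative H t) (at t)"
    using antiderivative_open_interval[OF H] by blast
  have contQ: "continuous_on {a<..<b} Q" by (rule DERIV_continuous_on_open_interval[OF Q])
  have contQk: "continuous_on {a<..<b} (\<lambda>t. Q t / t ^ k)"
    using a by (intro continuous_intros contQ) auto
  have contk: "continuous_on {a<..<b} (\<lambda>t. 1 / t ^ k)"
    using a by (intro continuous_intros) auto
  define W where "W = (\<lambda>\<eta> \<eta>'. integral UNIV (\<lambda>t. U t * \<eta>' t + Q t / t ^ k * \<eta> t))"
  have W_lin: "W (\<lambda>t. \<eta> t + s * \<zeta> t) (\<lambda>t. \<eta>' t + s * \<zeta>' t) = W \<eta> \<eta>' + s * W \<zeta> \<zeta>'"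
    if "compact_test a b \<eta>" "compact_test a b \<eta>'" "compact_test a b \<zeta>" "compact_test a b \<zeta>'" for \<eta> \<eta>' \<zeta> \<zeta>' s
  proof -
    have int: "(\<lambda>t. U t * \<eta>' t + Q t / t ^ k * \<eta> t) integrable_on UNIV"
      "(\<lambda>t. U t * \<zeta>' t + Q t / t ^ k * \<zeta> t) integrable_on UNIV"
      by (intro integrable_add compact_test_integrable[OF _ U] compact_test_integrable[OF _ contQk] that)+
    show ?thesis unfolding W_def
      by (rule integral_lincomb[OF int]) (simp only: distrib_left add.assoc add.left_commute mult.left_commute)
  qed
  have W0: "W \<eta> \<eta>' = 0" if \<eta>: "compact_test a b \<eta>" "compact_test a b \<eta>'"
    "\<And>t. (\<eta> has_real_derivative \<eta>' t) (at t)" "integral UNIV (\<lambda>t. \<eta> t / t ^ k) = 0" for \<eta> \<eta>'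
  proof -
    note \<eta>k = compact_test_divide_power[OF \<eta>(1) a(1), of k]
    obtain \<psi> where \<psi>: "compact_test a b \<psi>" "\<And>t. (\<psi> has_real_derivative \<eta> t / t ^ k) (at t)"
      by (rule test_antiderivative[OF \<eta>k \<eta>(4)]) (rule that)
    have "integral UNIV (\<lambda>t. Q t * (\<eta> t / t ^ k) + H t * \<psi> t) = 0"
      by (rule integral_unique[OF test_integral_by_parts[OF \<psi> Q]])
    moreover note weak[OF \<psi>(1) \<eta>(1,2) \<psi>(2) \<eta>(3)]
    ultimately have "integral UNIV (\<lambda>t. (U t * \<eta>' t - H t * \<psi> t) + (Q t * (\<eta> t / t ^ k) + H t * \<psi> t)) = 0"
      using compact_test_integrable[OF \<eta>(2) U] compact_test_integrable[OF \<psi>(1) H]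
        compact_test_integrable[OF \<eta>k contQ]
      by (subst integral_add) (auto intro!: integrable_add integrable_diff)
    then show ?thesis by (simp add: W_def)
  qed
  obtain h where h: "compact_test a b h" "integral UNIV h = 1"
    using unit_bump_exists[OF a(2)] by blast
  define \<zeta> where "\<zeta> = (\<lambda>t. t ^ k * h t)"
  have \<zeta>: "compact_test a b \<zeta>" unfolding \<zeta>_def by (rule compact_test_mult[OF h(1) smooth_power])
  obtain \<zeta>' where \<zeta>': "compact_test a b \<zeta>'" "\<And>t. (\<zeta> has_real_derivative \<zeta>' t) (at t)"
    using compact_test_deriv[OF \<zeta>] by blast
  have \<zeta>k: "\<zeta> t / t ^ k = h t" for t
    using compact_test_outside[OF h(1), of t] a by (cases "t = 0") (auto simp: \<zeta>_def)
  \<comment> \<open>\<open>\<zeta>\<close> has \<open>\<integral> \<zeta> / r\<^sup>k = 1\<close>, so subtracting a multiple of it makes every test admissible for \<open>W0\<close>.\<close>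
  define K where "K = W \<zeta> \<zeta>'"
  have WK: "W \<eta> \<eta>' = K * integral UNIV (\<lambda>t. \<eta> t / t ^ k)"
    if \<eta>: "compact_test a b \<eta>" "compact_test a b \<eta>'" "\<And>t. (\<eta> has_real_derivative \<eta>' t) (at t)" for \<eta> \<eta>'
  proof -
    let ?s = "integral UNIV (\<lambda>t. \<eta> t / t ^ k)"
    note \<eta>k = compact_test_divide_power[OF \<eta>(1) a(1), of k]
    have "W (\<lambda>t. \<eta> t + (- ?s) * \<zeta> t) (\<lambda>t. \<eta>' t + (- ?s) * \<zeta>' t) = 0"
    proof (rule W0)
      show "((\<lambda>t. \<eta> t + (- ?s) * \<zeta> t) has_real_derivative \<eta>' t + (- ?s) * \<zeta>' t) (at t)" for t
        by (auto intro!: derivative_eq_intros \<eta>(3) \<zeta>'(2))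
      have "integral UNIV (\<lambda>t. \<eta> t / t ^ k + (- ?s) * h t) = 0"
        using integral_lincomb[OF compact_test_integrable'[OF \<eta>k] compact_test_integrable'[OF h(1)] refl, of "- ?s"] h(2)
        by simp
      moreover have "(\<eta> t + (- ?s) * \<zeta> t) / t ^ k = \<eta> t / t ^ k + (- ?s) * h t" for t
        unfolding \<zeta>k[symmetric] add_divide_distrib times_divide_eq_right ..
      ultimately show "integral UNIV (\<lambda>t. (\<eta> t + (- ?s) * \<zeta> t) / t ^ k) = 0" by simp
    qed (intro compact_test_lincomb \<eta> \<zeta> \<zeta>')+
    then show ?thesis using W_lin[OF \<eta>(1,2) \<zeta> \<zeta>'(1), of "- ?s"] by (simp add: K_def)
  qed
  have "(U has_real_derivative (Q t - K) / t ^ k) (at t)" if "a < t" "t < b" for t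
  proof (rule weak_first_derivative[OF U _ _ that])
    show "continuous_on {a<..<b} (\<lambda>t. (Q t - K) / t ^ k)"
      using a by (intro continuous_intros contQ) auto
    fix \<eta> \<eta>' assume \<eta>: "compact_test a b \<eta>" "compact_test a b \<eta>'" "\<And>t. (\<eta> has_real_derivative \<eta>' t) (at t)"
    note \<eta>k = compact_test_divide_power[OF \<eta>(1) a(1), of k]
    have "(\<lambda>t. U t * \<eta>' t + Q t / t ^ k * \<eta> t) integrable_on UNIV"
      by (intro integrable_add compact_test_integrable[OF _ U] compact_test_integrable[OF _ contQk] \<eta>)
    from integral_lincomb[OF this compact_test_integrable'[OF \<eta>k], of _ "- K"]
    have "integral UNIV (\<lambda>t. U t * \<eta>' t + (Q t - K) / t ^ k * \<eta> t) =
      W \<eta> \<eta>' + (- K) * integral UNIV (\<lambda>t. \<eta> t / t ^ k)"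
      unfolding W_def by (simp add: left_diff_distrib diff_divide_distrib)
    then show "integral UNIV (\<lambda>t. U t * \<eta>' t + (Q t - K) / t ^ k * \<eta> t) = 0"
      using WK[OF \<eta>] by simp
  qed
  moreover have "((\<lambda>t. Q t - K) has_real_derivative H t) (at t)" if "a < t" "t < b" for t
    using DERIV_diff[OF Q[OF that] DERIV_const[of K]] by simp
  ultimately show thesis by (rule that)
qed

section \<open>Integration in the radial variable and in a direction\<close>

lemma indicator_scale_eq:
  fixes h :: "'a \<Rightarrow> real"
  assumes "\<And>x. x \<notin> S \<Longrightarrow> h x = 0"
  shows "(\<lambda>x. indicator S x *\<^sub>R h x) = h"
proof
  show "indicator S x *\<^sub>R h x = h x" for x by (cases "x \<in> S") (use assms in auto)
qed

definition sphere_area :: "'a::euclidean_space itself \<Rightarrow> real" where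
  "sphere_area _ = real DIM('a) * unit_ball_vol (real DIM('a))"

lemma sphere_area_pos: "0 < sphere_area TYPE('a::euclidean_space)"
  by (simp add: sphere_area_def)

text \<open>
  Integration in polar coordinates for radial functions: both measures agree on the half-lines
  below \<open>a\<close>, where the left one is the volume of a ball.
\<close>

lemma distr_norm_lborel:
  "distr lborel borel (norm :: 'a::euclidean_space \<Rightarrow> real) =
   density lborel (\<lambda>r. ennreal (indicator {0<..} r * (sphere_area TYPE('a) * r ^ (DIM('a) - 1))))"
  (is "?M = density lborel ?d")
proof (rule measure_eqI_generator_eq)
  have borel: "sets (borel :: real measure) = sigma_sets UNIV (range lessThan)"
    by (subst borel_Iio) simp
  show "Int_stable (range (lessThan :: real \<Rightarrow> real set))"
    by (force simp: Int_stable_def intro: image_eqI[of _ _ "min a b" for a b])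
  show "sets ?M = sigma_sets UNIV (range lessThan)" "sets (density lborel ?d) = sigma_sets UNIV (range lessThan)"
    using borel by simp_all
  show "range (\<lambda>i. {..<real i}) \<subseteq> range lessThan" by auto
  show "(\<Union>i. {..<real i}) = UNIV" using reals_Archimedean2 by auto
  have M: "emeasure ?M {..<a} = (if a \<le> 0 then 0 else ennreal (unit_ball_vol (real DIM('a)) * a ^ DIM('a)))" for a
  proof -
    have "emeasure ?M {..<a} = emeasure lborel (norm -` {..<a} :: 'a set)"
      by (subst emeasure_distr) auto
    also have "(norm -` {..<a} :: 'a set) = ball 0 a" by auto
    finally show ?thesis using emeasure_ball[of a "0::'a"] ball_empty[of a "0::'a"]
      by (cases "a \<le> 0") (simp_all del: ball_eq_empty)
  qed
  show "emeasure ?M {..<real i} \<noteq> \<infinity>" for i by (simp add: M)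
  fix X :: "real set" assume "X \<in> range lessThan"
  then obtain a where X: "X = {..<a}" by auto
  have d: "emeasure (density lborel ?d) {..<a} = (\<integral>\<^sup>+ r. ?d r * indicator {..<a} r \<partial>lborel)"
    by (subst emeasure_density) auto
  show "emeasure ?M X = emeasure (density lborel ?d) X"
  proof (cases "a \<le> 0")
    case True
    have "(\<integral>\<^sup>+ r. ?d r * indicator {..<a} r \<partial>lborel) = (\<integral>\<^sup>+ r. 0 \<partial>(lborel :: real measure))"
      using True by (intro nn_integral_cong) (auto simp: indicator_def)
    then show ?thesis unfolding X M d using True by simp
  next
    case False
    let ?k = "DIM('a) - 1"
    have "AE r in lborel. r \<noteq> 0 \<and> r \<noteq> a" using AE_lborel_singleton[of 0] AE_lborel_singleton[of a] by eventually_elim auto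
    then have "(\<integral>\<^sup>+ r. ?d r * indicator {..<a} r \<partial>lborel) =
      (\<integral>\<^sup>+ r. ennreal (sphere_area TYPE('a) * r ^ ?k) * indicator {0..a} r \<partial>lborel)"
    proof (intro nn_integral_cong_AE, eventually_elim)
      case (elim r)
      then show ?case by (cases "0 < r \<and> r < a") auto
    qed
    also have "\<dots> = unit_ball_vol (real DIM('a)) * a ^ DIM('a) - unit_ball_vol (real DIM('a)) * 0 ^ DIM('a)"
    proof (rule nn_integral_FTC_Icc)
      fix x :: real
      show "((\<lambda>r. unit_ball_vol (real DIM('a)) * r ^ DIM('a)) has_real_derivative sphere_area TYPE('a) * x ^ ?k) (at x)"
        by (auto intro!: derivative_eq_intros simp: sphere_area_def)
    qed (use False sphere_area_pos[where 'a='a] in auto)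
    finally show ?thesis unfolding X M d using False by simp
  qed
qed auto

lemma radial_integral:
  fixes h :: "real \<Rightarrow> real"
  assumes c: "0 < c" and h: "continuous_on {c..d} h" and out: "\<And>t. t \<notin> {c..d} \<Longrightarrow> h t = 0"
  shows "integrable lborel (\<lambda>x::'a::euclidean_space. h (norm x))"
    and "(LINT x|lborel. h (norm (x::'a))) =
         sphere_area TYPE('a) * integral UNIV (\<lambda>r. r ^ (DIM('a) - 1) * h r)"
proof -
  let ?k = "DIM('a) - 1" and ?c = "sphere_area TYPE('a)"
  let ?d = "\<lambda>r. indicator {0<..} r * (?c * r ^ ?k)"
  note ind = indicator_scale_eq[of "{c..d}" h, OF out]
  have meas[measurable]: "h \<in> borel_measurable borel"
    using borel_measurable_continuous_on_indicator[OF _ h] ind by simp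
  have eq: "?d r * h r = ?c * (r ^ ?k * h r)" for r
    using out[of r] c by (auto simp: indicator_def)
  have "integrable lborel (\<lambda>r. indicator {c..d} r *\<^sub>R (?c * (r ^ ?k * h r)))"
    by (intro borel_integrable_compact continuous_intros h) auto
  moreover have "(\<lambda>r. indicator {c..d} r *\<^sub>R (?c * (r ^ ?k * h r))) = (\<lambda>r. ?c * (r ^ ?k * h r))"
    by (rule indicator_scale_eq) (use out in auto)
  ultimately have int: "integrable lborel (\<lambda>r. ?c * (r ^ ?k * h r))" by simp
  have pos: "AE r in lborel. 0 \<le> ?d r"
    using sphere_area_pos[where 'a='a] by (intro AE_I2) (auto simp: indicator_def)
  have "integrable (density lborel ?d) h"
  proof (rule iffD2[OF integrable_density[OF _ _ pos]])
    show "integrable lborel (\<lambda>r. ?d r *\<^sub>R h r)" unfolding real_scaleR_def eq by (rule int)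
  qed auto
  then show "integrable lborel (\<lambda>x::'a. h (norm x))"
    by (subst integrable_distr_eq[symmetric, where N=borel]) (auto simp: distr_norm_lborel)
  have "(LINT x|lborel. h (norm (x::'a))) = (LINT r|distr lborel borel (norm :: 'a \<Rightarrow> real). h r)"
    by (subst integral_distr) auto
  also have "\<dots> = (LINT r|lborel. ?d r *\<^sub>R h r)"
    unfolding distr_norm_lborel by (rule integral_density[OF _ _ pos]) auto
  also have "\<dots> = (LINT r|lborel. ?c * (r ^ ?k * h r))" unfolding real_scaleR_def eq ..
  also have "\<dots> = integral UNIV (\<lambda>r. ?c * (r ^ ?k * h r))"
    by (rule integral_lborel[OF int, symmetric])
  finally show "(LINT x|lborel. h (norm (x::'a))) = ?c * integral UNIV (\<lambda>r. r ^ ?k * h r)"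
    by simp
qed

text \<open>
  Translation invariance makes the integrals of the difference quotients vanish, and dominated
  convergence carries this over to the derivative.
\<close>

lemma integral_directional_derivative_eq_0:
  fixes f :: "'a::euclidean_space \<Rightarrow> real"
  assumes D: "\<And>x. GDERIV f x :> g x" and g: "continuous_on UNIV (\<lambda>x. g x \<bullet> b)"
    and out: "\<And>x. R < norm x \<Longrightarrow> f x = 0"
  shows "integrable lborel (\<lambda>x. g x \<bullet> b)" and "(LINT x|lborel. g x \<bullet> b) = 0"
proof -
  have contf: "continuous_on UNIV f"
    using times_cont_diff_0_if_GDERIV[of f g] D by simp
  have int: "integrable lborel h" if "continuous_on UNIV h" "\<And>x. R < norm x \<Longrightarrow> h x = 0" for h :: "'a \<Rightarrow> real"
  proof -
    have "integrable lborel (\<lambda>x. indicator (cball 0 R) x *\<^sub>R h x)"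
      using that by (intro borel_integrable_compact) (auto intro: continuous_on_subset)
    moreover have "(\<lambda>x. indicator (cball 0 R) x *\<^sub>R h x) = h"
      by (rule indicator_scale_eq) (use that(2) in auto)
    ultimately show ?thesis by simp
  qed
  have g0: "g x = 0" if "R < norm x" for x
  proof -
    have "((\<lambda>_. 0::real) has_derivative (\<lambda>h. 0)) (at x)" by simp
    then have "(f has_derivative (\<lambda>h. 0)) (at x)"
    proof (rule has_derivative_transform_within_open[of _ _ _ _ "- cball 0 R"])
      show "x \<in> - cball 0 R" using that by auto
      show "0 = f y" if "y \<in> - cball 0 R" for y using that out[of y] by auto
    qed auto
    then have "GDERIV f x :> 0" by (simp add: gderiv_def)
    then show ?thesis using D GDERIV_unique by blast
  qed
  show ig: "integrable lborel (\<lambda>x. g x \<bullet> b)" by (rule int[OF g]) (simp add: g0)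
  have "bounded ((\<lambda>x. g x \<bullet> b) ` cball 0 R)"
    by (intro compact_imp_bounded compact_continuous_image continuous_on_subset[OF g]) auto
  then obtain M where "\<forall>x\<in>cball 0 R. \<bar>g x \<bullet> b\<bar> \<le> M" unfolding bounded_iff by auto
  then have M: "\<bar>g x \<bullet> b\<bar> \<le> max M 0" for x
    using g0[of x] by (cases "norm x \<le> R") (auto simp: le_max_iff_disj)
  have line: "((\<lambda>s. f (x + s *\<^sub>R b)) has_real_derivative g (x + s *\<^sub>R b) \<bullet> b) (at s)" for x s
  proof -
    have "((\<lambda>s. x + s *\<^sub>R b) has_derivative (\<lambda>h. h *\<^sub>R b)) (at s)"
      by (auto intro!: derivative_eq_intros)
    from has_derivative_compose[OF this D[unfolded gderiv_def, of "x + s *\<^sub>R b"]]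
    show ?thesis by (simp add: has_field_derivative_def inner_commute mult.commute mult_commute_abs)
  qed
  define t where "t = (\<lambda>i. inverse (real (Suc i)))"
  have t: "0 < t i" "t i \<le> 1" for i by (auto simp: t_def field_simps)
  define s where "s = (\<lambda>i x. (f (x + t i *\<^sub>R b) - f x) / t i)"
  have shift: "integrable lborel (\<lambda>x. f (x + v))" "(LINT x|lborel. f (x + v)) = (LINT x|lborel. f x)" for v
  proof -
    have [measurable]: "f \<in> borel_measurable borel" using contf by (rule borel_measurable_continuous_onI)
    have f: "integrable lborel f" using int[OF contf] out by blast
    have "integrable (distr lborel borel ((+) v)) f" using f by (simp add: lborel_distr_plus)
    then show "integrable lborel (\<lambda>x. f (x + v))"
      by (subst (asm) integrable_distr_eq) (auto simp: add.commute)
    have "(LINT x|lborel. f x) = (LINT x|distr lborel borel ((+) v). f x)" by (simp add: lborel_distr_plus)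
    also have "\<dots> = (LINT x|lborel. f (x + v))" by (subst integral_distr) (auto simp: add.commute)
    finally show "(LINT x|lborel. f (x + v)) = (LINT x|lborel. f x)" by simp
  qed
  have s0: "integrable lborel (s i)" "integral\<^sup>L lborel (s i) = 0" for i
    using shift[of "t i *\<^sub>R b"] int[OF contf out] by (auto simp: s_def)
  have "(\<lambda>i. integral\<^sup>L lborel (s i)) \<longlonglongrightarrow> (LINT x|lborel. g x \<bullet> b)"
  proof (rule integral_dominated_convergence[where w="\<lambda>x. max M 0 * indicator (cball 0 (R + norm b)) x"])
    show "AE x in lborel. (\<lambda>i. s i x) \<longlonglongrightarrow> g x \<bullet> b"
    proof (rule AE_I2)
      fix x
      have "((\<lambda>h. (f (x + (0 + h) *\<^sub>R b) - f (x + 0 *\<^sub>R b)) / h) \<longlongrightarrow> g (x + 0 *\<^sub>R b) \<bullet> b) (at 0)"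
        using line[of x 0] unfolding DERIV_def .
      moreover have "filterlim t (at 0) sequentially"
        unfolding filterlim_at t_def using LIMSEQ_inverse_real_of_nat by (auto simp: eventually_sequentially)
      ultimately have "((\<lambda>i. (f (x + (0 + t i) *\<^sub>R b) - f (x + 0 *\<^sub>R b)) / t i) \<longlongrightarrow> g (x + 0 *\<^sub>R b) \<bullet> b) sequentially"
        by (rule filterlim_compose)
      then show "(\<lambda>i. s i x) \<longlonglongrightarrow> g x \<bullet> b" by (simp add: s_def)
    qed
    show "AE x in lborel. norm (s i x) \<le> max M 0 * indicator (cball 0 (R + norm b)) x" for i
    proof (rule AE_I2)
      fix x
      show "norm (s i x) \<le> max M 0 * indicator (cball 0 (R + norm b)) x"
      proof (cases "norm x \<le> R + norm b")
        case True
        obtain z where "0 < z" "z < t i" "f (x + t i *\<^sub>R b) - f (x + 0 *\<^sub>R b) = (t i - 0) * (g (x + z *\<^sub>R b) \<bullet> b)"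
          using MVT2[OF t(1)[of i], of "\<lambda>s. f (x + s *\<^sub>R b)" "\<lambda>s. g (x + s *\<^sub>R b) \<bullet> b"] line by blast
        then have "s i x = g (x + z *\<^sub>R b) \<bullet> b" using t(1)[of i] by (simp add: s_def)
        then show ?thesis using M[of "x + z *\<^sub>R b"] True by simp
      next
        case False
        have "norm x \<le> norm (x + t i *\<^sub>R b) + norm (t i *\<^sub>R b)"
          using norm_triangle_ineq4[of "x + t i *\<^sub>R b" "t i *\<^sub>R b"] by simp
        moreover have "norm (t i *\<^sub>R b) \<le> norm b" using t[of i] by (simp add: mult_left_le_one_le)
        ultimately have "R < norm (x + t i *\<^sub>R b)" "R < norm x" using False norm_ge_zero[of b] by linarith+
        then show ?thesis using out False by (simp add: s_def)
      qed
    qed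
    show "integrable lborel (\<lambda>x::'a. max M 0 * indicator (cball 0 (R + norm b)) x)"
      using emeasure_bounded_finite[OF bounded_cball, of "0::'a" "R + norm b"]
      by (intro integrable_mult_right integrable_real_indicator) (auto simp: infinity_ennreal_def)
  qed (use ig s0 in auto)
  then show "(LINT x|lborel. g x \<bullet> b) = 0" by (simp add: s0(2) LIMSEQ_const_iff)
qed

section \<open>The divergence identity for radial fields\<close>

lemma test_functionE:
  assumes "\<phi> \<in> test_functions \<Omega>"
  obtains R where "smooth \<phi>" "\<And>x. GDERIV \<phi> x :> grad \<phi> x" "continuous_on UNIV (grad \<phi>)"
    "\<And>x. x \<notin> \<Omega> \<Longrightarrow> \<phi> x = 0" "\<And>x. x \<notin> \<Omega> \<Longrightarrow> grad \<phi> x = 0"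
    "\<And>x. R < norm x \<Longrightarrow> \<phi> x = 0" "\<And>x. R < norm x \<Longrightarrow> grad \<phi> x = 0"
proof -
  let ?S = "closure {x. \<phi> x \<noteq> 0}"
  have sm: "smooth \<phi>" and comp: "compact ?S" and sub: "?S \<subseteq> \<Omega>"
    using assms by (auto simp: test_functions_def smooth_def)
  have "times_cont_diff (Suc 0) \<phi>" using sm by (simp only: smooth_def)
  then obtain g where "\<forall>x. GDERIV \<phi> x :> g x" "\<forall>b\<in>Basis. continuous_on UNIV (\<lambda>x. g x \<bullet> b)"
    unfolding times_cont_diff.simps by blast
  then have g: "\<And>x. GDERIV \<phi> x :> g x" "\<And>b. b \<in> Basis \<Longrightarrow> continuous_on UNIV (\<lambda>x. g x \<bullet> b)"
    by blast+
  have eq: "grad \<phi> = g" by (rule ext) (rule grad_eq[OF g(1)])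
  obtain R where R: "\<forall>x\<in>?S. norm x \<le> R"
    using compact_imp_bounded[OF comp] unfolding bounded_iff by blast
  have off: "\<phi> x = 0" "grad \<phi> x = 0" if "x \<notin> ?S" for x
  proof -
    have zero: "\<phi> y = 0" if "y \<notin> ?S" for y
      using that closure_subset[of "{x. \<phi> x \<noteq> 0}"] by auto
    show "\<phi> x = 0" by (rule zero[OF that])
    have "((\<lambda>_. 0::real) has_derivative (\<lambda>h. 0)) (at x)" by simp
    then have "(\<phi> has_derivative (\<lambda>h. 0)) (at x)"
    proof (rule has_derivative_transform_within_open[of _ _ _ _ "- ?S"])
      show "0 = \<phi> y" if "y \<in> - ?S" for y using zero[of y] that by simp
      show "x \<in> - ?S" using that by simp
    qed (simp add: open_Compl)
    then have "GDERIV \<phi> x :> 0" by (simp add: gderiv_def)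
    then show "grad \<phi> x = 0" by (rule grad_eq)
  qed
  have cont: "continuous_on UNIV (grad \<phi>)" unfolding eq by (subst continuous_on_componentwise) (use g in auto)
  have far: "x \<notin> ?S" if "R < norm x" for x using R that by auto
  have outside: "x \<notin> ?S" if "x \<notin> \<Omega>" for x using sub that by auto
  have GD: "GDERIV \<phi> x :> grad \<phi> x" for x unfolding eq by (rule g(1))
  show thesis
    by (rule that[OF sm GD cont off(1)[OF outside] off(2)[OF outside] off(1)[OF far] off(2)[OF far]])
qed

lemma lebesgue_on_integral_lborel:
  fixes f :: "'a::euclidean_space \<Rightarrow> real"
  assumes "\<Omega> \<in> sets lebesgue" and "f \<in> borel_measurable borel" and out: "\<And>x. x \<notin> \<Omega> \<Longrightarrow> f x = 0"
  shows "(LINT x|lebesgue_on \<Omega>. f x) = (LINT x|lborel. f x)"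
    and "integrable (lebesgue_on \<Omega>) f \<longleftrightarrow> integrable lborel f"
proof -
  have ind: "(\<lambda>x. indicator \<Omega> x *\<^sub>R f x) = f" by (rule indicator_scale_eq) (rule out)
  have sets: "\<Omega> \<inter> space lebesgue \<in> sets lebesgue" using assms(1) by simp
  show "(LINT x|lebesgue_on \<Omega>. f x) = (LINT x|lborel. f x)"
    unfolding integral_restrict_space[OF sets] ind by (rule integral_completion) (simp add: assms(2))
  show "integrable (lebesgue_on \<Omega>) f \<longleftrightarrow> integrable lborel f"
    unfolding integrable_restrict_space[OF sets] ind by (rule integrable_completion) (simp add: assms(2))
qed

text \<open>
  The divergence theorem for \<open>\<phi>\<close> times the radial field \<open>X = \<theta>(r) / r\<^sup>n x\<close>, whose divergence is
  \<open>\<theta>'(r) / r\<^sup>n\<^sup>-\<^sup>1\<close>. The profile \<open>\<theta>\<close> avoids the centre and may be nonzero at the boundary of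
  \<open>\<Omega>\<close>, where \<open>\<phi>\<close> vanishes: such profiles are what detects the boundary condition.
\<close>

lemma radial_divergence_test:
  fixes \<phi> :: "'a::euclidean_space \<Rightarrow> real"
  assumes \<phi>: "\<phi> \<in> test_functions \<Omega>" and \<Omega>: "\<Omega> \<in> sets lebesgue"
    and \<theta>: "compact_test 0 m \<theta>" "compact_test 0 m \<theta>'" "\<And>t. (\<theta> has_real_derivative \<theta>' t) (at t)"
  shows "(LINT x|lebesgue_on \<Omega>. \<phi> x * (\<theta>' (norm x) / norm x ^ (DIM('a) - 1)) +
            grad \<phi> x \<bullet> ((\<theta> (norm x) / norm x ^ DIM('a)) *\<^sub>R x)) = 0"
proof -
  let ?n = "DIM('a)"
  obtain R where R: "smooth \<phi>" "\<And>x. GDERIV \<phi> x :> grad \<phi> x" "continuous_on UNIV (grad \<phi>)"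
    "\<And>x. x \<notin> \<Omega> \<Longrightarrow> \<phi> x = 0" "\<And>x. x \<notin> \<Omega> \<Longrightarrow> grad \<phi> x = 0"
    "\<And>x. R < norm x \<Longrightarrow> \<phi> x = 0" "\<And>x. R < norm x \<Longrightarrow> grad \<phi> x = 0"
    by (rule test_functionE[OF \<phi>]) (rule that)
  define \<zeta> where "\<zeta> = (\<lambda>t. \<theta> t / t ^ ?n)"
  have \<zeta>: "compact_test 0 m \<zeta>" unfolding \<zeta>_def by (rule compact_test_divide_power[OF \<theta>(1)]) simp
  obtain \<zeta>' where \<zeta>': "compact_test 0 m \<zeta>'" "\<And>t. (\<zeta> has_real_derivative \<zeta>' t) (at t)"
    using compact_test_deriv[OF \<zeta>] by blast
  have div: "\<zeta>' t * t + real ?n * \<zeta> t = \<theta>' t / t ^ (?n - 1)" if "0 < t" for t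
  proof -
    have "(\<zeta> has_real_derivative (\<theta>' t * t ^ ?n - \<theta> t * (real ?n * t ^ (?n - 1))) / (t ^ ?n * t ^ ?n)) (at t)"
      unfolding \<zeta>_def using that by (auto intro!: derivative_eq_intros \<theta>(3))
    then have "\<zeta>' t = (\<theta>' t * t ^ ?n - \<theta> t * (real ?n * t ^ (?n - 1))) / (t ^ ?n * t ^ ?n)"
      using \<zeta>'(2) DERIV_unique by blast
    moreover obtain j where "?n = Suc j" using DIM_positive[where 'a='a] gr0_implies_Suc by blast
    ultimately show ?thesis using that by (simp add: \<zeta>_def field_simps)
  qed
  define X where "X = (\<lambda>b x::'a. \<zeta> (norm x) * (x \<bullet> b))"
  define dX where "dX = (\<lambda>b x::'a. \<zeta> (norm x) *\<^sub>R b + (x \<bullet> b) *\<^sub>R ((\<zeta>' (norm x) / norm x) *\<^sub>R x))"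
  have X: "GDERIV (X b) x :> dX b x" for b x
  proof -
    have "GDERIV (\<lambda>x. x \<bullet> b) x :> b" unfolding gderiv_def by (auto intro!: derivative_eq_intros)
    then show ?thesis unfolding X_def dX_def
      by (intro GDERIV_mult radial_test_GDERIV[OF \<zeta> order_refl \<zeta>'(2)])
  qed
  define g where "g = (\<lambda>b x. \<phi> x *\<^sub>R dX b x + X b x *\<^sub>R grad \<phi> x)"
  have g: "GDERIV (\<lambda>x. \<phi> x * X b x) x :> g b x" for b x
    unfolding g_def by (intro GDERIV_mult X R)
  have cont: "continuous_on UNIV (\<lambda>x. g b x \<bullet> b)" if b: "b \<in> Basis" for b
  proof -
    have "times_cont_diff (Suc 0) (\<lambda>x. \<phi> x * X b x)" unfolding X_def
      using R(1) by (intro times_cont_diff_mult times_cont_diff_radial[OF \<zeta>] times_cont_diff_inner)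
        (auto simp: smooth_def)
    then obtain g' where "\<And>x. GDERIV (\<lambda>x. \<phi> x * X b x) x :> g' x" "continuous_on UNIV (\<lambda>x. g' x \<bullet> b)"
      using b by auto
    moreover from this g have "g' x = g b x" for x using GDERIV_unique by blast
    ultimately show ?thesis by simp
  qed
  note zero = integral_directional_derivative_eq_0[OF g cont, of _ R]
  have "(LINT x|lborel. (\<Sum>b\<in>Basis. g b x \<bullet> b)) = 0"
    using R(6) zero by (subst Bochner_Integration.integral_sum) auto
  moreover have sum_eq: "(\<Sum>b\<in>Basis. g b x \<bullet> b) = \<phi> x * (\<theta>' (norm x) / norm x ^ (?n - 1)) +
            grad \<phi> x \<bullet> ((\<theta> (norm x) / norm x ^ ?n) *\<^sub>R x)" for x
  proof -
    have sq: "(\<Sum>b\<in>Basis. (x \<bullet> b) * (x \<bullet> b)) = norm x * norm x"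
      by (metis euclidean_inner power2_eq_square power2_norm_eq_inner)
    have "(\<Sum>b\<in>Basis. dX b x \<bullet> b) = (\<Sum>b\<in>Basis. \<zeta> (norm x) + (\<zeta>' (norm x) / norm x) * ((x \<bullet> b) * (x \<bullet> b)))"
      unfolding dX_def by (rule sum.cong) (auto simp: inner_add_left)
    also have "\<dots> = real ?n * \<zeta> (norm x) + (\<zeta>' (norm x) / norm x) * (norm x * norm x)"
      by (simp only: sum.distrib sum_distrib_left[symmetric] sq) simp
    also have "\<dots> = \<theta>' (norm x) / norm x ^ (?n - 1)"
    proof (cases "x = 0")
      case True
      then show ?thesis using compact_test_outside[OF \<zeta>, of 0] compact_test_outside[OF \<theta>(2), of 0] by simp
    next
      case False
      then show ?thesis using div[of "norm x"] by (simp add: algebra_simps)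
    qed
    finally have dX: "(\<Sum>b\<in>Basis. dX b x \<bullet> b) = \<theta>' (norm x) / norm x ^ (?n - 1)" .
    have "(\<Sum>b\<in>Basis. g b x \<bullet> b) = \<phi> x * (\<Sum>b\<in>Basis. dX b x \<bullet> b) + \<zeta> (norm x) * (\<Sum>b\<in>Basis. (x \<bullet> b) * (grad \<phi> x \<bullet> b))"
      by (simp add: g_def X_def inner_add_left sum.distrib sum_distrib_left mult.assoc)
    also have "(\<Sum>b\<in>Basis. (x \<bullet> b) * (grad \<phi> x \<bullet> b)) = grad \<phi> x \<bullet> x"
      by (rule trans[OF euclidean_inner[symmetric] inner_commute])
    finally show ?thesis unfolding dX \<zeta>_def by simp
  qed
  ultimately have zero': "(LINT x|lborel. \<phi> x * (\<theta>' (norm x) / norm x ^ (?n - 1)) +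
            grad \<phi> x \<bullet> ((\<theta> (norm x) / norm x ^ ?n) *\<^sub>R x)) = 0" by (simp only: sum_eq)
  have meas: "(\<lambda>x. \<phi> x * (\<theta>' (norm x) / norm x ^ (?n - 1)) +
            grad \<phi> x \<bullet> ((\<theta> (norm x) / norm x ^ ?n) *\<^sub>R x)) \<in> borel_measurable borel"
    unfolding sum_eq[symmetric] by (intro borel_measurable_sum borel_measurable_continuous_onI cont)
  have out: "\<phi> x * (\<theta>' (norm x) / norm x ^ (?n - 1)) +
            grad \<phi> x \<bullet> ((\<theta> (norm x) / norm x ^ ?n) *\<^sub>R x) = 0" if "x \<notin> \<Omega>" for x
    using R(4,5)[OF that] by simp
  show ?thesis by (rule trans[OF lebesgue_on_integral_lborel(1)[OF \<Omega> meas out] zero'])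
qed

lemma square_integrable_pairing:
  fixes f C :: "'a::euclidean_space \<Rightarrow> 'b::euclidean_space"
  assumes fin: "finite_measure (lebesgue_on \<Omega>)" and f: "square_integrable_on \<Omega> f"
    and C: "C \<in> borel_measurable (lebesgue_on \<Omega>)" "\<And>x. norm (C x) \<le> K"
  shows "integrable (lebesgue_on \<Omega>) (\<lambda>x. f x \<bullet> C x)"
proof (rule Bochner_Integration.integrable_bound)
  show "integrable (lebesgue_on \<Omega>) (\<lambda>x. K * (1 + (norm (f x))\<^sup>2))"
    using f unfolding square_integrable_on_def
    by (intro integrable_mult_right Bochner_Integration.integrable_add finite_measure.integrable_const[OF fin]) blast
  show "(\<lambda>x. f x \<bullet> C x) \<in> borel_measurable (lebesgue_on \<Omega>)"
    using f C by (auto simp: square_integrable_on_def)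
  show "AE x in lebesgue_on \<Omega>. norm (f x \<bullet> C x) \<le> norm (K * (1 + (norm (f x))\<^sup>2))"
  proof (rule AE_I2)
    fix x
    have K: "0 \<le> K" using C(2)[of x] norm_ge_zero order_trans by blast
    have "norm (f x \<bullet> C x) \<le> norm (f x) * norm (C x)" by (simp add: Cauchy_Schwarz_ineq2)
    also have "\<dots> \<le> (1 + (norm (f x))\<^sup>2) * K"
    proof (rule mult_mono)
      have "0 \<le> (norm (f x) - 1)\<^sup>2" "0 \<le> norm (f x)" by auto
      then have "norm (f x) * 2 \<le> 1 + (norm (f x))\<^sup>2" by (simp add: power2_diff)
      then show "norm (f x) \<le> 1 + (norm (f x))\<^sup>2" using \<open>0 \<le> norm (f x)\<close> by linarith
    qed (use C(2) in auto)
    also have "\<dots> = norm (K * (1 + (norm (f x))\<^sup>2))" using K by (simp add: abs_mult)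
    finally show "norm (f x \<bullet> C x) \<le> norm (K * (1 + (norm (f x))\<^sup>2))" .
  qed
qed

lemma square_integrable_diff:
  fixes f g :: "'a::euclidean_space \<Rightarrow> 'b::euclidean_space"
  assumes f: "square_integrable_on \<Omega> f" and g: "square_integrable_on \<Omega> g"
  shows "square_integrable_on \<Omega> (\<lambda>x. f x - g x)"
  unfolding square_integrable_on_def
proof
  show m: "(\<lambda>x. f x - g x) \<in> borel_measurable (lebesgue_on \<Omega>)"
    using f g by (auto simp: square_integrable_on_def)
  show "integrable (lebesgue_on \<Omega>) (\<lambda>x. (norm (f x - g x))\<^sup>2)"
  proof (rule Bochner_Integration.integrable_bound)
    show "integrable (lebesgue_on \<Omega>) (\<lambda>x. 2 * (norm (f x))\<^sup>2 + 2 * (norm (g x))\<^sup>2)"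
      using f g by (auto simp: square_integrable_on_def)
    have "(norm (f x - g x))\<^sup>2 \<le> 2 * (norm (f x))\<^sup>2 + 2 * (norm (g x))\<^sup>2" for x
    proof -
      have "(norm (f x - g x))\<^sup>2 \<le> (norm (f x) + norm (g x))\<^sup>2"
        by (intro power_mono norm_triangle_ineq4) auto
      moreover have "0 \<le> (norm (f x) - norm (g x))\<^sup>2" by simp
      ultimately show ?thesis by (simp add: power2_sum power2_diff)
    qed
    then show "AE x in lebesgue_on \<Omega>. norm ((norm (f x - g x))\<^sup>2) \<le> norm (2 * (norm (f x))\<^sup>2 + 2 * (norm (g x))\<^sup>2)"
      by auto
  qed (use m in auto)
qed

lemma square_integrable_continuous:
  fixes f :: "'a::euclidean_space \<Rightarrow> 'b::euclidean_space"
  assumes fin: "finite_measure (lebesgue_on \<Omega>)" and \<Omega>: "\<Omega> \<in> sets lebesgue"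
    and f: "continuous_on UNIV f" and out: "\<And>x. R < norm x \<Longrightarrow> f x = 0"
  shows "square_integrable_on \<Omega> f"
proof -
  have m: "f \<in> borel_measurable (lebesgue_on \<Omega>)"
    using continuous_on_subset[OF f] \<Omega> by (intro continuous_imp_measurable_on_sets_lebesgue) auto
  have "bounded (f ` cball 0 R)"
    by (intro compact_imp_bounded compact_continuous_image continuous_on_subset[OF f]) auto
  then obtain K where "\<forall>x\<in>cball 0 R. norm (f x) \<le> K" unfolding bounded_iff by auto
  then have "norm (f x) \<le> max K 0" for x
    using out[of x] by (cases "norm x \<le> R") (auto simp: le_max_iff_disj)
  then have "norm ((norm (f x))\<^sup>2) \<le> (max K 0)\<^sup>2" for x by (simp add: power_mono)
  then have "integrable (lebesgue_on \<Omega>) (\<lambda>x. (norm (f x))\<^sup>2)"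
    using m by (intro finite_measure.integrable_const_bound[OF fin, of _ "(max K 0)\<^sup>2"]) auto
  with m show ?thesis by (simp add: square_integrable_on_def)
qed

lemma compact_test_bounded:
  assumes "compact_test a b \<psi>"
  obtains K where "\<And>t. \<bar>\<psi> t\<bar> \<le> K"
proof -
  have "bounded (\<psi> ` {a..b})"
    by (intro compact_imp_bounded compact_continuous_image compact_test_continuous[OF assms]) auto
  then obtain K where "\<forall>t\<in>{a..b}. \<bar>\<psi> t\<bar> \<le> K" unfolding bounded_iff by auto
  then have "\<bar>\<psi> t\<bar> \<le> max K 0" for t
    using compact_test_outside[OF assms, of t] by (cases "t \<in> {a..b}") (auto simp: le_max_iff_disj)
  then show thesis by (rule that)
qed

text \<open>
  By approximation, the same identity holds in \<open>H\<^sub>0\<^sup>1\<close>, still for profiles \<open>\<theta>\<close> that do not vanish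
  on the boundary. This is the form in which the boundary condition of \<open>u\<close> is used.
\<close>

lemma radial_divergence:
  fixes u :: "'a::euclidean_space \<Rightarrow> real"
  assumes H10: "H10_gradient \<Omega> u G" and \<Omega>: "open \<Omega>" "bounded \<Omega>"
    and \<theta>: "compact_test 0 m \<theta>" "compact_test 0 m \<theta>'" "\<And>t. (\<theta> has_real_derivative \<theta>' t) (at t)"
  shows "integrable (lebesgue_on \<Omega>) (\<lambda>x. u x * (\<theta>' (norm x) / norm x ^ (DIM('a) - 1)))"
    and "integrable (lebesgue_on \<Omega>) (\<lambda>x. G x \<bullet> ((\<theta> (norm x) / norm x ^ DIM('a)) *\<^sub>R x))"
    and "(LINT x|lebesgue_on \<Omega>. u x * (\<theta>' (norm x) / norm x ^ (DIM('a) - 1))) =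
         - (LINT x|lebesgue_on \<Omega>. G x \<bullet> ((\<theta> (norm x) / norm x ^ DIM('a)) *\<^sub>R x))"
proof -
  let ?n = "DIM('a)" and ?M = "lebesgue_on \<Omega>"
  have lm: "\<Omega> \<in> lmeasurable" using \<Omega> by (intro lmeasurable_open)
  then have sets: "\<Omega> \<in> sets lebesgue" and fin: "finite_measure ?M"
    using finite_measure_lebesgue_on by blast+
  define B where "B = (\<lambda>x::'a. \<theta>' (norm x) / norm x ^ (?n - 1))"
  define C where "C = (\<lambda>x::'a. (\<theta> (norm x) / norm x ^ ?n) *\<^sub>R x)"
  have t: "compact_test 0 m (\<lambda>t. \<theta>' t / t ^ (?n - 1))" "compact_test 0 m (\<lambda>t. \<theta> t / t ^ (?n - 1))"
    "compact_test 0 m (\<lambda>t. \<theta> t / t ^ ?n)"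
    using \<theta> by (auto intro: compact_test_divide_power)
  obtain K1 where K1: "\<And>t. \<bar>\<theta>' t / t ^ (?n - 1)\<bar> \<le> K1" using compact_test_bounded[OF t(1)] by blast
  obtain K2 where K2: "\<And>t. \<bar>\<theta> t / t ^ (?n - 1)\<bar> \<le> K2" using compact_test_bounded[OF t(2)] by blast
  define K where "K = max K1 K2"
  have K0: "0 \<le> K" using K1[of 0] unfolding K_def by (meson abs_ge_zero le_max_iff_disj order_trans)
  have B: "norm (B x) \<le> K" for x using K1[of "norm x"] by (simp add: B_def K_def)
  have C: "norm (C x) \<le> K" for x
  proof -
    obtain j where "?n = Suc j" using DIM_positive[where 'a='a] gr0_implies_Suc by blast
    then have "norm (C x) = \<bar>\<theta> (norm x) / norm x ^ (?n - 1)\<bar>" if "x \<noteq> 0"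
      using that by (simp add: C_def field_simps abs_mult)
    moreover have "norm (C x) = 0" if "x = 0" using that by (simp add: C_def)
    ultimately show ?thesis using K2[of "norm x"] K0 by (cases "x = 0") (auto simp: K_def)
  qed
  have contB: "continuous_on UNIV B" unfolding B_def
    by (rule continuous_on_compose2[OF compact_test_continuous[OF t(1), of UNIV]]) (auto intro: continuous_intros)
  have contC: "continuous_on UNIV C" unfolding C_def
    by (intro continuous_intros continuous_on_compose2[OF compact_test_continuous[OF t(3), of UNIV]]) (auto intro: continuous_intros)
  have mB: "B \<in> borel_measurable ?M" and mC: "C \<in> borel_measurable ?M"
    using continuous_on_subset[OF contB] continuous_on_subset[OF contC] sets
    by (auto intro!: continuous_imp_measurable_on_sets_lebesgue)
  have u: "square_integrable_on \<Omega> u" and G: "square_integrable_on \<Omega> G"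
    using H10 by (auto simp: H10_gradient_def H1_gradient_def)
  obtain \<phi> where \<phi>: "\<And>k::nat. \<phi> k \<in> test_functions \<Omega>"
    "(\<lambda>k. LINT x|?M. (u x - \<phi> k x)\<^sup>2 + (norm (G x - grad (\<phi> k) x))\<^sup>2) \<longlonglongrightarrow> 0"
    using H10 unfolding H10_gradient_def by blast
  have \<phi>sq: "square_integrable_on \<Omega> (\<phi> k)" "square_integrable_on \<Omega> (grad (\<phi> k))" for k
  proof -
    obtain R where R: "smooth (\<phi> k)" "continuous_on UNIV (grad (\<phi> k))"
      "\<And>x. R < norm x \<Longrightarrow> \<phi> k x = 0" "\<And>x. R < norm x \<Longrightarrow> grad (\<phi> k) x = 0"
      using test_functionE[OF \<phi>(1)[of k]] by metis
    have "continuous_on UNIV (\<phi> k)" using R(1)[unfolded smooth_def, rule_format, of 0] by simp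
    then show "square_integrable_on \<Omega> (\<phi> k)" "square_integrable_on \<Omega> (grad (\<phi> k))"
      using R square_integrable_continuous[OF fin sets] by blast+
  qed
  have intB: "integrable ?M (\<lambda>x. f x * B x)" if "square_integrable_on \<Omega> f" for f :: "'a \<Rightarrow> real"
    using square_integrable_pairing[OF fin that mB B] by simp
  have intC: "integrable ?M (\<lambda>x. f x \<bullet> C x)" if "square_integrable_on \<Omega> f" for f :: "'a \<Rightarrow> 'a"
    using square_integrable_pairing[OF fin that mC C] by simp
  show "integrable ?M (\<lambda>x. u x * (\<theta>' (norm x) / norm x ^ (?n - 1)))"
    using intB[OF u] unfolding B_def .
  show "integrable ?M (\<lambda>x. G x \<bullet> ((\<theta> (norm x) / norm x ^ ?n) *\<^sub>R x))"
    using intC[OF G] unfolding C_def .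
  define s where "s = (LINT x|?M. u x * B x + G x \<bullet> C x)"
  define v where "v = measure ?M \<Omega>"
  have bound: "\<bar>s\<bar> \<le> K * e * v + K / (2 * e) * (LINT x|?M. (u x - \<phi> k x)\<^sup>2 + (norm (G x - grad (\<phi> k) x))\<^sup>2)"
    if e: "e > 0" for e k
  proof -
    let ?d = "\<lambda>x. (u x - \<phi> k x)\<^sup>2 + (norm (G x - grad (\<phi> k) x))\<^sup>2"
    note du = square_integrable_diff[OF u \<phi>sq(1)[of k]] and dG = square_integrable_diff[OF G \<phi>sq(2)[of k]]
    have intd: "integrable ?M ?d" using du dG by (auto simp: square_integrable_on_def)
    have "(LINT x|?M. \<phi> k x * B x + grad (\<phi> k) x \<bullet> C x) = 0"
      unfolding B_def C_def by (rule radial_divergence_test[OF \<phi>(1) sets \<theta>])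
    then have "s = (LINT x|?M. (u x * B x + G x \<bullet> C x) - (\<phi> k x * B x + grad (\<phi> k) x \<bullet> C x))"
      unfolding s_def using intB[OF u] intC[OF G] intB[OF \<phi>sq(1)[of k]] intC[OF \<phi>sq(2)[of k]]
      by (subst Bochner_Integration.integral_diff) auto
    also have "\<dots> = (LINT x|?M. (u x - \<phi> k x) * B x + (G x - grad (\<phi> k) x) \<bullet> C x)"
      by (rule Bochner_Integration.integral_cong) (auto simp: algebra_simps)
    finally have "\<bar>s\<bar> \<le> (LINT x|?M. \<bar>(u x - \<phi> k x) * B x + (G x - grad (\<phi> k) x) \<bullet> C x\<bar>)"
      by (simp add: integral_abs_bound)
    also have "\<dots> \<le> (LINT x|?M. K * e + K / (2 * e) * ?d x)"
    proof (rule integral_mono)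
      show "integrable ?M (\<lambda>x. \<bar>(u x - \<phi> k x) * B x + (G x - grad (\<phi> k) x) \<bullet> C x\<bar>)"
        using intB[OF du] intC[OF dG] by (intro integrable_abs Bochner_Integration.integrable_add)
      show "integrable ?M (\<lambda>x. K * e + K / (2 * e) * ?d x)"
        by (rule Bochner_Integration.integrable_add[OF finite_measure.integrable_const[OF fin]
              integrable_mult_right[OF intd]])
      fix x
      \<comment> \<open>Young's inequality; the weight \<open>e\<close> tends to zero after the limit in \<open>k\<close>.\<close>
      have am: "a \<le> e / 2 + a\<^sup>2 / (2 * e)" for a :: real
      proof -
        have "0 \<le> (a - e)\<^sup>2" by simp
        then show ?thesis using e by (simp add: power2_diff field_simps power2_eq_square)
      qed
      have "\<bar>(u x - \<phi> k x) * B x + (G x - grad (\<phi> k) x) \<bullet> C x\<bar> \<le>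
        \<bar>u x - \<phi> k x\<bar> * \<bar>B x\<bar> + norm (G x - grad (\<phi> k) x) * norm (C x)"
        by (rule order_trans[OF abs_triangle_ineq add_mono]) (auto simp: abs_mult Cauchy_Schwarz_ineq2)
      also have "\<dots> \<le> (e / 2 + \<bar>u x - \<phi> k x\<bar>\<^sup>2 / (2 * e)) * K + (e / 2 + (norm (G x - grad (\<phi> k) x))\<^sup>2 / (2 * e)) * K"
        using B[of x] C[of x] e by (intro add_mono mult_mono am) auto
      also have "\<dots> = K * e + K / (2 * e) * ?d x"
        using e by (simp add: field_simps)
      finally show "\<bar>(u x - \<phi> k x) * B x + (G x - grad (\<phi> k) x) \<bullet> C x\<bar> \<le> K * e + K / (2 * e) * ?d x" .
    qed
    also have "\<dots> = K * e * v + K / (2 * e) * (LINT x|?M. ?d x)"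
      using Bochner_Integration.integral_add[OF finite_measure.integrable_const[OF fin, of "K * e"]
          integrable_mult_right[OF intd, of "K / (2 * e)"]]
      by (simp only: integral_mult_right_zero lebesgue_integral_const) (simp add: v_def)
    finally show ?thesis .
  qed
  have le: "\<bar>s\<bar> \<le> K * e * v" if "e > 0" for e
  proof (rule LIMSEQ_le_const)
    show "(\<lambda>k. K * e * v + K / (2 * e) * (LINT x|?M. (u x - \<phi> k x)\<^sup>2 + (norm (G x - grad (\<phi> k) x))\<^sup>2)) \<longlonglongrightarrow> K * e * v"
      using tendsto_add[OF tendsto_const tendsto_mult[OF tendsto_const \<phi>(2)], of "K * e * v" "K / (2 * e)"] by simp
  qed (use bound[OF that] in blast)
  have "\<bar>s\<bar> \<le> 0"
  proof (rule field_le_epsilon)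
    fix e :: real assume e: "e > 0"
    have v: "0 \<le> v" by (simp add: v_def)
    then have Kv: "0 < K * v + 1" using K0 by (simp add: add_nonneg_pos)
    have "\<bar>s\<bar> \<le> K * (e / (K * v + 1)) * v" using le[of "e / (K * v + 1)"] e Kv by simp
    also have "\<dots> = e * (K * v / (K * v + 1))" by (simp add: mult_ac)
    also have "\<dots> \<le> e * 1"
    proof (rule mult_left_mono)
      show "K * v / (K * v + 1) \<le> 1" using Kv by (simp only: divide_le_eq_1_pos)
    qed (use e in simp)
    finally show "\<bar>s\<bar> \<le> 0 + e" by simp
  qed
  moreover have "s = (LINT x|?M. u x * B x) + (LINT x|?M. G x \<bullet> C x)"
    unfolding s_def using intB[OF u] intC[OF G] by (rule Bochner_Integration.integral_add)
  ultimately have "(LINT x|?M. u x * B x) = - (LINT x|?M. G x \<bullet> C x)" by linarith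
  then show "(LINT x|?M. u x * (\<theta>' (norm x) / norm x ^ (?n - 1))) =
         - (LINT x|?M. G x \<bullet> ((\<theta> (norm x) / norm x ^ ?n) *\<^sub>R x))"
    unfolding B_def C_def .
qed

section \<open>Bounds on averages of radial Sobolev functions\<close>

lemma unit_bump_mass:
  assumes h: "compact_test a b h" "\<And>t. 0 \<le> h t" "integral UNIV h = 1"
  shows "0 \<le> integral {c..t} h" "integral {c..t} h \<le> 1" "t \<le> a \<Longrightarrow> integral {c..t} h = 0"
    "c \<le> a \<Longrightarrow> b \<le> t \<Longrightarrow> integral {c..t} h = 1"
proof -
  have int: "h integrable_on {c..t}"
    by (intro integrable_continuous_real compact_test_continuous[OF h(1)])
  show "0 \<le> integral {c..t} h" by (rule integral_nonneg[OF int h(2)])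
  have "integral {c..t} h \<le> integral UNIV h"
    by (rule integral_subset_le[OF subset_UNIV int compact_test_integrable'[OF h(1)]]) (simp add: h(2))
  then show "integral {c..t} h \<le> 1" using h(3) by simp
  show "integral {c..t} h = 0" if "t \<le> a"
  proof (rule integral_unique[OF has_integral_is_0])
    show "h x = 0" if "x \<in> {c..t}" for x
      using compact_test_outside[OF h(1), of x] that \<open>t \<le> a\<close> by auto
  qed
  show "integral {c..t} h = 1" if "c \<le> a" "b \<le> t"
  proof -
    have "(h has_integral integral {c..t} h) UNIV"
    proof (rule has_integral_compact_support[OF compact_test_continuous[OF h(1)]])
      show "h x = 0" if "x \<notin> {c..t}" for x
        using compact_test_outside[OF h(1), of x] that \<open>c \<le> a\<close> \<open>b \<le> t\<close> by auto
    qed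
    then show ?thesis using h(3) by (simp add: integral_unique)
  qed
qed

lemma unit_bump_difference:
  assumes h: "compact_test a b h" "\<And>t. 0 \<le> h t" "integral UNIV h = 1"
    and h': "compact_test a' b' h'" "\<And>t. 0 \<le> h' t" "integral UNIV h' = 1"
    and bounds: "0 \<le> a" "0 \<le> a'" "b \<le> m" "b' \<le> m"
  obtains \<theta> where "compact_test 0 m \<theta>" "compact_test 0 m (\<lambda>t. h t + (-1) * h' t)"
    "\<And>t. (\<theta> has_real_derivative (h t + (-1) * h' t)) (at t)" "\<And>t. \<bar>\<theta> t\<bar> \<le> 1"
    "\<And>t. t \<le> min a a' \<Longrightarrow> \<theta> t = 0" "\<And>t. max b b' \<le> t \<Longrightarrow> \<theta> t = 0"
proof -
  have g: "compact_test 0 m (\<lambda>t. h t + (-1) * h' t)"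
    by (intro compact_test_lincomb compact_test_mono[OF h(1)] compact_test_mono[OF h'(1)] bounds)
  have "integral UNIV (\<lambda>t. h t + (-1) * h' t) = 1 + (-1) * 1"
    using integral_lincomb[OF compact_test_integrable'[OF h(1)] compact_test_integrable'[OF h'(1)] refl, of "-1"]
    by (simp only: h(3) h'(3))
  then have zero: "integral UNIV (\<lambda>t. h t + (-1) * h' t) = 0" by simp
  obtain \<theta> where \<theta>: "compact_test 0 m \<theta>" "\<And>t. (\<theta> has_real_derivative (h t + (-1) * h' t)) (at t)"
    "\<And>t. \<theta> t = integral {0..t} (\<lambda>t. h t + (-1) * h' t)"
    by (rule test_antiderivative[OF g zero]) (rule that)
  have eq: "\<theta> t = integral {0..t} h - integral {0..t} h'" for t
  proof -
    have "integral {0..t} (\<lambda>t. h t + (-1) * h' t) = integral {0..t} (\<lambda>t. h t - h' t)" by simp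
    also have "\<dots> = integral {0..t} h - integral {0..t} h'"
      by (rule Henstock_Kurzweil_Integration.integral_diff)
         (intro integrable_continuous_real compact_test_continuous[OF h(1)] compact_test_continuous[OF h'(1)])+
    finally show ?thesis using \<theta>(3) by simp
  qed
  note M = unit_bump_mass[OF h, where c=0] and M' = unit_bump_mass[OF h', where c=0]
  show thesis
  proof (rule that[OF \<theta>(1) g \<theta>(2)])
    show "\<bar>\<theta> t\<bar> \<le> 1" for t using M(1,2)[of t] M'(1,2)[of t] unfolding eq by linarith
    show "\<theta> t = 0" if "t \<le> min a a'" for t using M(3)[of t] M'(3)[of t] that unfolding eq by simp
    show "\<theta> t = 0" if "max b b' \<le> t" for t using M(4)[of t] M'(4)[of t] that bounds unfolding eq by simp
  qed
qed

text \<open>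
  Bounds on all averages against concentrated bumps give pointwise bounds. The intermediate point
  \<open>t\<close> allows the bound to be evaluated at whichever end of the support of the bump is convenient.
\<close>

lemma pointwise_bound_from_averages:
  fixes U \<Phi> :: "real \<Rightarrow> real"
  assumes U: "continuous_on {A<..<B} U" and \<Phi>: "continuous_on {A<..<B} \<Phi>"
    and avg: "\<And>s s' h. A < s \<Longrightarrow> s < s' \<Longrightarrow> s' < B \<Longrightarrow> compact_test s s' h \<Longrightarrow> (\<And>t. 0 \<le> h t) \<Longrightarrow>
      integral UNIV h = 1 \<Longrightarrow> \<exists>t\<in>{s..s'}. \<bar>integral UNIV (\<lambda>t. U t * h t)\<bar> \<le> \<Phi> t"
    and r: "A < r" "r < B"
  shows "\<bar>U r\<bar> \<le> \<Phi> r"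
proof (rule ccontr)
  assume "\<not> \<bar>U r\<bar> \<le> \<Phi> r"
  define \<sigma> where "\<sigma> = (if 0 \<le> U r then 1 else -1 :: real)"
  define m where "m = (\<Phi> r + \<bar>U r\<bar>) / 2"
  have \<sigma>U: "\<sigma> * U r = \<bar>U r\<bar>" by (simp add: \<sigma>_def)
  then have m: "\<Phi> r < m" "m < \<sigma> * U r" using \<open>\<not> \<bar>U r\<bar> \<le> \<Phi> r\<close> by (auto simp: m_def)
  have "isCont (\<lambda>t. \<sigma> * U t) r" "isCont \<Phi> r"
    using U \<Phi> r by (auto simp: continuous_on_eq_continuous_at intro: continuous_mult_left)
  then have "\<forall>\<^sub>F t in at r. m < \<sigma> * U t" "\<forall>\<^sub>F t in at r. \<Phi> t < m"
    using order_tendstoD(1)[of "\<lambda>t. \<sigma> * U t" "\<sigma> * U r" "at r" m] order_tendstoD(2)[of \<Phi> "\<Phi> r" "at r" m] m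
    unfolding isCont_def by blast+
  then have "\<forall>\<^sub>F t in at r. m < \<sigma> * U t \<and> \<Phi> t < m" by eventually_elim simp
  then obtain e where e: "e > 0" "\<forall>t. t \<noteq> r \<and> dist t r < e \<longrightarrow> m < \<sigma> * U t \<and> \<Phi> t < m"
    unfolding eventually_at by auto
  have near: "m < \<sigma> * U t \<and> \<Phi> t < m" if "\<bar>t - r\<bar> < e" for t
    using e(2) m that by (cases "t = r") (auto simp: dist_real_def)
  define s where "s = max ((A + r) / 2) (r - e / 2)"
  define s' where "s' = min ((B + r) / 2) (r + e / 2)"
  have s: "A < s" "s < r" "r < s'" "s' < B" using r e(1) by (auto simp: s_def s'_def less_max_iff_disj min_less_iff_disj)
  have close: "\<bar>t - r\<bar> < e" if "s \<le> t" "t \<le> s'" for t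
    using that e(1) by (auto simp: s_def s'_def)
  have "s < s'" using s by simp
  obtain h where h: "compact_test s s' h" "\<And>t. 0 \<le> h t" "integral UNIV h = 1"
    by (rule unit_bump_exists[OF \<open>s < s'\<close>]) (rule that)
  obtain t where t: "t \<in> {s..s'}" "\<bar>integral UNIV (\<lambda>t. U t * h t)\<bar> \<le> \<Phi> t"
    using avg[OF s(1) \<open>s < s'\<close> s(4) h] by blast
  have "m \<le> integral UNIV (\<lambda>t. \<sigma> * U t * h t)"
  proof (rule unit_bump_average[OF h])
    show "continuous_on {s<..<s'} (\<lambda>t. \<sigma> * U t)"
      using s by (intro continuous_on_mult_left continuous_on_subset[OF U]) auto
    show "m \<le> \<sigma> * U t" if "s < t" "t < s'" for t using near[OF close, of t] that by simp
  qed
  also have "integral UNIV (\<lambda>t. \<sigma> * U t * h t) = \<sigma> * integral UNIV (\<lambda>t. U t * h t)"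
    by (simp add: mult.assoc)
  also have "\<dots> \<le> \<bar>integral UNIV (\<lambda>t. U t * h t)\<bar>" by (auto simp: \<sigma>_def)
  also have "\<dots> \<le> \<Phi> t" by (rule t(2))
  also have "\<dots> < m" using near[OF close, of t] t(1) by simp
  finally show False by simp
qed

text \<open>
  A common description of balls and annuli away from the origin; a ball has \<open>A = 0\<close>.
\<close>

definition radial_shell :: "'a::euclidean_space set \<Rightarrow> real \<Rightarrow> real \<Rightarrow> bool" where
  "radial_shell \<Omega> A B \<longleftrightarrow> 0 \<le> A \<and> A < B \<and> open \<Omega> \<and> bounded \<Omega> \<and>
     (\<forall>x. x \<noteq> 0 \<longrightarrow> (x \<in> \<Omega> \<longleftrightarrow> A < norm x \<and> norm x < B))"

lemma radial_domain_shell: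
  assumes "radial_domain (\<Omega> :: 'a::euclidean_space set)"
  obtains A B where "radial_shell \<Omega> A B"
  using assms unfolding radial_domain_def
proof (elim disjE exE conjE)
  fix R :: real assume "0 < R" "\<Omega> = ball 0 R"
  then have "radial_shell \<Omega> 0 R" by (auto simp: radial_shell_def)
  then show thesis by (rule that)
next
  fix a b :: real assume ab: "0 < a" "a < b" "\<Omega> = {x. a < norm x \<and> norm x < b}"
  have "open {x::'a. a < norm x \<and> norm x < b}"
    by (intro open_Collect_conj open_Collect_less continuous_intros)
  moreover have "bounded {x::'a. a < norm x \<and> norm x < b}"
    by (rule bounded_subset[OF bounded_ball[of 0 b]]) auto
  ultimately have "radial_shell \<Omega> a b" using ab by (auto simp: radial_shell_def)
  then show thesis by (rule that)
qed

lemma shell_radial_integral: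
  fixes f :: "'a::euclidean_space \<Rightarrow> real"
  assumes sh: "radial_shell \<Omega> A B" and v: "continuous_on {A<..<B} v" and h: "compact_test A B h"
    and f: "\<And>x. x \<in> \<Omega> \<Longrightarrow> f x = v (norm x) * h (norm x) / norm x ^ (DIM('a) - 1)"
  shows "integrable (lebesgue_on \<Omega>) f"
    "(LINT x|lebesgue_on \<Omega>. f x) = sphere_area TYPE('a) * integral UNIV (\<lambda>r. v r * h r)"
proof -
  let ?k = "DIM('a) - 1"
  define H where "H = (\<lambda>r. v r * h r / r ^ ?k)"
  have A: "0 \<le> A" "open \<Omega>" using sh by (auto simp: radial_shell_def)
  have sets: "\<Omega> \<in> sets lebesgue" using A by auto
  obtain c d where cd: "A < c" "c < d" "d < B" "\<And>t. t \<le> c \<Longrightarrow> h t = 0" "\<And>t. d \<le> t \<Longrightarrow> h t = 0"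
    by (rule compact_testE[OF h]) (rule that)
  have c0: "0 < c" using cd A by simp
  have contH: "continuous_on {c..d} H" unfolding H_def
    using cd c0 by (intro continuous_intros compact_test_continuous[OF h] continuous_on_subset[OF v]) auto
  have outH: "H t = 0" if "t \<notin> {c..d}" for t
    using that cd(4)[of t] cd(5)[of t] by (cases "t \<le> c") (auto simp: H_def)
  note RI = radial_integral[OF c0 contH outH, where 'a='a]
  have out: "H (norm x) = 0" if "x \<notin> \<Omega>" for x :: 'a
  proof (cases "x = 0")
    case True
    then show ?thesis using outH[of 0] c0 by simp
  next
    case False
    then have "\<not> (A < norm x \<and> norm x < B)" using sh that by (auto simp: radial_shell_def)
    then show ?thesis using cd by (intro outH) auto
  qed
  have "integrable lborel (\<lambda>x::'a. H (norm x))" by (rule RI(1))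
  then have meas: "(\<lambda>x::'a. H (norm x)) \<in> borel_measurable borel" using borel_measurable_integrable by force
  note L = lebesgue_on_integral_lborel[OF sets meas out]
  have f': "f x = H (norm x)" if "x \<in> space (lebesgue_on \<Omega>)" for x
    using f[of x] that by (simp add: H_def)
  have "integrable (lebesgue_on \<Omega>) (\<lambda>x. H (norm x))" using L(2) RI(1) by simp
  then show "integrable (lebesgue_on \<Omega>) f" by (subst Bochner_Integration.integrable_cong[OF refl f'])
  have "(LINT x|lebesgue_on \<Omega>. f x) = (LINT x|lebesgue_on \<Omega>. H (norm x))"
    by (rule Bochner_Integration.integral_cong[OF refl f'])
  also have "\<dots> = sphere_area TYPE('a) * integral UNIV (\<lambda>r. r ^ ?k * H r)" using L(1) RI(2) by simp
  also have "(\<lambda>r. r ^ ?k * H r) = (\<lambda>r. v r * h r)"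
  proof
    fix r
    show "r ^ ?k * H r = v r * h r" using cd(4)[of r] c0 by (cases "r = 0") (auto simp: H_def)
  qed
  finally show "(LINT x|lebesgue_on \<Omega>. f x) = sphere_area TYPE('a) * integral UNIV (\<lambda>r. v r * h r)" .
qed

text \<open>
  The divergence identity with \<open>\<theta>' = h\<close> inside \<open>\<Omega>\<close> bounds an average of \<open>U\<close> by the energy of \<open>u\<close>
  and by the integral of \<open>r\<^sup>k (\<theta> / r\<^sup>k)\<^sup>2 \<le> 1 / r\<^sup>k\<close> over the support of \<open>\<theta>\<close> in \<open>\<Omega>\<close>. The parameter
  \<open>y\<close> comes from Young's inequality in place of Cauchy--Schwarz.
\<close>

lemma average_energy_bound:
  fixes u :: "'a::euclidean_space \<Rightarrow> real"
  assumes sh: "radial_shell \<Omega> A B" and k: "DIM('a) - 1 \<in> {1, 2}"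
    and H10: "H10_gradient \<Omega> u G" and U: "continuous_on {A<..<B} U"
    and u: "\<And>x. x \<in> \<Omega> \<Longrightarrow> x \<noteq> 0 \<Longrightarrow> u x = U (norm x)"
    and h: "compact_test A B h"
    and \<theta>: "compact_test 0 m \<theta>" "compact_test 0 m \<theta>'" "\<And>t. (\<theta> has_real_derivative \<theta>' t) (at t)"
    and \<theta>1: "\<And>t. \<bar>\<theta> t\<bar> \<le> 1" and h': "\<And>r. A < r \<Longrightarrow> r < B \<Longrightarrow> \<theta>' r = h r"
    and cd: "0 < c" "c \<le> d" "\<And>r. A < r \<Longrightarrow> r < B \<Longrightarrow> \<theta> r \<noteq> 0 \<Longrightarrow> c \<le> r \<and> r \<le> d"
    and y: "0 < y"
  shows "sphere_area TYPE('a) * \<bar>integral UNIV (\<lambda>r. U r * h r)\<bar> \<le>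
    (y * (LINT x|lebesgue_on \<Omega>. (norm (G x))\<^sup>2) +
     sphere_area TYPE('a) * (radial_harmonic (DIM('a) - 1) d - radial_harmonic (DIM('a) - 1) c) / y) / 2"
proof -
  let ?k = "DIM('a) - 1" and ?M = "lebesgue_on \<Omega>" and ?c = "sphere_area TYPE('a)"
  let ?L = "radial_harmonic (DIM('a) - 1)"
  have A: "0 \<le> A" "open \<Omega>" "bounded \<Omega>" using sh by (auto simp: radial_shell_def)
  then have sets: "\<Omega> \<in> sets lebesgue" by auto
  define C where "C = (\<lambda>x::'a. (\<theta> (norm x) / norm x ^ DIM('a)) *\<^sub>R x)"
  note D = radial_divergence[OF H10 A(2,3) \<theta>]
  have G: "integrable ?M (\<lambda>x. (norm (G x))\<^sup>2)"
    using H10 by (auto simp: H10_gradient_def H1_gradient_def square_integrable_on_def)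
  have E: "(LINT x|?M. u x * (\<theta>' (norm x) / norm x ^ ?k)) = ?c * integral UNIV (\<lambda>r. U r * h r)"
  proof (rule shell_radial_integral(2)[OF sh U h])
    fix x assume x: "x \<in> \<Omega>"
    show "u x * (\<theta>' (norm x) / norm x ^ ?k) = U (norm x) * h (norm x) / norm x ^ ?k"
    proof (cases "x = 0")
      case True
      then show ?thesis using compact_test_outside[OF \<theta>(2), of 0] compact_test_outside[OF h, of 0] A by simp
    next
      case False
      then have "\<theta>' (norm x) = h (norm x)" using h' x sh by (auto simp: radial_shell_def)
      then show ?thesis using u[OF x False] by simp
    qed
  qed
  have I: "?c * integral UNIV (\<lambda>r. U r * h r) = - (LINT x|?M. G x \<bullet> C x)"
    unfolding C_def using E D(3) by (rule trans[OF sym])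
  define J where "J = (\<lambda>r. if r \<in> {c..d} then 1 / r ^ (2 * ?k) else 0 :: real)"
  have contJ: "continuous_on {c..d} J"
  proof -
    have "continuous_on {c..d} (\<lambda>r. 1 / r ^ (2 * ?k))" using cd by (intro continuous_intros) auto
    then show ?thesis by (rule continuous_on_eq) (simp add: J_def)
  qed
  have outJ: "J t = 0" if "t \<notin> {c..d}" for t unfolding J_def by (rule if_not_P[OF that])
  note RJ = radial_integral[OF cd(1) contJ outJ, where 'a='a]
  have J0: "0 \<le> J t" for t using cd by (auto simp: J_def)
  have measJ: "(\<lambda>x::'a. J (norm x)) \<in> borel_measurable borel"
    using borel_measurable_integrable[OF RJ(1)] by simp
  have intJ: "integrable lebesgue (\<lambda>x::'a. J (norm x))"
    using RJ(1) measJ by (simp add: integrable_completion)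
  have sets': "\<Omega> \<inter> space lebesgue \<in> sets lebesgue" using sets by simp
  have intJM: "integrable ?M (\<lambda>x. J (norm x))"
    unfolding integrable_restrict_space[OF sets'] by (rule integrable_mult_indicator) (use sets intJ in auto)
  have "(LINT x|?M. J (norm x)) \<le> (LINT x|lebesgue. J (norm (x::'a)))"
    unfolding integral_restrict_space[OF sets']
  proof (rule integral_mono)
    show "integrable lebesgue (\<lambda>x. indicator \<Omega> x *\<^sub>R J (norm x))"
      by (rule integrable_mult_indicator) (use sets intJ in auto)
  qed (use intJ J0 in \<open>auto simp: indicator_def\<close>)
  also have "\<dots> = (LINT x|lborel. J (norm (x::'a)))" by (rule integral_completion) (simp add: measJ)
  also have "\<dots> = ?c * integral UNIV (\<lambda>r. r ^ ?k * J r)" by (rule RJ(2))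
  also have "integral UNIV (\<lambda>r. r ^ ?k * J r) = ?L d - ?L c"
  proof (rule integral_unique)
    have "((\<lambda>r. 1 / r ^ ?k) has_integral (?L d - ?L c)) {c..d}"
    proof (rule fundamental_theorem_of_calculus[OF cd(2)])
      fix r assume "r \<in> {c..d}"
      then have "0 < r" using cd by auto
      from radial_harmonic_derivative[OF k this]
      show "(?L has_vector_derivative 1 / r ^ ?k) (at r within {c..d})"
        by (simp add: has_real_derivative_iff_has_vector_derivative has_vector_derivative_at_within)
    qed
    then have "((\<lambda>r. r ^ ?k * J r) has_integral (?L d - ?L c)) {c..d}"
    proof (rule has_integral_eq[rotated])
      have reciprocal: "1 / r ^ n = r ^ n * (1 / r ^ (2 * n))" if "0 < r" for r :: real and n
        using that by (simp add: mult_2 power_add)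
      show "1 / r ^ ?k = r ^ ?k * J r" if "r \<in> {c..d}" for r
        unfolding J_def if_P[OF that] using that cd(1) by (intro reciprocal) auto
    qed
    then show "((\<lambda>r. r ^ ?k * J r) has_integral (?L d - ?L c)) UNIV"
      by (rule has_integral_on_superset) (auto simp: J_def)
  qed
  finally have Jle: "(LINT x|?M. J (norm x)) \<le> ?c * (?L d - ?L c)" .
  have "\<bar>LINT x|?M. G x \<bullet> C x\<bar> \<le> (LINT x|?M. \<bar>G x \<bullet> C x\<bar>)" by (rule integral_abs_bound)
  also have "\<dots> \<le> (LINT x|?M. y / 2 * (norm (G x))\<^sup>2 + 1 / (2 * y) * J (norm x))"
  proof (rule integral_mono)
    show "integrable ?M (\<lambda>x. \<bar>G x \<bullet> C x\<bar>)" unfolding C_def by (rule integrable_abs[OF D(2)])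
    show "integrable ?M (\<lambda>x. y / 2 * (norm (G x))\<^sup>2 + 1 / (2 * y) * J (norm x))"
      by (rule Bochner_Integration.integrable_add[OF integrable_mult_right[OF G] integrable_mult_right[OF intJM]])
    fix x assume "x \<in> space ?M"
    then have x: "x \<in> \<Omega>" by simp
    have CJ: "(norm (C x))\<^sup>2 \<le> J (norm x)"
    proof (cases "x = 0 \<or> \<theta> (norm x) = 0")
      case True
      then show ?thesis using J0 by (auto simp: C_def)
    next
      case False
      then have nx: "A < norm x" "norm x < B" using x sh by (auto simp: radial_shell_def)
      then have in_cd: "norm x \<in> {c..d}" using cd(3) False by auto
      have "DIM('a) = Suc ?k" using DIM_positive[where 'a='a] by linarith
      then have "norm x ^ DIM('a) = norm x * norm x ^ ?k" by (metis power_Suc)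
      then have "norm (C x) = \<bar>\<theta> (norm x)\<bar> / norm x ^ ?k" using False by (simp add: C_def)
      also have "\<dots> \<le> 1 / norm x ^ ?k" using \<theta>1 by (intro divide_right_mono) auto
      finally have "(norm (C x))\<^sup>2 \<le> (1 / norm x ^ ?k)\<^sup>2" by (rule power_mono) simp
      also have "\<dots> = J (norm x)" using in_cd
        by (simp add: J_def power_divide mult.commute flip: power_mult)
      finally show ?thesis .
    qed
    have "\<bar>G x \<bullet> C x\<bar> \<le> norm (G x) * norm (C x)" by (rule Cauchy_Schwarz_ineq2)
    also have "\<dots> \<le> y / 2 * (norm (G x))\<^sup>2 + 1 / (2 * y) * (norm (C x))\<^sup>2"
    proof -
      have "y / 2 * s\<^sup>2 + 1 / (2 * y) * t\<^sup>2 - s * t = (y * s - t)\<^sup>2 / (2 * y)" for s t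
        using y by (simp add: field_simps power2_eq_square)
      moreover have "0 \<le> (y * s - t)\<^sup>2 / (2 * y)" for s t using y by simp
      ultimately show ?thesis by (metis diff_ge_0_iff_ge)
    qed
    also have "\<dots> \<le> y / 2 * (norm (G x))\<^sup>2 + 1 / (2 * y) * J (norm x)"
      using CJ y by (intro add_left_mono mult_left_mono) auto
    finally show "\<bar>G x \<bullet> C x\<bar> \<le> y / 2 * (norm (G x))\<^sup>2 + 1 / (2 * y) * J (norm x)" .
  qed
  also have "\<dots> = y / 2 * (LINT x|?M. (norm (G x))\<^sup>2) + 1 / (2 * y) * (LINT x|?M. J (norm x))"
    using Bochner_Integration.integral_add[OF integrable_mult_right[OF G, of "y / 2"] integrable_mult_right[OF intJM, of "1 / (2 * y)"]]
    by (simp only: integral_mult_right_zero)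
  also have "\<dots> \<le> y / 2 * (LINT x|?M. (norm (G x))\<^sup>2) + 1 / (2 * y) * (?c * (?L d - ?L c))"
    using Jle y by (intro add_left_mono mult_left_mono) auto
  also have "\<dots> = (y * (LINT x|?M. (norm (G x))\<^sup>2) + ?c * (?L d - ?L c) / y) / 2"
    by (simp add: add_divide_distrib mult.commute)
  finally have "\<bar>?c * integral UNIV (\<lambda>r. U r * h r)\<bar> \<le> (y * (LINT x|?M. (norm (G x))\<^sup>2) + ?c * (?L d - ?L c) / y) / 2"
    unfolding I by simp
  then show ?thesis using sphere_area_pos[where 'a='a] by (simp add: abs_mult)
qed

section \<open>Decay of radial Sobolev functions and the radial equation of a component\<close>

text \<open>
  The radial lemma of Strauss, with the boundary condition built in. The average of \<open>U\<close> near \<open>r\<close>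
  is compared with an average over a bump beyond the outer sphere, or inside the inner one, where
  \<open>u\<close> vanishes: the antiderivative \<open>\<theta>\<close> of the difference of the two unit bumps has values in
  \<open>[-1, 1]\<close> and lives between the two supports.
\<close>

lemma radial_H10_small_at_ends:
  fixes u :: "'a::euclidean_space \<Rightarrow> real"
  assumes sh: "radial_shell \<Omega> A B" and k: "DIM('a) - 1 \<in> {1, 2}"
    and H10: "H10_gradient \<Omega> u G" and U: "continuous_on {A<..<B} U"
    and u: "\<And>x. x \<in> \<Omega> \<Longrightarrow> x \<noteq> 0 \<Longrightarrow> u x = U (norm x)"
  shows "small_at_ends (DIM('a) - 1) A B U"
proof -
  let ?c = "sphere_area TYPE('a)" and ?L = "radial_harmonic (DIM('a) - 1)"
  define E where "E = (LINT x|lebesgue_on \<Omega>. (norm (G x))\<^sup>2)"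
  define K where "K = (E + ?c) / (2 * ?c)"
  have c: "0 < ?c" by (rule sphere_area_pos)
  have A: "0 \<le> A" "A < B" using sh by (auto simp: radial_shell_def)
  have K: "0 \<le> K" using c by (simp add: K_def E_def)
  have contL: "continuous_on {A<..<B} ?L"
    by (rule DERIV_continuous_on_open_interval[OF radial_harmonic_derivative[OF k]]) (use A in auto)
  \<comment> \<open>Optimising in \<open>y\<close> turns the additive bound into a multiple of \<open>sqrt q\<close>.\<close>
  have opt: "\<bar>I\<bar> \<le> K * sqrt q"
    if q: "0 < q" and I: "\<And>y. 0 < y \<Longrightarrow> ?c * \<bar>I\<bar> \<le> (y * E + ?c * q / y) / 2" for I q
  proof -
    have "?c * \<bar>I\<bar> \<le> (sqrt q * E + ?c * q / sqrt q) / 2" using I[of "sqrt q"] q by simp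
    also have "q / sqrt q = sqrt q" using q by (simp add: real_div_sqrt)
    then have "?c * q / sqrt q = ?c * sqrt q" by (metis times_divide_eq_right)
    finally have "?c * \<bar>I\<bar> \<le> (sqrt q * E + ?c * sqrt q) / 2" .
    then show ?thesis using c by (simp add: K_def field_simps)
  qed
  have right: "\<bar>U r\<bar> \<le> K * sqrt (?L B - ?L r)" if r: "A < r" "r < B" for r
  proof (rule pointwise_bound_from_averages[OF U _ _ r])
    show "continuous_on {A<..<B} (\<lambda>r. K * sqrt (?L B - ?L r))" by (intro continuous_intros contL)
    fix s s' h
    assume s: "A < s" "s < s'" "s' < B" and h: "compact_test s s' h" "\<And>t. 0 \<le> h t" "integral UNIV h = 1"
    have "B < B + 1" by simp
    then obtain h' where h': "compact_test B (B + 1) h'" "\<And>t. 0 \<le> h' t" "integral UNIV h' = 1"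
      by (rule unit_bump_exists) (rule that)
    obtain \<theta> where \<theta>: "compact_test 0 (B + 1) \<theta>" "compact_test 0 (B + 1) (\<lambda>t. h t + (-1) * h' t)"
      "\<And>t. (\<theta> has_real_derivative (h t + (-1) * h' t)) (at t)" "\<And>t. \<bar>\<theta> t\<bar> \<le> 1"
      "\<And>t. t \<le> min s B \<Longrightarrow> \<theta> t = 0" "\<And>t. max s' (B + 1) \<le> t \<Longrightarrow> \<theta> t = 0"
      by (rule unit_bump_difference[OF h h', of "B + 1"]) (use s A in auto)
    have "\<bar>integral UNIV (\<lambda>r. U r * h r)\<bar> \<le> K * sqrt (?L B - ?L s)"
    proof (rule opt)
      show "0 < ?L B - ?L s" using radial_harmonic_strict_mono[OF k, of s B] s A by simp
      fix y :: real assume y: "0 < y"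
      show "?c * \<bar>integral UNIV (\<lambda>r. U r * h r)\<bar> \<le> (y * E + ?c * (?L B - ?L s) / y) / 2"
        unfolding E_def
      proof (rule average_energy_bound[OF sh k H10 U u _ \<theta>(1-4) _ _ _ _ y])
        show "compact_test A B h" using h(1) s by (intro compact_test_mono[OF h(1)]) auto
        show "h r + - 1 * h' r = h r" if "A < r" "r < B" for r
          using compact_test_outside[OF h'(1), of r] that by simp
        show "s \<le> r \<and> r \<le> B" if "A < r" "r < B" "\<theta> r \<noteq> 0" for r
          using \<theta>(5)[of r] that s by force
      qed (use s A in auto)
    qed
    then show "\<exists>t\<in>{s..s'}. \<bar>integral UNIV (\<lambda>t. U t * h t)\<bar> \<le> K * sqrt (?L B - ?L t)"
      using s by (intro bexI[of _ s]) auto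
  qed
  have left: "\<bar>U r\<bar> \<le> K * sqrt (?L r - ?L A)" if A0: "0 < A" and r: "A < r" "r < B" for r
  proof (rule pointwise_bound_from_averages[OF U _ _ r])
    show "continuous_on {A<..<B} (\<lambda>r. K * sqrt (?L r - ?L A))" by (intro continuous_intros contL)
    fix s s' h
    assume s: "A < s" "s < s'" "s' < B" and h: "compact_test s s' h" "\<And>t. 0 \<le> h t" "integral UNIV h = 1"
    obtain h' where h': "compact_test 0 A h'" "\<And>t. 0 \<le> h' t" "integral UNIV h' = 1"
      by (rule unit_bump_exists[OF A0]) (rule that)
    obtain \<theta> where \<theta>: "compact_test 0 B \<theta>" "compact_test 0 B (\<lambda>t. h t + (-1) * h' t)"
      "\<And>t. (\<theta> has_real_derivative (h t + (-1) * h' t)) (at t)" "\<And>t. \<bar>\<theta> t\<bar> \<le> 1"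
      "\<And>t. t \<le> min s 0 \<Longrightarrow> \<theta> t = 0" "\<And>t. max s' A \<le> t \<Longrightarrow> \<theta> t = 0"
      by (rule unit_bump_difference[OF h h', of B]) (use s A in auto)
    have "\<bar>integral UNIV (\<lambda>r. U r * h r)\<bar> \<le> K * sqrt (?L s' - ?L A)"
    proof (rule opt)
      show "0 < ?L s' - ?L A" using radial_harmonic_strict_mono[OF k A0, of s'] s by simp
      fix y :: real assume y: "0 < y"
      show "?c * \<bar>integral UNIV (\<lambda>r. U r * h r)\<bar> \<le> (y * E + ?c * (?L s' - ?L A) / y) / 2"
        unfolding E_def
      proof (rule average_energy_bound[OF sh k H10 U u _ \<theta>(1-4) _ A0 _ _ y])
        show "compact_test A B h" using h(1) s by (intro compact_test_mono[OF h(1)]) auto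
        show "h r + - 1 * h' r = h r" if "A < r" "r < B" for r
          using compact_test_outside[OF h'(1), of r] that by simp
        show "A \<le> r \<and> r \<le> s'" if "A < r" "r < B" "\<theta> r \<noteq> 0" for r
          using \<theta>(6)[of r] that s by force
      qed (use s in auto)
    qed
    then show "\<exists>t\<in>{s..s'}. \<bar>integral UNIV (\<lambda>t. U t * h t)\<bar> \<le> K * sqrt (?L t - ?L A)"
      using s by (intro bexI[of _ s']) auto
  qed
  have sq: "z\<^sup>2 \<le> (K\<^sup>2 + 1) * q" if z: "\<bar>z\<bar> \<le> K * sqrt q" and q: "0 \<le> q" for z q :: real
  proof -
    have "z\<^sup>2 \<le> (K * sqrt q)\<^sup>2" using power_mono[OF z abs_ge_zero, of 2] by simp
    also have "\<dots> = K\<^sup>2 * q" using q by (simp add: power_mult_distrib)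
    also have "\<dots> \<le> (K\<^sup>2 + 1) * q" using q by (intro mult_right_mono) auto
    finally show ?thesis .
  qed
  show ?thesis unfolding small_at_ends_def
  proof (intro exI[of _ "K\<^sup>2 + 1"] conjI ballI impI)
    show "0 < K\<^sup>2 + 1" by (simp add: add_nonneg_pos)
    fix r assume "r \<in> {A<..<B}"
    then have r: "A < r" "r < B" by auto
    have "?L r < ?L B" using radial_harmonic_strict_mono[OF k, of r B] r A by simp
    then show "(U r)\<^sup>2 \<le> (K\<^sup>2 + 1) * (?L B - ?L r)" by (intro sq right r) simp
    assume A0: "0 < A"
    have "?L A < ?L r" using radial_harmonic_strict_mono[OF k A0 r(1)] .
    then show "(U r)\<^sup>2 \<le> (K\<^sup>2 + 1) * (?L r - ?L A)" by (intro sq left A0 r) simp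
  qed
qed

lemma radial_test_function:
  assumes sh: "radial_shell (\<Omega> :: 'a::euclidean_space set) A B" and \<psi>: "compact_test A B \<psi>"
  shows "(\<lambda>x. \<psi> (norm x)) \<in> test_functions \<Omega>"
proof -
  have A: "0 \<le> A" using sh by (auto simp: radial_shell_def)
  obtain c d where cd: "A < c" "c < d" "d < B" "\<And>t. t \<le> c \<Longrightarrow> \<psi> t = 0" "\<And>t. d \<le> t \<Longrightarrow> \<psi> t = 0"
    by (rule compact_testE[OF \<psi>]) (rule that)
  let ?S = "{x::'a. c \<le> norm x \<and> norm x \<le> d}"
  have cl: "closed ?S" by (intro closed_Collect_conj closed_Collect_le continuous_intros)
  have "c < norm x \<and> norm x < d" if "\<psi> (norm x) \<noteq> 0" for x :: 'a
    using cd(4)[of "norm x"] cd(5)[of "norm x"] that by force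
  then have "{x. \<psi> (norm x) \<noteq> 0} \<subseteq> ?S" by (auto intro: less_imp_le)
  then have sub: "closure {x. \<psi> (norm x) \<noteq> 0} \<subseteq> ?S" by (rule closure_minimal[OF _ cl])
  have "bounded ?S" by (rule bounded_subset[OF bounded_cball[of 0 d]]) auto
  then have "compact (closure {x::'a. \<psi> (norm x) \<noteq> 0})"
    unfolding compact_eq_bounded_closed using bounded_subset[OF _ sub] closed_closure by blast
  moreover have "?S \<subseteq> \<Omega>"
  proof
    fix x assume "x \<in> ?S"
    then have "x \<noteq> 0" "A < norm x" "norm x < B" using cd A by auto
    then show "x \<in> \<Omega>" using sh by (auto simp: radial_shell_def)
  qed
  ultimately show ?thesis
    using sub times_cont_diff_radial[OF \<psi> A] by (auto simp: test_functions_def)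
qed

text \<open>
  Radial test functions turn the weak equation into a one-dimensional one. The weak gradient \<open>G\<close>
  of \<open>u\<close> is not known to be radial, but it enters only through \<open>\<integral> \<psi>'(r) G \<bullet> x / r\<close>, which the
  divergence identity with \<open>\<theta> = r\<^sup>k \<psi>'\<close> expresses by \<open>u\<close> itself.
\<close>

lemma weak_solution_radial_ode:
  fixes u :: "nat \<Rightarrow> 'a::euclidean_space \<Rightarrow> real"
  assumes sh: "radial_shell \<Omega> A B" and sol: "weak_solution \<Omega> \<beta> N u" and j: "j \<in> {1..N}"
    and U: "\<And>i. i \<in> {1..N} \<Longrightarrow> continuous_on {A<..<B} (U i)"
    and u: "\<And>i x. i \<in> {1..N} \<Longrightarrow> x \<in> \<Omega> \<Longrightarrow> x \<noteq> 0 \<Longrightarrow> u i x = U i (norm x)"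
  obtains p where "radial_ode (DIM('a) - 1) {A<..<B}
    (\<lambda>r. 1 - (U j r)\<^sup>2 - \<beta> * (\<Sum>i\<in>{1..N} - {j}. (U i r)\<^sup>2)) (U j) p"
proof -
  let ?k = "DIM('a) - 1" and ?M = "lebesgue_on \<Omega>" and ?c = "sphere_area TYPE('a)"
  have A: "0 \<le> A" "A < B" "open \<Omega>" "bounded \<Omega>" using sh by (auto simp: radial_shell_def)
  define V where "V = (\<lambda>r. 1 - (U j r)\<^sup>2 - \<beta> * (\<Sum>i\<in>{1..N} - {j}. (U i r)\<^sup>2))"
  have contV: "continuous_on {A<..<B} V" unfolding V_def
    using U j by (intro continuous_intros) auto
  obtain G where G: "H10_gradient \<Omega> (u j) G" and weak: "\<And>\<phi>. \<phi> \<in> test_functions \<Omega> \<Longrightarrow>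
       (LINT x|?M. G x \<bullet> grad \<phi> x + u j x * \<phi> x) =
       (LINT x|?M. (u j x ^ 3 + \<beta> * (\<Sum>i\<in>{1..N} - {j}. u j x * (u i x)\<^sup>2)) * \<phi> x)"
    using sol j unfolding weak_solution_def by blast
  have contH: "continuous_on {A<..<B} (\<lambda>r. r ^ ?k * V r * U j r)"
    by (intro continuous_intros contV U j)
  obtain p where p: "\<And>t. A < t \<Longrightarrow> t < B \<Longrightarrow> (U j has_real_derivative p t / t ^ ?k) (at t)"
    "\<And>t. A < t \<Longrightarrow> t < B \<Longrightarrow> (p has_real_derivative t ^ ?k * V t * U j t) (at t)"
  proof (rule weak_radial_equation[OF A(1,2) U[OF j] contH, of ?k])
    fix \<psi> \<eta> \<eta>'
    assume \<psi>: "compact_test A B \<psi>" and \<eta>: "compact_test A B \<eta>" "compact_test A B \<eta>'"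
      and d\<psi>: "\<And>t. (\<psi> has_real_derivative \<eta> t / t ^ ?k) (at t)"
      and d\<eta>: "\<And>t. (\<eta> has_real_derivative \<eta>' t) (at t)"
    let ?\<phi> = "\<lambda>x::'a. \<psi> (norm x)"
    define C where "C = (\<lambda>x::'a. (\<eta> (norm x) / norm x ^ DIM('a)) *\<^sub>R x)"
    have grad: "grad ?\<phi> x = C x" for x
    proof -
      have "DIM('a) = Suc ?k" using DIM_positive[where 'a='a] by linarith
      then have "norm x ^ DIM('a) = norm x ^ ?k * norm x" by (metis power_Suc2)
      then show ?thesis
        using grad_eq[OF radial_test_GDERIV[OF \<psi> A(1) d\<psi>, of x]] by (simp add: C_def)
    qed
    have \<eta>m: "compact_test 0 B \<eta>" "compact_test 0 B \<eta>'"
      using A by (auto intro: compact_test_mono[OF \<eta>(1)] compact_test_mono[OF \<eta>(2)])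
    note D = radial_divergence[OF G A(3,4) \<eta>m d\<eta>]
    have z: "\<psi> 0 = 0" "\<eta>' 0 = 0"
      using A compact_test_outside[OF \<psi>, of 0] compact_test_outside[OF \<eta>(2), of 0] by auto
    have S1: "(LINT x|?M. u j x * (\<eta>' (norm x) / norm x ^ ?k)) = ?c * integral UNIV (\<lambda>r. U j r * \<eta>' r)"
      by (rule shell_radial_integral(2)[OF sh U[OF j] \<eta>(2)]) (use u[OF j] z in force)
    have kmult: "compact_test A B (\<lambda>t. t ^ ?k * \<psi> t)" by (rule compact_test_mult[OF \<psi> smooth_power])
    have S2: "integrable ?M (\<lambda>x. u j x * \<psi> (norm x))"
      "(LINT x|?M. u j x * \<psi> (norm x)) = ?c * integral UNIV (\<lambda>r. U j r * (r ^ ?k * \<psi> r))"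
    proof -
      have eq: "u j x * \<psi> (norm x) = U j (norm x) * (norm x ^ ?k * \<psi> (norm x)) / norm x ^ ?k" if "x \<in> \<Omega>" for x
        using u[OF j that] z by (cases "x = 0") auto
      show "integrable ?M (\<lambda>x. u j x * \<psi> (norm x))"
        by (rule shell_radial_integral(1)[OF sh U[OF j] kmult eq])
      show "(LINT x|?M. u j x * \<psi> (norm x)) = ?c * integral UNIV (\<lambda>r. U j r * (r ^ ?k * \<psi> r))"
        by (rule shell_radial_integral(2)[OF sh U[OF j] kmult eq])
    qed
    have contVU: "continuous_on {A<..<B} (\<lambda>r. (1 - V r) * U j r)"
      by (intro continuous_intros contV U j)
    have S3: "(LINT x|?M. (u j x ^ 3 + \<beta> * (\<Sum>i\<in>{1..N} - {j}. u j x * (u i x)\<^sup>2)) * ?\<phi> x) =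
      ?c * integral UNIV (\<lambda>r. (1 - V r) * U j r * (r ^ ?k * \<psi> r))"
    proof (rule shell_radial_integral(2)[OF sh contVU kmult])
      fix x assume x: "x \<in> \<Omega>"
      show "(u j x ^ 3 + \<beta> * (\<Sum>i\<in>{1..N} - {j}. u j x * (u i x)\<^sup>2)) * ?\<phi> x =
        (1 - V (norm x)) * U j (norm x) * (norm x ^ ?k * \<psi> (norm x)) / norm x ^ ?k"
      proof (cases "x = 0")
        case True
        then show ?thesis using z by simp
      next
        case False
        have "(\<Sum>i\<in>{1..N} - {j}. u j x * (u i x)\<^sup>2) = U j (norm x) * (\<Sum>i\<in>{1..N} - {j}. (U i (norm x))\<^sup>2)"
          unfolding sum_distrib_left using u[OF _ x False] j by (intro sum.cong) auto
        then have "u j x ^ 3 + \<beta> * (\<Sum>i\<in>{1..N} - {j}. u j x * (u i x)\<^sup>2) = (1 - V (norm x)) * U j (norm x)"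
          using u[OF j x False] by (simp add: V_def algebra_simps power3_eq_cube power2_eq_square)
        then show ?thesis using False by simp
      qed
    qed
    have "(LINT x|?M. G x \<bullet> grad ?\<phi> x + u j x * ?\<phi> x) = (LINT x|?M. G x \<bullet> C x) + (LINT x|?M. u j x * ?\<phi> x)"
      unfolding grad using D(2) S2(1) unfolding C_def by (rule Bochner_Integration.integral_add)
    also have "(LINT x|?M. G x \<bullet> C x) = - (?c * integral UNIV (\<lambda>r. U j r * \<eta>' r))"
      using D(3) S1 unfolding C_def by linarith
    finally have "?c * (- integral UNIV (\<lambda>r. U j r * \<eta>' r) + integral UNIV (\<lambda>r. U j r * (r ^ ?k * \<psi> r))) =
      ?c * integral UNIV (\<lambda>r. (1 - V r) * U j r * (r ^ ?k * \<psi> r))"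
      using weak[OF radial_test_function[OF sh \<psi>]] S2(2) S3 by (simp only: distrib_left mult_minus_right)
    then have eq: "- integral UNIV (\<lambda>r. U j r * \<eta>' r) + integral UNIV (\<lambda>r. U j r * (r ^ ?k * \<psi> r)) =
      integral UNIV (\<lambda>r. (1 - V r) * U j r * (r ^ ?k * \<psi> r))"
      using sphere_area_pos[where 'a='a] by simp
    have i1: "(\<lambda>r. U j r * \<eta>' r) integrable_on UNIV" by (rule compact_test_integrable[OF \<eta>(2) U[OF j]])
    have i2: "(\<lambda>r. U j r * (r ^ ?k * \<psi> r)) integrable_on UNIV" by (rule compact_test_integrable[OF kmult U[OF j]])
    have i3: "(\<lambda>r. (1 - V r) * U j r * (r ^ ?k * \<psi> r)) integrable_on UNIV" by (rule compact_test_integrable[OF kmult contVU])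
    have i4: "(\<lambda>r. U j r * \<eta>' r + (-1) * (U j r * (r ^ ?k * \<psi> r))) integrable_on UNIV"
      by (intro integrable_add i1 integrable_on_mult_right i2)
    have "integral UNIV (\<lambda>t. U j t * \<eta>' t - t ^ ?k * V t * U j t * \<psi> t) =
      integral UNIV (\<lambda>r. U j r * \<eta>' r + (-1) * (U j r * (r ^ ?k * \<psi> r))) + 1 * integral UNIV (\<lambda>r. (1 - V r) * U j r * (r ^ ?k * \<psi> r))"
      by (rule integral_lincomb[OF i4 i3]) (simp add: algebra_simps)
    also have "integral UNIV (\<lambda>r. U j r * \<eta>' r + (-1) * (U j r * (r ^ ?k * \<psi> r))) =
      integral UNIV (\<lambda>r. U j r * \<eta>' r) + (-1) * integral UNIV (\<lambda>r. U j r * (r ^ ?k * \<psi> r))"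
      by (rule integral_lincomb[OF i1 i2 refl])
    finally show "integral UNIV (\<lambda>t. U j t * \<eta>' t - t ^ ?k * V t * U j t * \<psi> t) = 0" using eq by linarith
  qed (rule that)
  show thesis
    by (rule that[of p]) (use p in \<open>auto simp: radial_ode_def V_def\<close>)
qed

section \<open>Nodal numbers\<close>

definition profile :: "('a::euclidean_space \<Rightarrow> real) \<Rightarrow> real \<Rightarrow> real" where
  "profile u r = u (r *\<^sub>R (SOME b. b \<in> Basis))"

lemma norm_profile_direction: "norm (r *\<^sub>R (SOME b. b \<in> (Basis :: 'a::euclidean_space set))) = \<bar>r\<bar>"
  using someI_ex[of "\<lambda>b. b \<in> (Basis :: 'a set)"] nonempty_Basis by auto

lemma shell_profile:
  fixes u :: "'a::euclidean_space \<Rightarrow> real"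
  assumes sh: "radial_shell \<Omega> A B" and rad: "radial_on \<Omega> u" and cont: "continuous_on (\<Omega> - {0}) u"
  shows "continuous_on {A<..<B} (profile u)"
    and "x \<in> \<Omega> \<Longrightarrow> x \<noteq> 0 \<Longrightarrow> u x = profile u (norm x)"
proof -
  let ?e = "SOME b. b \<in> (Basis :: 'a set)"
  have in_shell: "r *\<^sub>R ?e \<in> \<Omega> - {0}" if "A < r" "r < B" for r
  proof -
    have "norm (r *\<^sub>R ?e) = r" using norm_profile_direction[of r] that sh by (simp add: radial_shell_def)
    moreover from this have "r *\<^sub>R ?e \<noteq> 0" using that sh by (metis norm_zero radial_shell_def not_less)
    ultimately show ?thesis using sh that by (auto simp: radial_shell_def)
  qed
  show "continuous_on {A<..<B} (profile u)"
    unfolding profile_def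
    by (rule continuous_on_compose2[OF cont]) (use in_shell in \<open>auto intro!: continuous_intros\<close>)
  show "u x = profile u (norm x)" if x: "x \<in> \<Omega>" "x \<noteq> 0"
  proof -
    have "A < norm x" "norm x < B" using x sh by (auto simp: radial_shell_def)
    then have "norm x *\<^sub>R ?e \<in> \<Omega>" using in_shell by blast
    moreover have "norm x = norm (norm x *\<^sub>R ?e)" using norm_profile_direction[of "norm x"] by simp
    ultimately show ?thesis using rad x(1) unfolding radial_on_def profile_def by blast
  qed
qed

lemma nodal_number_profile:
  fixes v :: "'a::euclidean_space \<Rightarrow> real"
  assumes sh: "radial_shell \<Omega> A B" and v: "\<And>x. x \<in> \<Omega> \<Longrightarrow> x \<noteq> 0 \<Longrightarrow> v x = V (norm x)"
  shows "nodal_number \<Omega> v = (GREATEST k. \<exists>r. alternates {A<..<B} V k r)"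
proof -
  have sphere: "sphere (0::'a) r \<subseteq> \<Omega> \<longleftrightarrow> A < r \<and> r < B" if r: "0 < r" for r
  proof
    obtain b :: 'a where "b \<in> Basis" using nonempty_Basis by blast
    then have b: "norm (r *\<^sub>R b) = r" using r by simp
    moreover assume "sphere (0::'a) r \<subseteq> \<Omega>"
    ultimately have "r *\<^sub>R b \<in> \<Omega>" "r *\<^sub>R b \<noteq> 0" using r by auto
    then show "A < r \<and> r < B" using sh b by (metis radial_shell_def)
  next
    assume "A < r \<and> r < B"
    then have "x \<in> \<Omega>" if "norm x = r" for x
      using that sh r unfolding radial_shell_def by (metis norm_zero order_less_irrefl)
    then show "sphere (0::'a) r \<subseteq> \<Omega>" by auto
  qed
  have vals: "(\<forall>y\<in>sphere 0 r. \<forall>z\<in>sphere 0 s. v y * v z < 0) \<longleftrightarrow> V r * V s < 0"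
    if "0 < r" "sphere (0::'a) r \<subseteq> \<Omega>" "0 < s" "sphere (0::'a) s \<subseteq> \<Omega>" for r s
  proof -
    have "v y = V r" if "y \<in> sphere 0 r" for y
      using v[of y] that \<open>0 < r\<close> \<open>sphere 0 r \<subseteq> \<Omega>\<close> by auto
    moreover have "v y = V s" if "y \<in> sphere 0 s" for y
      using v[of y] that \<open>0 < s\<close> \<open>sphere 0 s \<subseteq> \<Omega>\<close> by auto
    moreover have "sphere (0::'a) r \<noteq> {}" "sphere (0::'a) s \<noteq> {}" using that by auto
    ultimately show ?thesis by fastforce
  qed
  have "(\<exists>r::nat \<Rightarrow> real. 0 < r 0 \<and> (\<forall>j<k. r j < r (Suc j)) \<and> (\<forall>j\<le>k. sphere (0::'a) (r j) \<subseteq> \<Omega>) \<and>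
        (\<forall>j<k. \<forall>y\<in>sphere 0 (r j). \<forall>z\<in>sphere 0 (r (Suc j)). v y * v z < 0)) \<longleftrightarrow>
      (\<exists>r. alternates {A<..<B} V k r)" (is "?L \<longleftrightarrow> ?R") for k
  proof
    assume ?L
    then obtain r :: "nat \<Rightarrow> real" where r: "0 < r 0" "\<And>j. j < k \<Longrightarrow> r j < r (Suc j)"
      "\<And>j. j \<le> k \<Longrightarrow> sphere (0::'a) (r j) \<subseteq> \<Omega>"
      "\<And>j. j < k \<Longrightarrow> \<forall>y\<in>sphere 0 (r j). \<forall>z\<in>sphere 0 (r (Suc j)). v y * v z < 0" by blast
    have pos: "0 < r j" if "j \<le> k" for j
      using that by (induction j) (use r(1,2) in \<open>auto simp: Suc_le_eq intro: less_trans\<close>)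
    have "alternates {A<..<B} V k r" unfolding alternates_def
    proof (intro conjI allI impI)
      show "r j < r (Suc j)" if "j < k" for j by (rule r(2)[OF that])
      show "r j \<in> {A<..<B}" if "j \<le> k" for j using sphere[OF pos[OF that]] r(3)[OF that] by simp
      show "V (r j) * V (r (Suc j)) < 0" if "j < k" for j
        using vals[of "r j" "r (Suc j)"] pos[of j] pos[of "Suc j"] r(3)[of j] r(3)[of "Suc j"] r(4)[OF that] that
        by simp
    qed
    then show ?R by blast
  next
    assume ?R
    then obtain r where r: "alternates {A<..<B} V k r" by blast
    have A: "0 \<le> A" using sh by (simp add: radial_shell_def)
    have pos: "0 < r j" "sphere (0::'a) (r j) \<subseteq> \<Omega>" if "j \<le> k" for j
    proof -
      show "0 < r j" using r that A by (force simp: alternates_def)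
      then show "sphere (0::'a) (r j) \<subseteq> \<Omega>" using sphere r that by (auto simp: alternates_def)
    qed
    show ?L
    proof (intro exI[of _ r] conjI allI impI)
      show "0 < r 0" using pos(1) by simp
      show "r j < r (Suc j)" if "j < k" for j using r that by (simp add: alternates_def)
      show "sphere (0::'a) (r j) \<subseteq> \<Omega>" if "j \<le> k" for j using pos(2)[OF that] .
      show "\<forall>y\<in>sphere 0 (r j). \<forall>z\<in>sphere 0 (r (Suc j)). v y * v z < 0" if "j < k" for j
        using vals[of "r j" "r (Suc j)"] pos[of j] pos[of "Suc j"] r that by (simp add: alternates_def)
    qed
  qed
  then show ?thesis unfolding nodal_number_def by simp
qed

lemma alternates_0: "x \<in> I \<Longrightarrow> alternates I z 0 (\<lambda>_. x)"
  by (simp add: alternates_def)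

lemma sign_change_alternates:
  assumes "x \<in> I" "y \<in> I" "z x * z y < 0"
  shows "\<exists>r. alternates I z 1 r"
proof -
  have ne: "x \<noteq> y" using assms(3) by (metis not_square_less_zero)
  have "alternates I z 1 (\<lambda>j. if j = 0 then min x y else max x y)"
    using assms ne by (auto simp: alternates_def min_def max_def mult.commute)
  then show ?thesis by blast
qed

lemma small_at_ends_potential_bound:
  assumes "small_at_ends k A B z" and k: "k \<in> {1, 2}" and A: "0 \<le> A" "A < B"
  obtains C where "0 < C" "\<And>r. A < r \<Longrightarrow> r < B \<Longrightarrow> (z r)\<^sup>2 \<le> C / r"
proof -
  obtain K where K: "K > 0" "\<And>r. A < r \<Longrightarrow> r < B \<Longrightarrow> (z r)\<^sup>2 \<le> K * (radial_harmonic k B - radial_harmonic k r)"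
    using assms(1) unfolding small_at_ends_def by auto
  have "(z r)\<^sup>2 \<le> (K * max 1 B) / r" if r: "A < r" "r < B" for r
  proof -
    have "K * (radial_harmonic k B - radial_harmonic k r) \<le> K * (max 1 B / r)"
      using radial_harmonic_bound[OF k, of r B] r A K(1) by (intro mult_left_mono) auto
    then show ?thesis using K(2)[OF r] by simp
  qed
  then show thesis using K(1) by (intro that[of "K * max 1 B"]) auto
qed

text \<open>
  Sign changes do not accumulate: for \<open>f\<close>, \<open>g\<close> and \<open>f - g\<close> the only terms that push the potential
  down are quadratic in \<open>f\<close> and \<open>g\<close>, hence of order \<open>1 / r\<close>. So the maxima in the definition of
  the nodal numbers exist.
\<close>

lemma competing_pair_finite_nodal:
  assumes pair: "competing_pair k {A<..<B} \<beta> S f p g q" and \<beta>: "\<beta> \<le> -1"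
    and S: "\<And>r. 0 \<le> S r" and k: "k \<in> {1, 2}" and A: "0 \<le> A" "A < B"
    and small: "small_at_ends k A B f" "small_at_ends k A B g"
  obtains M where "\<And>m r. alternates {A<..<B} f m r \<Longrightarrow> m \<le> M"
    "\<And>m r. alternates {A<..<B} g m r \<Longrightarrow> m \<le> M"
    "\<And>m r. alternates {A<..<B} (\<lambda>r. f r - g r) m r \<Longrightarrow> m \<le> M"
proof -
  obtain Cf where Cf: "0 < Cf" "\<And>r. A < r \<Longrightarrow> r < B \<Longrightarrow> (f r)\<^sup>2 \<le> Cf / r"
    by (rule small_at_ends_potential_bound[OF small(1) k A]) (rule that)
  obtain Cg where Cg: "0 < Cg" "\<And>r. A < r \<Longrightarrow> r < B \<Longrightarrow> (g r)\<^sup>2 \<le> Cg / r"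
    by (rule small_at_ends_potential_bound[OF small(2) k A]) (rule that)
  have k1: "1 \<le> k" using k by auto
  have neg: "\<beta> * x \<le> 0" if "0 \<le> x" for x using \<beta> that by (simp add: mult_nonpos_nonneg)
  have odef: "radial_ode k {A<..<B} (\<lambda>r. 1 - (f r)\<^sup>2 - \<beta> * (g r)\<^sup>2 - \<beta> * S r) f p"
    and odeg: "radial_ode k {A<..<B} (\<lambda>r. 1 - (g r)\<^sup>2 - \<beta> * (f r)\<^sup>2 - \<beta> * S r) g q"
    using pair by (auto simp: competing_pair_def)
  obtain Mf where Mf: "\<And>m r. alternates {A<..<B} f m r \<Longrightarrow> m \<le> Mf"
  proof (rule alternates_bounded[OF odef k1 A(1) Cf(1)])
    fix r assume r: "A < r" "r < B"
    show "- Cf / r \<le> 1 - (f r)\<^sup>2 - \<beta> * (g r)\<^sup>2 - \<beta> * S r"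
      using Cf(2)[OF r] neg[of "(g r)\<^sup>2"] neg[OF S[of r]] by simp
  qed (rule that)
  obtain Mg where Mg: "\<And>m r. alternates {A<..<B} g m r \<Longrightarrow> m \<le> Mg"
  proof (rule alternates_bounded[OF odeg k1 A(1) Cg(1)])
    fix r assume r: "A < r" "r < B"
    show "- Cg / r \<le> 1 - (g r)\<^sup>2 - \<beta> * (f r)\<^sup>2 - \<beta> * S r"
      using Cg(2)[OF r] neg[of "(f r)\<^sup>2"] neg[OF S[of r]] by simp
  qed (rule that)
  define C where "C = (1 + (1 - \<beta>) / 2) * (Cf + Cg)"
  have C: "0 < C" unfolding C_def using Cf(1) Cg(1) \<beta> by (intro mult_pos_pos add_pos_pos) auto
  obtain Mw where Mw: "\<And>m r. alternates {A<..<B} (\<lambda>r. f r - g r) m r \<Longrightarrow> m \<le> Mw"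
  proof (rule alternates_bounded[OF competing_pair_diff[OF pair] k1 A(1) C])
    fix r assume r: "A < r" "r < B"
    have "2 * (f r * g r) \<le> (f r)\<^sup>2 + (g r)\<^sup>2"
      using sum_squares_bound[of "f r" "g r"] by simp
    then have "(1 - \<beta>) / 2 * (2 * (f r * g r)) \<le> (1 - \<beta>) / 2 * ((f r)\<^sup>2 + (g r)\<^sup>2)"
      using \<beta> by (intro mult_left_mono) auto
    then have "(1 - \<beta>) * (f r * g r) \<le> (1 - \<beta>) / 2 * ((f r)\<^sup>2 + (g r)\<^sup>2)" by simp
    then have "(f r)\<^sup>2 + (g r)\<^sup>2 + (1 - \<beta>) * (f r * g r) \<le> (1 + (1 - \<beta>) / 2) * ((f r)\<^sup>2 + (g r)\<^sup>2)"
      unfolding distrib_right[of 1] mult_1 by linarith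
    also have "\<dots> \<le> (1 + (1 - \<beta>) / 2) * ((Cf + Cg) / r)"
      using Cf(2)[OF r] Cg(2)[OF r] \<beta> by (intro mult_left_mono) (auto simp: add_divide_distrib)
    also have "\<dots> = C / r" by (simp add: C_def)
    finally show "- C / r \<le> 1 - ((f r)\<^sup>2 + (g r)\<^sup>2 + (1 - \<beta>) * (f r * g r) + \<beta> * S r)"
      using neg[OF S[of r]] by simp
  qed (rule that)
  show thesis
  proof (rule that[of "Mf + Mg + Mw"])
    show "m \<le> Mf + Mg + Mw" if "alternates {A<..<B} f m r" for m r using Mf[OF that] by simp
    show "m \<le> Mf + Mg + Mw" if "alternates {A<..<B} g m r" for m r using Mg[OF that] by simp
    show "m \<le> Mf + Mg + Mw" if "alternates {A<..<B} (\<lambda>r. f r - g r) m r" for m r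
      using Mw[OF that] by simp
  qed
qed

theorem theorem1p3:
  fixes \<Omega> :: "(real ^ 'n) set" and \<beta> :: real and N :: nat
    and u :: "nat \<Rightarrow> real ^ 'n \<Rightarrow> real"
  assumes dim: "CARD('n) \<in> {2, 3}"
    and dom: "radial_domain \<Omega>"
    and beta: "\<beta> \<le> -1"
    and sol: "radial_solution \<Omega> \<beta> N u"
    and nontriv: "nontrivial \<Omega> N u"
    and idx: "i1 \<in> {1..N}" "i2 \<in> {1..N}" "i1 \<noteq> i2"
  shows "(nodal_number \<Omega> (u i1) = 0 \<and> nodal_number \<Omega> (u i2) = 0 \<and>
            (\<forall>x\<in>\<Omega> - {0}. u i1 x * u i2 x \<ge> 0) \<longrightarrow>
            nodal_number \<Omega> (\<lambda>x. u i1 x - u i2 x) \<ge> 1) \<and>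
         (nodal_number \<Omega> (u i1) \<noteq> 0 \<or> nodal_number \<Omega> (u i2) \<noteq> 0 \<longrightarrow>
            int (nodal_number \<Omega> (\<lambda>x. u i1 x - u i2 x)) \<ge>
              \<lfloor>(real (min (nodal_number \<Omega> (u i1)) (nodal_number \<Omega> (u i2))) - 1) / 2\<rfloor>)"
proof -
  define k where "k = DIM(real ^ 'n) - 1"
  have k: "k \<in> {1, 2}" using dim by (auto simp: k_def)
  obtain A B where sh: "radial_shell \<Omega> A B" using radial_domain_shell[OF dom] .
  have A: "0 \<le> A" "A < B" using sh by (auto simp: radial_shell_def)
  define U where "U = (\<lambda>i. profile (u i))"
  have U: "continuous_on {A<..<B} (U i)" "\<And>x. x \<in> \<Omega> \<Longrightarrow> x \<noteq> 0 \<Longrightarrow> u i x = U i (norm x)"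
    if "i \<in> {1..N}" for i
    using shell_profile[OF sh, of "u i"] sol that unfolding U_def radial_solution_def by blast+
  have weak: "weak_solution \<Omega> \<beta> N u" using sol by (simp add: radial_solution_def)
  have small: "small_at_ends k A B (U i)" if i: "i \<in> {1..N}" for i
  proof -
    obtain G where "H10_gradient \<Omega> (u i) G" using weak i unfolding weak_solution_def by blast
    then show ?thesis unfolding k_def
      by (rule radial_H10_small_at_ends[OF sh k[unfolded k_def] _ U[OF i]])
  qed
  have ode: "\<exists>p. radial_ode k {A<..<B} (\<lambda>r. 1 - (U i r)\<^sup>2 - \<beta> * (\<Sum>l\<in>{1..N} - {i}. (U l r)\<^sup>2)) (U i) p"
    if i: "i \<in> {1..N}" for i
    using weak_solution_radial_ode[OF sh weak i U] unfolding k_def by metis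
  have nonzero: "\<exists>r\<in>{A<..<B}. U i r \<noteq> 0" if i: "i \<in> {1..N}" for i
  proof (rule ccontr)
    assume zero: "\<not> (\<exists>r\<in>{A<..<B}. U i r \<noteq> 0)"
    have "u i x = 0" if "x \<in> \<Omega>" "x \<noteq> 0" for x
      using U(2)[OF i that] zero that sh by (auto simp: radial_shell_def)
    moreover have "AE x in lebesgue_on \<Omega>. x \<noteq> 0"
    proof -
      have "AE x in lebesgue. x \<noteq> (0 :: real ^ 'n)"
        by (rule AE_completion) (rule AE_lborel_singleton)
      then show ?thesis
        using sh by (subst AE_restrict_space_iff) (auto simp: radial_shell_def)
    qed
    moreover have "AE x in lebesgue_on \<Omega>. x \<in> \<Omega>" by (rule AE_I2) simp
    ultimately have "AE x in lebesgue_on \<Omega>. u i x = 0"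
      by (auto elim!: eventually_elim2)
    then show False using nontriv i by (auto simp: nontrivial_def)
  qed
  \<comment> \<open>All components other than the two in question act on both of them through the same sum \<open>S\<close>.\<close>
  define f g where "f = U i1" and "g = U i2"
  define S where "S = (\<lambda>r. \<Sum>l\<in>{1..N} - {i1, i2}. (U l r)\<^sup>2)"
  have S: "0 \<le> S r" for r by (simp add: S_def sum_nonneg)
  have contS: "continuous_on {A<..<B} S" unfolding S_def
    using U(1) by (intro continuous_intros) auto
  have split1: "(\<Sum>l\<in>{1..N} - {i1}. (U l r)\<^sup>2) = (g r)\<^sup>2 + S r" for r
  proof -
    have eq: "{1..N} - {i1} = insert i2 ({1..N} - {i1, i2})" using idx by auto
    show ?thesis unfolding eq S_def g_def by (rule sum.insert) auto
  qed
  have split2: "(\<Sum>l\<in>{1..N} - {i2}. (U l r)\<^sup>2) = (f r)\<^sup>2 + S r" for r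
  proof -
    have eq: "{1..N} - {i2} = insert i1 ({1..N} - {i1, i2})" using idx by auto
    show ?thesis unfolding eq S_def f_def by (rule sum.insert) auto
  qed
  have expand: "1 - x\<^sup>2 - \<beta> * (y\<^sup>2 + s) = 1 - x\<^sup>2 - \<beta> * y\<^sup>2 - \<beta> * s" for x y s :: real
    unfolding distrib_left by linarith
  obtain p where p: "radial_ode k {A<..<B} (\<lambda>r. 1 - (f r)\<^sup>2 - \<beta> * (g r)\<^sup>2 - \<beta> * S r) f p"
    using ode[OF idx(1)] unfolding split1 expand by (auto simp only: f_def)
  obtain q where q: "radial_ode k {A<..<B} (\<lambda>r. 1 - (g r)\<^sup>2 - \<beta> * (f r)\<^sup>2 - \<beta> * S r) g q"
    using ode[OF idx(2)] unfolding split2 expand by (auto simp only: g_def)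
  have pair: "competing_pair k {A<..<B} \<beta> S f p g q" using p q by (simp only: competing_pair_def)
  have fx: "u i1 x = f (norm x)" and gx: "u i2 x = g (norm x)" if "x \<in> \<Omega>" "x \<noteq> 0" for x
    using U(2)[OF idx(1) that] U(2)[OF idx(2) that] by (simp_all add: f_def g_def)
  define n where "n = (\<lambda>z. GREATEST m. \<exists>r. alternates {A<..<B} z m r)"
  have nf: "nodal_number \<Omega> (u i1) = n f" and ng: "nodal_number \<Omega> (u i2) = n g"
    and nw: "nodal_number \<Omega> (\<lambda>x. u i1 x - u i2 x) = n (\<lambda>r. f r - g r)"
    unfolding n_def using fx gx by (intro nodal_number_profile[OF sh]; simp)+
  have smallfg: "small_at_ends k A B f" "small_at_ends k A B g"
    using small idx by (simp_all add: f_def g_def)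
  obtain M where M: "\<forall>m r. alternates {A<..<B} f m r \<longrightarrow> m \<le> M"
    "\<forall>m r. alternates {A<..<B} g m r \<longrightarrow> m \<le> M"
    "\<forall>m r. alternates {A<..<B} (\<lambda>r. f r - g r) m r \<longrightarrow> m \<le> M"
    by (rule competing_pair_finite_nodal[OF pair beta S k A smallfg]) (rule that; blast)
  have upper: "m \<le> n z" if "alternates {A<..<B} z m r" "\<forall>m r. alternates {A<..<B} z m r \<longrightarrow> m \<le> M" for z m r
    unfolding n_def using that by (intro Greatest_le_nat[of _ m M]) blast+
  have attained: "\<exists>r. alternates {A<..<B} z (n z) r" if "\<forall>m r. alternates {A<..<B} z m r \<longrightarrow> m \<le> M" for z
  proof -
    have "(A + B) / 2 \<in> {A<..<B}" using A by auto
    then have "\<exists>r. alternates {A<..<B} z 0 r" using alternates_0 by blast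
    then show ?thesis unfolding n_def by (rule GreatestI_nat[of _ 0 M]) (use that in blast)
  qed
  show ?thesis unfolding nf ng nw
  proof (intro conjI impI; (elim conjE)?)
    assume f0: "n f = 0" and g0: "n g = 0" and sgn: "\<forall>x\<in>\<Omega> - {0}. 0 \<le> u i1 x * u i2 x"
    have no_change: "\<forall>x\<in>{A<..<B}. \<forall>y\<in>{A<..<B}. 0 \<le> z x * z y"
      if "n z = 0" "\<forall>m r. alternates {A<..<B} z m r \<longrightarrow> m \<le> M" for z
    proof (intro ballI, rule ccontr)
      fix x y assume "x \<in> {A<..<B}" "y \<in> {A<..<B}" "\<not> 0 \<le> z x * z y"
      then obtain r where "alternates {A<..<B} z 1 r" using sign_change_alternates[of x _ y z] by fastforce
      then show False using upper[OF _ that(2)] that(1) by fastforce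
    qed
    have "0 \<le> f r * g r" if r: "r \<in> {A<..<B}" for r
    proof -
      define x :: "real ^ 'n" where "x = r *\<^sub>R (SOME b. b \<in> Basis)"
      have nx: "norm x = r" using norm_profile_direction[of r] r A by (simp add: x_def)
      then have x0: "x \<noteq> 0" using r A by auto
      then have x\<Omega>: "x \<in> \<Omega>" using nx r sh by (simp add: radial_shell_def)
      have "0 \<le> u i1 x * u i2 x" using sgn x0 x\<Omega> by blast
      then show ?thesis using fx[OF x\<Omega> x0] gx[OF x\<Omega> x0] nx by simp
    qed
    then have "\<exists>x\<in>{A<..<B}. \<exists>y\<in>{A<..<B}. (f x - g x) * (f y - g y) < 0"
      using nonzero idx
      by (intro difference_changes_sign[OF pair beta S contS k A smallfg _ _ no_change[OF f0 M(1)] no_change[OF g0 M(2)]])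
         (auto simp: f_def g_def)
    then obtain r where "alternates {A<..<B} (\<lambda>r. f r - g r) 1 r"
      using sign_change_alternates[of _ "{A<..<B}" _ "\<lambda>r. f r - g r"] by blast
    then show "1 \<le> n (\<lambda>r. f r - g r)" by (rule upper[OF _ M(3)])
  next
    \<comment> \<open>\<open>n g - 2\<close> sign changes already suffice, since \<open>[(m - 1) / 2] \<le> m - 2\<close> for \<open>m \<ge> 3\<close>.\<close>
    have lower: "n g - 2 \<le> n (\<lambda>r. f r - g r)"
    proof (cases "2 \<le> n g")
      case True
      obtain r where "alternates {A<..<B} g (n g) r" using attained[OF M(2)] by blast
      then obtain t where "alternates {A<..<B} (\<lambda>r. f r - g r) (n g - 2) t"
        by (rule alternates_difference[OF pair beta A(1) S _ True]) (rule that)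
      then show ?thesis by (rule upper[OF _ M(3)])
    qed simp
    define m where "m = min (n f) (n g)"
    have m: "m - 2 \<le> n (\<lambda>r. f r - g r)" using lower by (simp add: m_def)
    have "(real m - 1) / 2 < real (n (\<lambda>r. f r - g r)) + 1"
    proof (cases "m \<le> 2")
      case True
      then have "real m \<le> 2" by simp
      then show ?thesis by simp
    next
      case False
      then have "real m - 2 \<le> real (n (\<lambda>r. f r - g r))" using m by linarith
      moreover have "2 < real m" using False by simp
      ultimately show ?thesis by (simp add: field_simps)
    qed
    then show "\<lfloor>(real (min (n f) (n g)) - 1) / 2\<rfloor> \<le> int (n (\<lambda>r. f r - g r))"
      unfolding m_def by (simp add: floor_le_iff)
  qed
qed

end
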